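(* Let $G$ be a connected graph with at least two nodes. The facet defining inequalities (in minimum integer form, other than nonnegativity constraints) of Steiner degree at most five for $\mathrm{CUT}_+(G)$ are the inequalities $$x(E(H))\ \ge\ 1$$ for each spanning tree $H$ in $G$ with at most five leaves, and the inequalities $$\sum_{\substack{e\in E(H)\\ e\text{ is in some cycle of }H}} x_e\ +\sum_{\substack{e\in E(H)\\ e\text{ is in no cycle of }H}} 2\,x_e\ \ge\ 2$$ for each spanning cactus $H$ of $G$ for which the number of leaves plus the sum of the defects of the cycles of $H$ is at most five (which in particular implies that $H$ has no more than three cycles).
   Context: Graphs are finite and have no loops or multiple edges. For a connected graph $G$ with node set $V(G)$ and edge set $E(G)$, and $T\subseteq V(G)$ with $|T|\ge 2$: for $S\subseteq V(G)$, $\delta(S)$ is the set of edges with exactly one endnode in $S$, and $\delta(S)$ is a $T$-Steiner cut if $T\cap S\neq\varnothing$ and $T\setminus S\neq\varnothing$. The $T$-Steiner cut dominant is $\mathrm{CUT}_+(G,T)=\mathrm{conv}\{\chi(\delta(S)) : \delta(S)\text{ a }T\text{-Steiner cut}\}+\mathbb{R}_{\ge 0}^{E(G)}$, where $\chi(\cdot)$ denotes the $0/1$ incidence vector in $\mathbb{R}^{E(G)}$. The cut dominant of $G$ is $\mathrm{CUT}_+(G)=\mathrm{CUT}_+(G,V(G))$. For $F\subseteq E(G)$, $x(F)=\sum_{e\in F}x_e$. An inequality $cx\ge\gamma$ is in minimum integer form if the components of $c$ are nonnegative integers with greatest common divisor one. The Steiner degree of an inequality defining a facet of $\mathrm{CUT}_+(G)$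 is the minimum $\tau$ for which there is some $T\subseteq V(G)$ with $|T|=\tau$ such that the inequality defines a facet of $\mathrm{CUT}_+(G,T)$. A cactus is a connected graph with at least one cycle in which every edge is contained in at most one cycle. Leaves are nodes of degree one (in $H$). For a cycle $C$ of a cactus $H$, $\deg(C)$ is the number of nodes of $C$ that are connected (adjacent in $H$) to nodes outside of $C$ (i.e., that are cut nodes of $H$), and the defect of $C$ is $\max\{0,3-\deg(C)\}$. *)

theory Defs
  imports "HOL-Analysis.Analysis"
begin

text \<open>
  A finite graph is given by a map \<open>ends :: 'e \<Rightarrow> 'v set\<close> from a finite type of edges to sets
  of end nodes in a finite type of nodes, so the node set is \<open>UNIV :: 'v set\<close> and
  \<open>\<real>\<^sup>E\<close> is the type \<open>real ^ 'e\<close>.  A spanning subgraph is identified with its edge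
  set \<open>F :: 'e set\<close>.  The edge type is nonempty, which costs no generality for connected
  graphs with at least two nodes.
\<close>

definition simple_graph :: "('e::finite \<Rightarrow> 'v::finite set) \<Rightarrow> bool" where
  "simple_graph ends \<longleftrightarrow> inj ends \<and> (\<forall>e. card (ends e) = 2)"

definition adjacent :: "('e::finite \<Rightarrow> 'v::finite set) \<Rightarrow> 'e set \<Rightarrow> 'v \<Rightarrow> 'v \<Rightarrow> bool" where
  "adjacent ends F u v \<longleftrightarrow> (\<exists>e\<in>F. ends e = {u, v})"

definition connected_spanning :: "('e::finite \<Rightarrow> 'v::finite set) \<Rightarrow> 'e set \<Rightarrow> bool" where
  "connected_spanning ends F \<longleftrightarrow> (\<forall>u v. (adjacent ends F)\<^sup>*\<^sup>* u v)"

text \<open>Cycles are identified with their edge sets.\<close>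

definition is_cycle :: "('e::finite \<Rightarrow> 'v::finite set) \<Rightarrow> 'e set \<Rightarrow> bool" where
  "is_cycle ends C \<longleftrightarrow>
    (\<exists>vs. 3 \<le> length vs \<and> distinct vs \<and>
      ends ` C = {{vs ! i, vs ! (Suc i mod length vs)} | i. i < length vs})"

definition cycles :: "('e::finite \<Rightarrow> 'v::finite set) \<Rightarrow> 'e set \<Rightarrow> 'e set set" where
  "cycles ends F = {C. C \<subseteq> F \<and> is_cycle ends C}"

definition spanning_tree :: "('e::finite \<Rightarrow> 'v::finite set) \<Rightarrow> 'e set \<Rightarrow> bool" where
  "spanning_tree ends F \<longleftrightarrow> connected_spanning ends F \<and> cycles ends F = {}"

definition spanning_cactus :: "('e::finite \<Rightarrow> 'v::finite set) \<Rightarrow> 'e set \<Rightarrow> bool" where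
  "spanning_cactus ends F \<longleftrightarrow> connected_spanning ends F \<and> cycles ends F \<noteq> {} \<and>
    (\<forall>e\<in>F. \<forall>C\<in>cycles ends F. \<forall>D\<in>cycles ends F. e \<in> C \<longrightarrow> e \<in> D \<longrightarrow> C = D)"

definition leaves :: "('e::finite \<Rightarrow> 'v::finite set) \<Rightarrow> 'e set \<Rightarrow> 'v set" where
  "leaves ends F = {v. card {e \<in> F. v \<in> ends e} = 1}"

definition cycle_nodes :: "('e::finite \<Rightarrow> 'v::finite set) \<Rightarrow> 'e set \<Rightarrow> 'v set" where
  "cycle_nodes ends C = (\<Union>e\<in>C. ends e)"

definition cycle_degree :: "('e::finite \<Rightarrow> 'v::finite set) \<Rightarrow> 'e set \<Rightarrow> 'e set \<Rightarrow> nat" where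
  "cycle_degree ends F C =
    card {v \<in> cycle_nodes ends C. \<exists>u. u \<notin> cycle_nodes ends C \<and> adjacent ends F v u}"

text \<open>Truncated subtraction on \<open>nat\<close> is the maximum of zero and the difference.\<close>

definition defect :: "('e::finite \<Rightarrow> 'v::finite set) \<Rightarrow> 'e set \<Rightarrow> 'e set \<Rightarrow> nat" where
  "defect ends F C = 3 - cycle_degree ends F C"

definition cut :: "('e::finite \<Rightarrow> 'v::finite set) \<Rightarrow> 'v set \<Rightarrow> 'e set" where
  "cut ends S = {e. card (ends e \<inter> S) = 1}"

definition incidence_vector :: "'e::finite set \<Rightarrow> real ^ 'e" where
  "incidence_vector F = (\<chi> e. if e \<in> F then 1 else 0)"

definition steiner_cut_dominant ::
  "('e::finite \<Rightarrow> 'v::finite set) \<Rightarrow> 'v set \<Rightarrow> (real ^ 'e) set" where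
  "steiner_cut_dominant ends T =
    {x + y | x y.
      x \<in> convex hull {incidence_vector (cut ends S) | S. T \<inter> S \<noteq> {} \<and> T - S \<noteq> {}} \<and>
      (\<forall>e. 0 \<le> y $ e)}"

definition cut_dominant :: "('e::finite \<Rightarrow> 'v::finite set) \<Rightarrow> (real ^ 'e) set" where
  "cut_dominant ends = steiner_cut_dominant ends UNIV"

text \<open>The inequality \<open>c \<bullet> x \<ge> \<gamma>\<close> is given by the vector \<open>c\<close> and the number \<open>\<gamma>\<close>.\<close>

definition defines_facet :: "(real ^ 'e::finite) set \<Rightarrow> real ^ 'e \<Rightarrow> real \<Rightarrow> bool" where
  "defines_facet P c \<gamma> \<longleftrightarrow> (\<forall>x\<in>P. c \<bullet> x \<ge> \<gamma>) \<and> {x \<in> P. c \<bullet> x = \<gamma>} facet_of P"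

definition minimum_integer_form :: "real ^ 'e::finite \<Rightarrow> bool" where
  "minimum_integer_form c \<longleftrightarrow>
    (\<exists>a :: 'e \<Rightarrow> nat. (\<forall>e. c $ e = real (a e)) \<and> Gcd (range a) = 1)"

text \<open>In minimum integer form, the nonnegativity constraints are the inequalities \<open>x\<^sub>e \<ge> 0\<close>.\<close>

definition nonnegativity_constraint :: "real ^ 'e::finite \<Rightarrow> real \<Rightarrow> bool" where
  "nonnegativity_constraint c \<gamma> \<longleftrightarrow> (\<exists>e. c = axis e 1) \<and> \<gamma> = 0"

definition steiner_degree ::
  "('e::finite \<Rightarrow> 'v::finite set) \<Rightarrow> real ^ 'e \<Rightarrow> real \<Rightarrow> nat" where
  "steiner_degree ends c \<gamma> =
    (LEAST \<tau>. \<exists>T. 2 \<le> card T \<and> card T = \<tau> \<and>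
      defines_facet (steiner_cut_dominant ends T) c \<gamma>)"

definition cactus_vector :: "('e::finite \<Rightarrow> 'v::finite set) \<Rightarrow> 'e set \<Rightarrow> real ^ 'e" where
  "cactus_vector ends F =
    (\<chi> e. if e \<notin> F then 0 else if \<exists>C\<in>cycles ends F. e \<in> C then 1 else 2)"

end

theory Submission
  imports Defs
begin

text \<open>
  Scaled to right-hand side one, a facet other than nonnegativity is a weight function \<open>w\<close> whose
  cuts all have weight at least one and which is determined by its support and its tight
  \<open>T\<close>-Steiner cuts. By uncrossing, a minimal tight set containing one or two terminals (and
  something else) can be contracted without losing this property, so by induction on the number of
  nodes one may assume that each tight Steiner cut isolates one or two terminals. For at most five
  terminals, comparing the number of edges with the number of equations then leaves only
  half-integral weights for which any two nodes are separated by a tight cut. Such a weight function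
  is half the vector of a tree or cactus: its support contains no two cycles with a common edge.

  Conversely, let \<open>T\<close> consist of the leaves and, on each cycle, of as many nodes without outside
  neighbours as its defect. Counting degrees shows that \<open>T\<close> meets both sides of each bridge and both
  arcs left by two suitable cycle edges, and these cuts determine the cactus vector. Every set of
  terminals that determines it contains all leaves and at least defect many such nodes of each
  cycle, so this choice of \<open>T\<close> has minimum size.
\<close>

subsection \<open>Weights, cuts and uncrossing\<close>

text \<open>The number five enters through complements: a set and its complement have the same cut,
  and one of the two holds at most two terminals. Once tight sets with one or two terminals are
  reduced to just these terminals, the only equations left are the stars of the terminals and the
  pairs of terminals joined by weight 1/2. The count alone does not finish: the number of terminals
  with exactly one such partner is even, which leaves configurations with four of them, to be
  excluded by explicit perturbations and weights. The induction does not carry the cactus structure,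
  which is hard to follow through a contraction, but two properties that can be lifted edge by edge
  and pair by pair: half-integrality, and separation of any two nodes by a tight cut. The cactus is
  recovered only at the end, again by uncrossing. Two facets are in play. The one of the full cut
  dominant gives weight at least one for every cut, also for cuts that do not split the terminals;
  the one for \<open>T\<close> gives uniqueness.\<close>

definition weight :: "('a \<Rightarrow> 'a \<Rightarrow> real) \<Rightarrow> 'a set \<Rightarrow> 'a set \<Rightarrow> real" where
  "weight d A B = (\<Sum>u\<in>A. \<Sum>v\<in>B. d u v)"

definition cutval :: "'a set \<Rightarrow> ('a \<Rightarrow> 'a \<Rightarrow> real) \<Rightarrow> 'a set \<Rightarrow> real" where
  "cutval V d S = weight d S (V - S)"

text \<open>Perturbation of a single edge. Most explicit perturbations that contradict uniqueness
  below are sums of these.\<close>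

definition edge_fn :: "'a \<Rightarrow> 'a \<Rightarrow> real \<Rightarrow> 'a \<Rightarrow> 'a \<Rightarrow> real" where
  "edge_fn p q c u v = (if {u, v} = {p, q} then c else 0)"

text \<open>Contraction along \<open>f\<close>: parallel edges are merged by adding their values,
  and loops are dropped. For its sake weights are symmetric functions of two nodes rather than edge
  vectors.\<close>

definition quot :: "'a set \<Rightarrow> ('a \<Rightarrow> 'b) \<Rightarrow> ('a \<Rightarrow> 'a \<Rightarrow> real) \<Rightarrow> 'b \<Rightarrow> 'b \<Rightarrow> real" where
  "quot V f d u v =
    (if u = v then 0 else weight d {p \<in> V. f p = u} {q \<in> V. f q = v})"

lemma weight_indicator:
  assumes "finite V" "A \<subseteq> V" "B \<subseteq> V"
  shows "weight d A B = (\<Sum>u\<in>V. \<Sum>v\<in>V. if u \<in> A \<and> v \<in> B then d u v else 0)"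
proof -
  have "weight d A B = (\<Sum>u\<in>V. if u \<in> A then (\<Sum>v\<in>B. d u v) else 0)"
    using assms unfolding weight_def by (simp add: sum.inter_restrict[symmetric] Int_absorb1)
  also have "\<dots> = (\<Sum>u\<in>V. \<Sum>v\<in>V. if u \<in> A \<and> v \<in> B then d u v else 0)"
  proof (rule sum.cong[OF refl])
    fix u
    have "(\<Sum>v\<in>B. d u v) = (\<Sum>v\<in>V. if v \<in> B then d u v else 0)"
      using assms by (simp add: sum.inter_restrict[symmetric] Int_absorb1)
    then show "(if u \<in> A then (\<Sum>v\<in>B. d u v) else 0)
        = (\<Sum>v\<in>V. if u \<in> A \<and> v \<in> B then d u v else 0)"
      by auto
  qed
  finally show ?thesis .
qed

lemma weight_sym:
  assumes "\<And>u v. d u v = d v u"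
  shows "weight d A B = weight d B A"
proof -
  have "weight d A B = (\<Sum>u\<in>A. \<Sum>v\<in>B. d v u)"
    unfolding weight_def by (intro sum.cong refl assms)
  also have "\<dots> = weight d B A"
    unfolding weight_def by (rule sum.swap)
  finally show ?thesis .
qed

lemma weight_nonneg: "(\<And>u v. 0 \<le> d u v) \<Longrightarrow> 0 \<le> weight d A B"
  by (simp add: weight_def sum_nonneg)

lemma weight_eq_0_iff:
  assumes "finite A" "finite B" "\<And>u v. 0 \<le> d u v"
  shows "weight d A B = 0 \<longleftrightarrow> (\<forall>u\<in>A. \<forall>v\<in>B. d u v = 0)"
  using assms by (simp add: weight_def sum_nonneg_eq_0_iff sum_nonneg)

lemma weight_singleton_le:
  assumes "finite A" "finite B" "\<And>u v. 0 \<le> d u v" "a \<in> A" "b \<in> B"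
  shows "d a b \<le> weight d A B"
proof -
  have "d a b \<le> (\<Sum>v\<in>B. d a v)"
    using assms by (intro member_le_sum) auto
  also have "\<dots> \<le> weight d A B"
    unfolding weight_def using assms by (intro member_le_sum) (auto intro: sum_nonneg)
  finally show ?thesis .
qed

text \<open>Submodularity of the cut function with its exact error term. When equality forces the
  error term of \<open>w\<close> to be zero, that of every perturbation within the support of
  \<open>w\<close> vanishes too.\<close>

lemma cutval_uncross:
  assumes "finite V" "\<And>u v. d u v = d v u" "A \<subseteq> V" "B \<subseteq> V"
  shows "cutval V d A + cutval V d B
    = cutval V d (A \<inter> B) + cutval V d (A \<union> B) + 2 * weight d (A - B) (B - A)"
proof -
  have s: "2 * weight d (A - B) (B - A) = weight d (A - B) (B - A) + weight d (B - A) (A - B)"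
    using weight_sym[where d = d and A = "A - B" and B = "B - A", OF assms(2)] by simp
  have sub: "A \<inter> B \<subseteq> V" "A \<union> B \<subseteq> V" "V - A \<subseteq> V" "V - B \<subseteq> V" "V - (A \<inter> B) \<subseteq> V"
    "V - (A \<union> B) \<subseteq> V" "A - B \<subseteq> V" "B - A \<subseteq> V"
    using assms by auto
  have "(if u \<in> A \<and> v \<in> V - A then d u v else 0) + (if u \<in> B \<and> v \<in> V - B then d u v else 0)
      = (if u \<in> A \<inter> B \<and> v \<in> V - A \<inter> B then d u v else 0)
      + (if u \<in> A \<union> B \<and> v \<in> V - (A \<union> B) then d u v else 0)
      + ((if u \<in> A - B \<and> v \<in> B - A then d u v else 0)
      + (if u \<in> B - A \<and> v \<in> A - B then d u v else 0))" if "v \<in> V" for u v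
    using that by (cases "u \<in> A"; cases "u \<in> B"; cases "v \<in> A"; cases "v \<in> B"; simp)
  then show ?thesis
    unfolding s cutval_def
    by (simp only: weight_indicator[OF assms(1)] assms(3,4) sub sum.distrib[symmetric] cong: sum.cong)
qed

lemma cutval_empty [simp]: "cutval V d {} = 0"
  by (simp add: cutval_def weight_def)

lemma cutval_V [simp]: "cutval V d V = 0"
  by (simp add: cutval_def weight_def)

lemma cutval_Compl:
  assumes "\<And>u v. d u v = d v u" "S \<subseteq> V"
  shows "cutval V d (V - S) = cutval V d S"
proof -
  have "V - (V - S) = S" using assms by auto
  then show ?thesis using weight_sym[where d = d and A = S and B = "V - S", OF assms(1)] by (simp add: cutval_def)
qed

lemma cutval_Un:
  assumes "finite V" "\<And>u v. d u v = d v u" "A \<subseteq> V" "B \<subseteq> V" "A \<inter> B = {}"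
  shows "cutval V d (A \<union> B) = cutval V d A + cutval V d B - 2 * weight d A B"
proof -
  have "A - B = A" "B - A = B" using assms(5) by auto
  then show ?thesis using cutval_uncross[OF assms(1-4)] assms(5) by simp
qed

lemma weight_add: "weight (\<lambda>u v. d u v + e u v) A B = weight d A B + weight e A B"
  by (simp add: weight_def sum.distrib)

lemma cutval_add: "cutval V (\<lambda>u v. d u v + e u v) S = cutval V d S + cutval V e S"
  by (simp add: cutval_def weight_add)

lemma weight_delta:
  assumes "finite A" "finite B"
  shows "weight (\<lambda>u v. if u = p \<and> v = q then c else 0) A B = (if p \<in> A \<and> q \<in> B then c else 0)"
proof -
  have "(\<Sum>v\<in>B. if u = p \<and> v = q then c else 0) = (if u = p then if q \<in> B then c else 0 else 0)" for u
    using assms by (cases "u = p") (simp_all add: sum.delta)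
  then show ?thesis using assms by (simp add: weight_def sum.delta)
qed

lemma cutval_edge_fn:
  assumes "finite V" "p \<in> V" "q \<in> V" "p \<noteq> q" "S \<subseteq> V"
  shows "cutval V (edge_fn p q c) S = (if (p \<in> S) = (q \<in> S) then 0 else c)"
proof -
  have fin: "finite S" "finite (V - S)" using assms finite_subset by blast+
  have "edge_fn p q c = (\<lambda>u v. (if u = p \<and> v = q then c else 0) + (if u = q \<and> v = p then c else 0))"
    using assms(4) by (auto simp: edge_fn_def doubleton_eq_iff fun_eq_iff)
  then show ?thesis
    using assms by (simp add: cutval_def weight_add weight_delta[OF fin])
qed

text \<open>The cuts of a contraction are the cuts that split no fibre; the proof groups both sums
  by fibres.\<close>

lemma cutval_quot:
  assumes "finite V" "S \<subseteq> f ` V"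
  shows "cutval (f ` V) (quot V f d) S = cutval V d {p \<in> V. f p \<in> S}"
proof -
  have fS: "finite S" using assms finite_surj by blast
  have "cutval (f ` V) (quot V f d) S
      = (\<Sum>u\<in>S. \<Sum>v\<in>f ` V - S. \<Sum>p\<in>{p \<in> V. f p = u}. \<Sum>q\<in>{q \<in> V. f q = v}. d p q)"
    unfolding cutval_def weight_def quot_def by (intro sum.cong refl) auto
  also have "\<dots> = (\<Sum>u\<in>S. \<Sum>p\<in>{p \<in> V. f p = u}. \<Sum>v\<in>f ` V - S. \<Sum>q\<in>{q \<in> V. f q = v}. d p q)"
    by (intro sum.cong refl sum.swap)
  also have "\<dots> = (\<Sum>u\<in>S. \<Sum>p\<in>{p \<in> {p \<in> V. f p \<in> S}. f p = u}.
       \<Sum>v\<in>f ` V - S. \<Sum>q\<in>{q \<in> {q \<in> V. f q \<notin> S}. f q = v}. d p q)"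
    by (intro sum.cong refl) auto
  also have "\<dots> = (\<Sum>u\<in>S. \<Sum>p\<in>{p \<in> {p \<in> V. f p \<in> S}. f p = u}. \<Sum>q\<in>{q \<in> V. f q \<notin> S}. d p q)"
    by (intro sum.cong refl sum.group) (use assms in auto)
  also have "\<dots> = (\<Sum>p\<in>{p \<in> V. f p \<in> S}. \<Sum>q\<in>{q \<in> V. f q \<notin> S}. d p q)"
    by (intro sum.group) (use assms fS in auto)
  also have "\<dots> = cutval V d {p \<in> V. f p \<in> S}"
  proof -
    have "V - {p \<in> V. f p \<in> S} = {q \<in> V. f q \<notin> S}" by auto
    then show ?thesis by (simp add: cutval_def weight_def)
  qed
  finally show ?thesis .
qed

lemma weight_mult: "weight (\<lambda>u v. c * d u v) A B = c * weight d A B"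
  by (simp add: weight_def sum_distrib_left)

lemma weight_cong:
  "(\<And>u v. u \<in> A \<Longrightarrow> v \<in> B \<Longrightarrow> d u v = e u v) \<Longrightarrow> weight d A B = weight e A B"
  by (simp add: weight_def)

lemma cutval_singleton: "a \<in> V \<Longrightarrow> cutval V d {a} = (\<Sum>v\<in>V - {a}. d a v)"
  by (simp add: cutval_def weight_def)

text \<open>\<open>cut_ge_1\<close> concerns all cuts, also those with all terminals on one side:
  uncrossing and splitting off single nodes lead to such cuts.\<close>

locale cut_weights =
  fixes V :: "'a set" and w :: "'a \<Rightarrow> 'a \<Rightarrow> real"
  assumes finV: "finite V"
    and w_commute: "w u v = w v u"
    and w_nonneg: "0 \<le> w u v"
    and w_irrefl: "w u u = 0"
    and w_in: "w u v \<noteq> 0 \<Longrightarrow> u \<in> V"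
    and cut_ge_1: "S \<subseteq> V \<Longrightarrow> S \<noteq> {} \<Longrightarrow> S \<noteq> V \<Longrightarrow> 1 \<le> cutval V w S"
begin

definition tight :: "'a set \<Rightarrow> bool" where
  "tight S \<longleftrightarrow> S \<subseteq> V \<and> cutval V w S = 1"

text \<open>The perturbations that keep the zero entries of \<open>w\<close>, that is, respect the
  nonnegativity constraints tight at \<open>w\<close>.\<close>

definition supported :: "('a \<Rightarrow> 'a \<Rightarrow> real) \<Rightarrow> bool" where
  "supported d \<longleftrightarrow> (\<forall>u v. d u v = d v u) \<and> (\<forall>u v. w u v = 0 \<longrightarrow> d u v = 0)"

lemma tightD: "tight S \<Longrightarrow> S \<subseteq> V" "tight S \<Longrightarrow> cutval V w S = 1"
  by (auto simp: tight_def)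

lemma tight_nonempty: "tight S \<Longrightarrow> S \<noteq> {}" "tight S \<Longrightarrow> S \<noteq> V"
  by (auto simp: tight_def)

lemma tight_Compl: "tight S \<Longrightarrow> tight (V - S)"
  using cutval_Compl[of w S V] w_commute by (auto simp: tight_def)

lemma w_in2: "w u v \<noteq> 0 \<Longrightarrow> v \<in> V"
  using w_in[of v u] w_commute[of u v] by simp

lemma supportedD:
  "supported d \<Longrightarrow> d u v = d v u" "supported d \<Longrightarrow> w u v = 0 \<Longrightarrow> d u v = 0"
  by (auto simp: supported_def)

lemma supported_w: "supported w"
  using w_commute by (auto simp: supported_def)

lemma supported_add: "supported d \<Longrightarrow> supported e \<Longrightarrow> supported (\<lambda>u v. d u v + e u v)"
  by (auto simp: supported_def)

lemma supported_edge_fn: "w p q \<noteq> 0 \<Longrightarrow> supported (edge_fn p q c)"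
  using w_commute by (auto simp: supported_def edge_fn_def doubleton_eq_iff)

lemma cutval_supported_Compl: "supported d \<Longrightarrow> S \<subseteq> V \<Longrightarrow> cutval V d (V - S) = cutval V d S"
  by (rule cutval_Compl) (auto simp: supported_def)

text \<open>The cuts of \<open>A \<inter> B\<close> and \<open>A \<union> B\<close> weigh at least
  one each, so submodularity holds with equality. Then \<open>w\<close>, and with it any supported
  \<open>d\<close>, is zero between \<open>A - B\<close> and \<open>B - A\<close>.\<close>

lemma tight_uncross:
  assumes "tight A" "tight B" "A \<inter> B \<noteq> {}" "A \<union> B \<noteq> V"
  shows "tight (A \<inter> B)" "tight (A \<union> B)"
    "supported d \<Longrightarrow> cutval V d A + cutval V d B = cutval V d (A \<inter> B) + cutval V d (A \<union> B)"
proof -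
  note AB = tightD(1)[OF assms(1)] tightD(1)[OF assms(2)]
  have fin: "finite (A - B)" "finite (B - A)" using AB finV finite_subset by blast+
  have 1: "1 \<le> cutval V w (A \<inter> B)" "1 \<le> cutval V w (A \<union> B)"
    by (rule cut_ge_1; use assms AB tight_nonempty in blast)+
  have 2: "cutval V w A + cutval V w B = cutval V w (A \<inter> B) + cutval V w (A \<union> B)
      + 2 * weight w (A - B) (B - A)"
    by (rule cutval_uncross[OF finV w_commute AB])
  have 3: "0 \<le> weight w (A - B) (B - A)" by (rule weight_nonneg[OF w_nonneg])
  show "tight (A \<inter> B)" "tight (A \<union> B)"
    using 1 2 3 assms AB by (auto simp: tight_def)
  have "weight w (A - B) (B - A) = 0"
    using 1 2 3 assms by (auto simp: tight_def)
  then have z: "\<forall>u\<in>A - B. \<forall>v\<in>B - A. w u v = 0"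
    using weight_eq_0_iff[OF fin, of w] w_nonneg by blast
  assume d: "supported d"
  have "weight d (A - B) (B - A) = 0"
    unfolding weight_def using z d by (auto simp: supported_def)
  then show "cutval V d A + cutval V d B = cutval V d (A \<inter> B) + cutval V d (A \<union> B)"
    using cutval_uncross[OF finV supportedD(1)[OF d] AB] by simp
qed

end

definition separates :: "'a set \<Rightarrow> 'a set \<Rightarrow> bool" where
  "separates S T \<longleftrightarrow> S \<inter> T \<noteq> {} \<and> T - S \<noteq> {}"

text \<open>The invariant of the induction. Both conditions speak of single edges or pairs of nodes,
  so they can be pulled back along a contraction; \<open>cactus_of_half_cactus\<close> extracts the
  cactus from them.\<close>

definition half_cactus :: "'a set \<Rightarrow> ('a \<Rightarrow> 'a \<Rightarrow> real) \<Rightarrow> bool" where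
  "half_cactus V w \<longleftrightarrow> (\<forall>u v. 2 * w u v \<in> \<int>) \<and>
    (\<forall>u\<in>V. \<forall>v\<in>V. u \<noteq> v \<longrightarrow> (\<exists>S\<subseteq>V. u \<in> S \<and> v \<notin> S \<and> cutval V w S = 1))"

text \<open>\<open>unique\<close> says that the constraints tight at \<open>w\<close>, its zero
  entries and its tight Steiner cuts, have full rank. Thus \<open>w\<close> is a vertex of the
  blocking polyhedron, dual to a facet of the dominant. In this homogeneous form any nonzero
  perturbation that vanishes on the tight Steiner cuts is a contradiction.\<close>

locale steiner_vertex = cut_weights +
  fixes T :: "'a set"
  assumes T_sub: "T \<subseteq> V"
    and unique: "supported d \<Longrightarrow> (\<And>S. tight S \<Longrightarrow> separates S T \<Longrightarrow> cutval V d S = 0) \<Longrightarrow> d u v = 0"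
begin

lemma separates_Compl: "S \<subseteq> V \<Longrightarrow> separates S T \<Longrightarrow> separates (V - S) T"
  using T_sub by (auto simp: separates_def)

text \<open>Uncrossing \<open>S\<close> with \<open>X\<close> expresses the value of
  \<open>S\<close> by those of \<open>S \<inter> X\<close>, \<open>S \<union> X\<close> and
  \<open>X\<close>, none of which crosses \<open>X\<close>.\<close>

lemma noncrossing_suffices:
  assumes X: "tight X" and d: "supported d"
    and sub: "\<And>S. tight S \<Longrightarrow> separates S T \<Longrightarrow> S \<subseteq> X \<Longrightarrow> cutval V d S = 0"
    and sup: "\<And>S. tight S \<Longrightarrow> separates S T \<Longrightarrow> X \<subseteq> S \<Longrightarrow> cutval V d S = 0"
    and XT: "separates X T"
    and S: "tight S" "separates S T"
  shows "cutval V d S = 0"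
proof -
  have key: "cutval V d S = 0"
    if S: "tight S" "separates S T" and m: "S \<inter> X \<inter> T \<noteq> {}" "T - (S \<union> X) \<noteq> {}" for S
  proof -
    have ne: "S \<inter> X \<noteq> {}" "S \<union> X \<noteq> V" using m T_sub by auto
    note u = tight_uncross[OF S(1) X ne]
    have "separates (S \<inter> X) T" "separates (S \<union> X) T"
      using m by (auto simp: separates_def)
    then have "cutval V d (S \<inter> X) = 0" "cutval V d (S \<union> X) = 0"
      using sub[OF u(1)] sup[OF u(2)] by auto
    moreover have "cutval V d X = 0" using sub[OF X XT] by simp
    ultimately show ?thesis using u(3)[OF d] by simp
  qed
  show ?thesis
  proof (cases "S \<inter> X \<inter> T \<noteq> {} \<and> T - (S \<union> X) \<noteq> {}")
    case True
    then show ?thesis using key S by blast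
  next
    \<comment> \<open>If \<open>S\<close> violates the condition, its complement satisfies it,
      because both \<open>S\<close> and \<open>X\<close> split the terminals.\<close>
    case False
    have "(V - S) \<inter> X \<inter> T \<noteq> {}" "T - ((V - S) \<union> X) \<noteq> {}"
      using False S XT T_sub tightD(1)[OF S(1)] by (auto simp: separates_def)
    then have "cutval V d (V - S) = 0"
      using key tight_Compl separates_Compl S tightD(1) by blast
    then show ?thesis using cutval_supported_Compl[OF d tightD(1)[OF S(1)]] by simp
  qed
qed

end

context cut_weights
begin

lemma cutval_edge_fn': "w p q \<noteq> 0 \<Longrightarrow> S \<subseteq> V \<Longrightarrow>
    cutval V (edge_fn p q c) S = (if (p \<in> S) = (q \<in> S) then 0 else c)"
  using cutval_edge_fn[OF finV w_in w_in2] w_irrefl by metis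

lemma cutval_inside:
  assumes "\<And>u v. e u v \<noteq> 0 \<Longrightarrow> u \<in> X \<and> v \<in> X" "X \<subseteq> S"
  shows "cutval V e S = 0"
  using assms unfolding cutval_def weight_def by (intro sum.neutral ballI) blast

lemma half_integral_outside:
  assumes "\<And>q. q \<notin> X \<Longrightarrow> 2 * w p q \<in> \<int>"
  shows "2 * (\<Sum>v\<in>V - X. w p v) \<in> \<int>"
  unfolding sum_distrib_left using assms by (intro Ints_sum) auto

end

subsection \<open>Contraction of tight sets\<close>

definition merge :: "'a set \<Rightarrow> 'a \<Rightarrow> 'a \<Rightarrow> 'a" where
  "merge X x p = (if p \<in> X then x else p)"

context steiner_vertex
begin

text \<open>The induction hypothesis as a predicate, so that each reduction can be a lemma of the
  locale. The node type stays the same because \<open>merge\<close> keeps a representative of the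
  contracted set.\<close>

definition half_cactus_below :: bool where
  "half_cactus_below \<longleftrightarrow> (\<forall>V' w' (T' :: 'a set). steiner_vertex V' w' T' \<and> card T' \<le> 5 \<and>
     card V' < card V \<and> 2 \<le> card V' \<longrightarrow> half_cactus V' w')"

text \<open>
  If every perturbation that vanishes on the tight cuts containing \<open>X\<close> can be corrected inside \<open>X\<close>
  to one that vanishes on all tight cuts, then uniqueness survives the contraction of \<open>X\<close>.
\<close>

definition liftable :: "'a set \<Rightarrow> bool" where
  "liftable X \<longleftrightarrow> (\<forall>d. supported d \<longrightarrow>
      (\<forall>S. tight S \<longrightarrow> separates S T \<longrightarrow> X \<subseteq> S \<longrightarrow> cutval V d S = 0) \<longrightarrow>
      (\<exists>e. supported e \<and> (\<forall>u v. e u v \<noteq> 0 \<longrightarrow> u \<in> X \<and> v \<in> X) \<and>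
        (\<forall>S. tight S \<longrightarrow> separates S T \<longrightarrow> cutval V d S + cutval V e S = 0)))"

text \<open>The conclusions are the two parts of \<open>half_cactus\<close> for pairs not both in
  \<open>X\<close>; what happens inside \<open>X\<close> is left to the reductions. A perturbation
  of the contracted weight is pulled back, vanishes on the tight Steiner cuts containing
  \<open>X\<close>, and is then handled by \<open>liftable\<close>.\<close>

lemma contraction:
  assumes X: "X \<subseteq> V" "x \<in> X" "y \<in> X" "x \<noteq> y" "X \<noteq> V"
    and T: "card T \<le> 5" "X \<inter> T \<noteq> {}"
    and lift: "liftable X"
    and IH: half_cactus_below
  shows "\<And>p q. p \<notin> X \<or> q \<notin> X \<Longrightarrow> 2 * w p q \<in> \<int>"
    and "\<And>p q. p \<in> V \<Longrightarrow> q \<in> V \<Longrightarrow> p \<noteq> q \<Longrightarrow> p \<notin> X \<or> q \<notin> X \<Longrightarrow>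
      \<exists>S\<subseteq>V. p \<in> S \<and> q \<notin> S \<and> cutval V w S = 1"
proof -
  define f where "f = merge X x"
  define V' where "V' = f ` V"
  define w' where "w' = quot V f w"
  have f_in: "f p = x" if "p \<in> X" for p using that by (simp add: f_def merge_def)
  have fib_x: "{p \<in> V. f p = x} = X"
    using X by (auto simp: f_def merge_def)
  have fib_out: "{p \<in> V. f p = v} = {v}" if "v \<in> V - X" for v
    using that X by (auto simp: f_def merge_def split: if_splits)
  \<comment> \<open>After its correction inside \<open>X\<close> the perturbation is zero by
    uniqueness, so the original one lives inside \<open>X\<close>.\<close>
  have lifted_exists: "\<exists>e. supported e \<and> (\<forall>u v. d u v + e u v = 0) \<and> (\<forall>u v. e u v \<noteq> 0 \<longrightarrow> u \<in> X \<and> v \<in> X)"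
    if d: "supported d" "\<And>S. tight S \<Longrightarrow> separates S T \<Longrightarrow> X \<subseteq> S \<Longrightarrow> cutval V d S = 0" for d
  proof -
    obtain e where e: "supported e" "\<forall>u v. e u v \<noteq> 0 \<longrightarrow> u \<in> X \<and> v \<in> X"
        "\<forall>S. tight S \<longrightarrow> separates S T \<longrightarrow> cutval V d S + cutval V e S = 0"
      using lift d unfolding liftable_def by blast
    have "d u v + e u v = 0" for u v
      by (rule unique[OF supported_add[OF d(1) e(1)]]) (use e(3) in \<open>simp add: cutval_add\<close>)
    then show ?thesis using e by blast
  qed
  have cw: "cut_weights V' w'"
  proof
    show "finite V'" using finV by (simp add: V'_def)
    show "w' u v = w' v u" for u v
      using weight_sym[where d = w, OF w_commute] by (auto simp: w'_def quot_def)
    show "0 \<le> w' u v" for u v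
      using weight_nonneg[where d = w, OF w_nonneg] by (simp add: w'_def quot_def)
    show "w' u u = 0" for u by (simp add: w'_def quot_def)
    show "u \<in> V'" if "w' u v \<noteq> 0" for u v
    proof (rule ccontr)
      assume "u \<notin> V'"
      then have "{p \<in> V. f p = u} = {}" by (auto simp: V'_def)
      then have "weight w {p \<in> V. f p = u} B = 0" for B by (simp only: weight_def sum.empty)
      with that show False by (simp add: w'_def quot_def split: if_splits)
    qed
    show "1 \<le> cutval V' w' S" if S: "S \<subseteq> V'" "S \<noteq> {}" "S \<noteq> V'" for S
    proof -
      obtain p q where "p \<in> V" "f p \<in> S" "q \<in> V" "f q \<notin> S"
        using S unfolding V'_def by blast
      then have "{p \<in> V. f p \<in> S} \<noteq> {}" "{p \<in> V. f p \<in> S} \<noteq> V" by blast+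
      then have "1 \<le> cutval V w {p \<in> V. f p \<in> S}" by (intro cut_ge_1) blast+
      then show ?thesis
        using cutval_quot[OF finV, of S f w] S(1) by (simp add: V'_def w'_def)
    qed
  qed
  interpret C: cut_weights V' w' by (rule cw)
  have tight_image: "C.tight (f ` S) \<and> separates (f ` S) (f ` T) \<and> {p \<in> V. f p \<in> f ` S} = S"
    if S: "tight S" "separates S T" "X \<subseteq> S" for S
  proof -
    have SV: "S \<subseteq> V" by (rule tightD(1)[OF S(1)])
    have pre: "{p \<in> V. f p \<in> f ` S} = S"
      using S(3) SV X by (auto simp: f_def merge_def split: if_splits)
    have "cutval V' w' (f ` S) = cutval V w {p \<in> V. f p \<in> f ` S}"
      unfolding V'_def w'_def using SV by (intro cutval_quot finV) auto
    then have "C.tight (f ` S)"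
      using S(1) SV unfolding C.tight_def tight_def pre by (simp add: V'_def image_mono)
    moreover have "separates (f ` S) (f ` T)"
    proof -
      obtain a b where ab: "a \<in> S" "a \<in> T" "b \<in> T" "b \<notin> S"
        using S(2) unfolding separates_def by blast
      then have "f a \<in> f ` S \<inter> f ` T" by blast
      moreover have "f b \<in> f ` T - f ` S" using ab pre T_sub by blast
      ultimately show ?thesis unfolding separates_def by blast
    qed
    ultimately show ?thesis using pre by (intro conjI)
  qed
  have sv: "steiner_vertex V' w' (f ` T)"
  proof
    show "f ` T \<subseteq> V'" using T_sub by (auto simp: V'_def)
    fix d' and u v
    assume d': "C.supported d'" and kill: "\<And>S. C.tight S \<Longrightarrow> separates S (f ` T) \<Longrightarrow> cutval V' d' S = 0"
    \<comment> \<open>Spreads the value of a contracted edge over its parallel edges in proportion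
      to \<open>w\<close>, so that contracting \<open>d\<close> gives \<open>d'\<close>
      back.\<close>
    define d where "d p q = (if f p = f q then 0 else w p q * (d' (f p) (f q) / w' (f p) (f q)))" for p q
    have sd: "supported d"
      unfolding supported_def d_def using w_commute C.w_commute C.supportedD(1)[OF d'] by auto
    have qd: "quot V f d a b = d' a b" for a b
    proof (cases "a = b")
      case True
      then show ?thesis using C.supportedD(2)[OF d'] C.w_irrefl by (simp add: quot_def)
    next
      case False
      then have "quot V f d a b
          = weight (\<lambda>p q. (d' a b / w' a b) * w p q) {p \<in> V. f p = a} {q \<in> V. f q = b}"
        unfolding quot_def by (auto intro!: weight_cong simp: d_def)
      also have "\<dots> = (d' a b / w' a b) * w' a b"
      proof -
        have "w' a b = weight w {p \<in> V. f p = a} {q \<in> V. f q = b}"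
          using False by (simp add: w'_def quot_def)
        then show ?thesis by (simp only: weight_mult)
      qed
      also have "\<dots> = d' a b"
        using C.supportedD(2)[OF d', of a b] by (cases "w' a b = 0") simp_all
      finally show ?thesis .
    qed
    have cd: "cutval V' d' S = cutval V d {p \<in> V. f p \<in> S}" if "S \<subseteq> V'" for S
    proof -
      have "quot V f d = d'" using qd by (intro ext) auto
      then show ?thesis using cutval_quot[OF finV, of S f d] that by (simp add: V'_def)
    qed
    have "cutval V d S = 0" if S: "tight S" "separates S T" "X \<subseteq> S" for S
      using tight_image[OF S] kill[of "f ` S"] cd[of "f ` S"] by (auto simp: C.tight_def)
    then obtain e where e: "\<forall>u v. d u v + e u v = 0" "\<forall>u v. e u v \<noteq> 0 \<longrightarrow> u \<in> X \<and> v \<in> X"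
      using lifted_exists[OF sd] by blast
    have z: "d p q = 0" if "f p \<noteq> f q" for p q
      using that e f_in by (metis add.right_neutral)
    have "quot V f d u v = 0"
      unfolding quot_def weight_def using z by (auto intro!: sum.neutral)
    then show "d' u v = 0" by (simp add: qd)
  qed
  have finT: "finite T" using T_sub finV finite_subset by blast
  have "V' = insert x (V - X)" using X by (auto simp: V'_def f_def merge_def)
  moreover have "insert x (V - X) \<subseteq> V - {y}" using X by auto
  ultimately have "V' \<subset> V" using X by blast
  then have cV': "card V' < card V" by (rule psubset_card_mono[OF finV])
  obtain z where z: "z \<in> V - X" using X by auto
  have "{x, z} \<subseteq> V'" "x \<noteq> z" using z X by (auto simp: \<open>V' = insert x (V - X)\<close>)
  then have "2 \<le> card V'" using card_mono[of V' "{x, z}"] C.finV by auto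
  moreover have "card (f ` T) \<le> 5" using card_image_le[OF finT, of f] T by linarith
  ultimately have hc: "half_cactus V' w'"
    using IH sv cV' by (auto simp: half_cactus_below_def)
  \<comment> \<open>Two edges from \<open>X\<close> to the same outer node could be perturbed by 1
    and -1 without changing any cut that contains \<open>X\<close>, and no correction inside
    \<open>X\<close> can undo this.\<close>
  have unique_nbr: "p = p'" if pp: "p \<in> X" "p' \<in> X" "v \<notin> X" "w p v \<noteq> 0" "w p' v \<noteq> 0" for p p' v
  proof (rule ccontr)
    assume ne: "p \<noteq> p'"
    define d where "d u r = edge_fn p v 1 u r + edge_fn p' v (-1) u r" for u r
    have sd: "supported d" unfolding d_def by (intro supported_add supported_edge_fn pp)
    have "cutval V d S = 0" if "tight S" "separates S T" "X \<subseteq> S" for S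
      using that pp unfolding d_def cutval_add by (auto simp: cutval_edge_fn' tight_def)
    then obtain e where e: "\<forall>u v. d u v + e u v = 0" "\<forall>u v. e u v \<noteq> 0 \<longrightarrow> u \<in> X \<and> v \<in> X"
      using lifted_exists[OF sd] by blast
    have "d p v = 1" using ne pp by (auto simp: d_def edge_fn_def doubleton_eq_iff)
    moreover have "d p v + e p v = 0" using e(1) by blast
    ultimately have "e p v \<noteq> 0" by simp
    then show False using e(2) pp(3) by blast
  qed
  \<comment> \<open>By \<open>unique_nbr\<close> the bundle between \<open>X\<close> and
    \<open>q\<close> is a single edge, which therefore has the weight of the contracted
    edge.\<close>
  have mixed: "2 * w p q \<in> \<int>" if pq: "p \<in> X" "q \<notin> X" for p q
  proof (cases "w p q = 0")
    case False
    have q: "q \<in> V" using w_in2[OF False] .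
    have "w' x q = weight w X {q}"
      using fib_x fib_out[of q] q pq X by (auto simp: w'_def quot_def)
    also have "\<dots> = (\<Sum>r\<in>X. w r q)" by (simp add: weight_def)
    also have "\<dots> = w p q + (\<Sum>r\<in>X - {p}. w r q)"
      using pq X finV finite_subset by (intro sum.remove) auto
    also have "(\<Sum>r\<in>X - {p}. w r q) = 0"
      using unique_nbr[OF pq(1) _ pq(2) False] by (intro sum.neutral) blast
    finally have "w p q = w' x q" by simp
    moreover have "2 * w' x q \<in> \<int>" using hc unfolding half_cactus_def by blast
    ultimately show ?thesis by simp
  qed simp
  show "2 * w p q \<in> \<int>" if pq: "p \<notin> X \<or> q \<notin> X" for p q
  proof -
    consider "p \<in> X" "q \<notin> X" | "q \<in> X" "p \<notin> X" | "p \<notin> X" "q \<notin> X" using pq by blast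
    then show ?thesis
    proof cases
      case 1 then show ?thesis by (rule mixed)
    next
      case 2 then show ?thesis using mixed[of q p] by (simp add: w_commute[of p q])
    next
      case 3
      show ?thesis
      proof (cases "w p q = 0")
        case False
        then have "p \<in> V" "q \<in> V" "p \<noteq> q" using w_in w_in2 w_irrefl by blast+
        then have "w' p q = w p q"
          using 3 fib_out[of p] fib_out[of q] by (simp add: w'_def quot_def weight_def)
        moreover have "2 * w' p q \<in> \<int>" using hc unfolding half_cactus_def by blast
        ultimately show ?thesis by simp
      qed simp
    qed
  qed
  show "\<exists>S\<subseteq>V. p \<in> S \<and> q \<notin> S \<and> cutval V w S = 1"
    if pq: "p \<in> V" "q \<in> V" "p \<noteq> q" "p \<notin> X \<or> q \<notin> X" for p q
  proof -
    have "f p \<noteq> f q" using pq X by (auto simp: f_def merge_def)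
    then obtain S where S: "S \<subseteq> V'" "f p \<in> S" "f q \<notin> S" "cutval V' w' S = 1"
      using hc pq unfolding half_cactus_def V'_def by blast
    then have "cutval V w {r \<in> V. f r \<in> S} = 1"
      using cutval_quot[OF finV, of S f w] by (simp add: V'_def w'_def)
    then show ?thesis using S pq by (intro exI[of _ "{r \<in> V. f r \<in> S}"]) auto
  qed
qed

text \<open>The edge between \<open>t\<close> and \<open>p\<close> is the one free parameter inside
  the contracted pair, and the star of \<open>t\<close> is the one equation it has to repair. The
  same star then makes its weight half-integral and separates \<open>t\<close> from
  \<open>p\<close>.\<close>

lemma contract_pair:
  assumes t: "t \<in> T" "tight {t}" and p: "w t p \<noteq> 0" "{t, p} \<noteq> V"
    and T: "card T \<le> 5" and IH: half_cactus_below
    and reduce: "\<And>d S. supported d \<Longrightarrow> cutval V d {t} = 0 \<Longrightarrow>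
      (\<And>S. tight S \<Longrightarrow> separates S T \<Longrightarrow> {t, p} \<subseteq> S \<Longrightarrow> cutval V d S = 0) \<Longrightarrow>
      tight S \<Longrightarrow> separates S T \<Longrightarrow> cutval V d S = 0"
  shows "half_cactus V w"
proof -
  have tp: "t \<in> V" "p \<in> V" "t \<noteq> p" using w_in w_in2 w_irrefl p by blast+
  have lift: "liftable {t, p}"
    unfolding liftable_def
  proof (intro allI impI)
    fix d
    assume d: "supported d" "\<forall>S. tight S \<longrightarrow> separates S T \<longrightarrow> {t, p} \<subseteq> S \<longrightarrow> cutval V d S = 0"
    \<comment> \<open>The coefficient makes \<open>d + e\<close> vanish on the star of
      \<open>t\<close>.\<close>
    define e where "e = edge_fn t p (- cutval V d {t})"
    have e: "supported e" unfolding e_def by (rule supported_edge_fn[OF p(1)])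
    have cute: "cutval V e S = (if (t \<in> S) = (p \<in> S) then 0 else - cutval V d {t})" if "S \<subseteq> V" for S
      unfolding e_def by (rule cutval_edge_fn'[OF p(1) that])
    have 1: "cutval V (\<lambda>u v. d u v + e u v) {t} = 0"
      using cute[of "{t}"] tp by (simp add: cutval_add)
    have 2: "cutval V (\<lambda>u v. d u v + e u v) S = 0"
      if "tight S" "separates S T" "{t, p} \<subseteq> S" for S
      using d(2) cute[of S] that by (auto simp: cutval_add tight_def)
    have "cutval V d S + cutval V e S = 0" if "tight S" "separates S T" for S
      using reduce[OF supported_add[OF d(1) e] 1 2 that] by (simp add: cutval_add)
    moreover have "\<forall>u v. e u v \<noteq> 0 \<longrightarrow> u \<in> {t, p} \<and> v \<in> {t, p}"
      by (auto simp: e_def edge_fn_def doubleton_eq_iff)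
    ultimately show "\<exists>e. supported e \<and> (\<forall>u v. e u v \<noteq> 0 \<longrightarrow> u \<in> {t, p} \<and> v \<in> {t, p}) \<and>
        (\<forall>S. tight S \<longrightarrow> separates S T \<longrightarrow> cutval V d S + cutval V e S = 0)"
      using e by blast
  qed
  have X: "{t, p} \<subseteq> V" "t \<in> {t, p}" "p \<in> {t, p}" "{t, p} \<inter> T \<noteq> {}" using tp t(1) by auto
  note c = contraction[OF X(1-3) tp(3) p(2) T X(4) lift IH]
  have half: "2 * w u v \<in> \<int>" if "u \<notin> {t, p} \<or> v \<notin> {t, p}" for u v
    by (rule c(1)[OF that])
  have "1 = cutval V w {t}" using t(2) by (simp add: tight_def)
  also have "\<dots> = w t p + (\<Sum>v\<in>V - {t, p}. w t v)"
    using sum.remove[of "V - {t}" p "w t"] tp finV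
    by (simp add: cutval_singleton insert_commute Diff_insert[symmetric])
  finally have "2 * w t p = 2 - 2 * (\<Sum>v\<in>V - {t, p}. w t v)" by simp
  moreover have "2 * (\<Sum>v\<in>V - {t, p}. w t v) \<in> \<int>"
    using half by (intro half_integral_outside) auto
  ultimately have "2 * w t p \<in> \<int>" by simp
  then have "2 * w u v \<in> \<int>" for u v
    using half[of u v] w_irrefl w_commute[of t p] by (cases "u \<in> {t, p} \<and> v \<in> {t, p}") auto
  moreover have "\<exists>S\<subseteq>V. u \<in> S \<and> v \<notin> S \<and> cutval V w S = 1"
    if uv: "u \<in> V" "v \<in> V" "u \<noteq> v" for u v
  proof (cases "u \<in> {t, p} \<and> v \<in> {t, p}")
    case True
    then consider "u = t" "v = p" | "u = p" "v = t" using uv by blast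
    then show ?thesis
    proof cases
      case 1
      then show ?thesis using t(2) tp by (intro exI[of _ "{t}"]) (auto simp: tight_def)
    next
      case 2
      then show ?thesis using tight_Compl[OF t(2)] tp by (intro exI[of _ "V - {t}"]) (auto simp: tight_def)
    qed
  next
    case False
    then show ?thesis using c(2)[OF uv] by blast
  qed
  ultimately show ?thesis by (simp add: half_cactus_def)
qed

end

context cut_weights
begin

text \<open>As \<open>p\<close> sends nothing to the rest of \<open>Q - P\<close>, uncrossing
  \<open>insert p P\<close> with \<open>Q - {p}\<close> has no error term. So a single node can be
  moved from a large tight set to a small one.\<close>

lemma cutval_insert_uncross:
  assumes "P \<subseteq> Q" "Q \<subseteq> V" "p \<in> Q" "p \<notin> P" "\<And>q. q \<in> Q \<Longrightarrow> q \<notin> P \<Longrightarrow> w p q = 0"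
  shows "cutval V w (insert p P) + cutval V w (Q - {p}) = cutval V w P + cutval V w Q"
proof -
  have eq: "insert p P \<inter> (Q - {p}) = P" "insert p P \<union> (Q - {p}) = Q"
    "insert p P - (Q - {p}) = {p}" "Q - {p} - insert p P = Q - insert p P"
    using assms by auto
  have "weight w {p} (Q - insert p P) = 0"
    using assms(5) by (auto simp: weight_def intro!: sum.neutral)
  then show ?thesis
    using cutval_uncross[where d = w and A = "insert p P" and B = "Q - {p}", OF finV w_commute] assms eq
    by auto
qed

lemma cutval_pair:
  assumes "a \<in> V" "b \<in> V" "a \<noteq> b" "\<And>u v. d u v = d v u"
  shows "cutval V d {a, b} = cutval V d {a} + cutval V d {b} - 2 * d a b"
  using cutval_Un[where d = d and A = "{a}" and B = "{b}", OF finV assms(4)] assms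
  by (simp add: weight_def insert_commute)

lemma supported_edge_fn_0: "(w p q = 0 \<Longrightarrow> c = 0) \<Longrightarrow> supported (edge_fn p q c)"
  using w_commute by (auto simp: supported_def edge_fn_def doubleton_eq_iff)

end

section \<open>Reductions: contractible tight sets with one or two terminals\<close>

context steiner_vertex
begin

text \<open>Perturbing only the edge between \<open>p\<close> and \<open>q\<close> would change no
  tight Steiner cut that is contained in \<open>X\<close> or contains \<open>X\<close>, hence none
  at all by \<open>noncrossing_suffices\<close>.\<close>

lemma no_edge_in_atom:
  assumes "tight X" "separates X T" "p \<in> X" "q \<in> X"
    and "\<And>S. tight S \<Longrightarrow> separates S T \<Longrightarrow> S \<subseteq> X \<Longrightarrow> p \<in> S \<longleftrightarrow> q \<in> S"
  shows "w p q = 0"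
proof (rule ccontr)
  assume w: "w p q \<noteq> 0"
  have "cutval V (edge_fn p q 1) S = 0" if S: "tight S" "separates S T" for S
  proof (rule noncrossing_suffices[OF assms(1) supported_edge_fn[OF w] _ _ assms(2) S])
    show "cutval V (edge_fn p q 1) S = 0" if "tight S" "separates S T" "S \<subseteq> X" for S
      using assms(5)[OF that] cutval_edge_fn'[OF w, of S] tightD(1)[OF that(1)] by simp
    show "cutval V (edge_fn p q 1) S = 0" if "tight S" "separates S T" "X \<subseteq> S" for S
      using assms(3,4) that cutval_edge_fn'[OF w, of S] tightD(1)[OF that(1)] by auto
  qed
  then have "edge_fn p q 1 p q = 0"
    by (intro unique[OF supported_edge_fn[OF w]])
  then show False by (simp add: edge_fn_def)
qed

text \<open>In a minimal tight Steiner set no tight Steiner subset distinguishes nodes, so its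
  terminal has no edges inside. Splitting that terminal off would divide the weight one between two
  cuts that weigh at least one each, unless it is the whole set.\<close>

lemma tight_contains_terminal:
  assumes "tight S" "separates S T"
  shows "\<exists>t\<in>S \<inter> T. tight {t}"
proof -
  define P where "P X \<longleftrightarrow> tight X \<and> separates X T \<and> X \<subseteq> S" for X
  have "P S" using assms by (simp add: P_def)
  then obtain X where X: "P X" and min: "\<And>Y. P Y \<Longrightarrow> card X \<le> card Y"
    using ex_has_least_nat[of P S card] by blast
  have XV: "X \<subseteq> V" using X by (auto simp: P_def tight_def)
  have finX: "finite X" using XV finV finite_subset by blast
  obtain t where t: "t \<in> X" "t \<in> T" using X by (auto simp: P_def separates_def)
  have no_edge: "w t q = 0" if "q \<in> X" for q
  proof (rule no_edge_in_atom)
    show "t \<in> Y \<longleftrightarrow> q \<in> Y" if Y: "tight Y" "separates Y T" "Y \<subseteq> X" for Y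
    proof -
      have "P Y" using Y X by (auto simp: P_def)
      then have "Y = X" using min[of Y] card_seteq[OF finX Y(3)] by blast
      then show ?thesis using \<open>q \<in> X\<close> t by simp
    qed
  qed (use X t that in \<open>auto simp: P_def\<close>)
  have "X = {t}"
  proof (rule ccontr)
    assume "X \<noteq> {t}"
    then have ne: "X - {t} \<noteq> {}" using t by blast
    have "1 \<le> cutval V w {t}" "1 \<le> cutval V w (X - {t})"
      by (rule cut_ge_1; use XV t ne X in \<open>auto simp: P_def tight_def\<close>)+
    moreover have "cutval V w {t} + cutval V w (X - {t}) = 1"
      using cutval_insert_uncross[of "{}" X t] XV t no_edge X by (auto simp: P_def tight_def)
    ultimately show False by linarith
  qed
  then show ?thesis using X t by (auto simp: P_def)
qed

lemma steiner_vertex_tight_terminals: "steiner_vertex V w {t \<in> T. tight {t}}"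
proof
  show "{t \<in> T. tight {t}} \<subseteq> V" using T_sub by blast
  fix d u v
  assume d: "supported d"
    and kill: "\<And>S. tight S \<Longrightarrow> separates S {t \<in> T. tight {t}} \<Longrightarrow> cutval V d S = 0"
  show "d u v = 0"
  proof (rule unique[OF d])
    fix S
    assume S: "tight S" "separates S T"
    obtain t where "t \<in> S \<inter> T" "tight {t}" using tight_contains_terminal[OF S] by blast
    moreover obtain t' where "t' \<in> (V - S) \<inter> T" "tight {t'}"
      using tight_contains_terminal[OF tight_Compl[OF S(1)] separates_Compl[OF tightD(1)[OF S(1)] S(2)]]
      by blast
    ultimately have "separates S {t \<in> T. tight {t}}" by (auto simp: separates_def)
    then show "cutval V d S = 0" using kill S by blast
  qed
qed

text \<open>A minimal set \<open>X\<close> of this kind has only \<open>{t}\<close> as a proper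
  tight Steiner subset, so there are no edges inside \<open>X - {t}\<close>. A pair of
  \<open>t\<close> and some \<open>p\<close> in \<open>X\<close> is then tight itself, and it is
  contracted.\<close>

lemma half_cactus_if_nonsingleton_terminal_set:
  assumes t: "t \<in> T" "tight {t}" and S: "tight S" "separates S T" "S \<inter> T = {t}" "S \<noteq> {t}"
    and T: "card T \<le> 5" and IH: half_cactus_below
  shows "half_cactus V w"
proof -
  define P where "P X \<longleftrightarrow> tight X \<and> separates X T \<and> X \<inter> T = {t} \<and> X \<noteq> {t}" for X
  have "P S" using S by (simp add: P_def)
  then obtain X where X: "P X" and min: "\<And>Y. P Y \<Longrightarrow> card X \<le> card Y"
    using ex_has_least_nat[of P S card] by blast
  have XV: "X \<subseteq> V" using X by (auto simp: P_def tight_def)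
  have finX: "finite X" using XV finV finite_subset by blast
  have tX: "t \<in> X" using X by (auto simp: P_def)
  have sub: "Y = {t} \<or> Y = X" if Y: "tight Y" "separates Y T" "Y \<subseteq> X" for Y
  proof (rule disjCI)
    assume "Y \<noteq> X"
    then have "card Y < card X" using Y finX by (intro psubset_card_mono) auto
    then have "\<not> P Y" using min[of Y] by auto
    moreover have "Y \<inter> T = {t}" using X Y by (auto simp: P_def separates_def)
    ultimately show "Y = {t}" using Y by (simp add: P_def)
  qed
  obtain p where p: "p \<in> X" "p \<noteq> t" using X tX by (auto simp: P_def)
  have no_edge: "w p q = 0" if "q \<in> X" "q \<noteq> t" for q
  proof (rule no_edge_in_atom)
    show "p \<in> Y \<longleftrightarrow> q \<in> Y" if "tight Y" "separates Y T" "Y \<subseteq> X" for Y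
      using sub[OF that] p \<open>q \<in> X\<close> \<open>q \<noteq> t\<close> by auto
  qed (use X p that in \<open>auto simp: P_def\<close>)
  have XT: "X \<inter> T = {t}" "T - X \<noteq> {}" "tight X" using X by (auto simp: P_def separates_def)
  have pV: "p \<in> V" using p XV by blast
  have ge: "1 \<le> cutval V w {t, p}" "1 \<le> cutval V w (X - {p})" "1 \<le> cutval V w {p}"
    by (rule cut_ge_1; use XV tX p XT T_sub in blast)+
  \<comment> \<open>The two values on the left are at least one and the sum on the right is
    two.\<close>
  have "cutval V w (insert p {t}) + cutval V w (X - {p}) = cutval V w {t} + cutval V w X"
    by (rule cutval_insert_uncross) (use XV tX p no_edge in auto)
  then have tp: "tight {t, p}"
    using ge t XT XV p tX by (auto simp: tight_def insert_commute)
  have tpT: "separates {t, p} T" "{t, p} \<inter> T = {t}"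
    using XT p tX t(1) by (auto simp: separates_def)
  have "w t p \<noteq> 0"
  proof
    assume "w t p = 0"
    then have "cutval V w {t, p} = cutval V w {t} + cutval V w {p}"
      using cutval_pair[where d = w, OF _ pV _ w_commute, of t] p t T_sub by auto
    then show False using tp t(2) ge by (simp add: tight_def)
  qed
  moreover have "{t, p} \<noteq> V" using tp by (auto simp: tight_def)
  ultimately show ?thesis
  proof (rule contract_pair[OF t _ _ T IH])
    fix d S
    assume d: "supported d" "cutval V d {t} = 0"
      "\<And>S. tight S \<Longrightarrow> separates S T \<Longrightarrow> {t, p} \<subseteq> S \<Longrightarrow> cutval V d S = 0"
      and S: "tight S" "separates S T"
    show "cutval V d S = 0"
    proof (rule noncrossing_suffices[OF tp d(1) _ d(3) tpT(1) S])
      show "cutval V d S = 0" if S: "tight S" "separates S T" "S \<subseteq> {t, p}" for S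
      proof (cases "p \<in> S")
        case True
        then have "{t, p} \<subseteq> S" using S(2,3) tpT(2) by (auto simp: separates_def)
        then show ?thesis using d(3) S by blast
      next
        case False
        then have "S = {t}" using S(2,3) by (auto simp: separates_def)
        then show ?thesis using d(2) by simp
      qed
    qed auto
  qed
qed

text \<open>The only tight set that contains \<open>t\<close> but not \<open>p\<close> is
  \<open>{t}\<close>: removing \<open>t\<close> from a larger one would lower its cut from one to
  zero. So \<open>{t, p}\<close> can be contracted.\<close>

lemma half_cactus_if_leaf:
  assumes t: "t \<in> T" "tight {t}" and p: "w t p \<noteq> 0" "\<And>v. v \<noteq> p \<Longrightarrow> w t v = 0"
    and T: "card T \<le> 5" and V: "3 \<le> card V" and IH: half_cactus_below
  shows "half_cactus V w"
proof -
  have tV: "t \<in> V" "p \<in> V" "t \<noteq> p" using w_in w_in2 w_irrefl p(1) by blast+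
  have "{t, p} \<noteq> V" using V tV by auto
  with p(1) show ?thesis
  proof (rule contract_pair[OF t _ _ T IH])
    fix d S
    assume d: "supported d" "cutval V d {t} = 0"
      "\<And>S. tight S \<Longrightarrow> separates S T \<Longrightarrow> {t, p} \<subseteq> S \<Longrightarrow> cutval V d S = 0"
      and S: "tight S" "separates S T"
    have key: "cutval V d S = 0" if S: "tight S" "separates S T" "t \<in> S" for S
    proof (cases "p \<in> S")
      case True
      then show ?thesis using d(3) S by blast
    next
      case False
      have SV: "S \<subseteq> V" by (rule tightD(1)[OF S(1)])
      have "S = {t}"
      proof (rule ccontr)
        assume "S \<noteq> {t}"
        then have "1 \<le> cutval V w (S - {t})"
          using S SV tV by (intro cut_ge_1) auto
        moreover have "cutval V w {t} + cutval V w (S - {t}) = cutval V w {} + cutval V w S"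
        proof (rule cutval_insert_uncross)
          show "w t q = 0" if "q \<in> S" for q using p(2) False that by metis
        qed (use SV S in auto)
        ultimately show False using S(1) t(2) by (simp add: tight_def)
      qed
      then show ?thesis using d(2) by simp
    qed
    show "cutval V d S = 0"
    proof (cases "t \<in> S")
      case True
      then show ?thesis using key S by blast
    next
      case False
      then have "cutval V d (V - S) = 0"
        using key[OF tight_Compl[OF S(1)] separates_Compl[OF tightD(1)[OF S(1)] S(2)]] tV by blast
      then show ?thesis using cutval_supported_Compl[OF d(1) tightD(1)[OF S(1)]] by simp
    qed
  qed
qed

text \<open>Common end of the two cases of the next lemma. In \<open>solve\<close>, the unknowns
  \<open>x\<close>, \<open>y\<close>, \<open>z\<close> are corrections on the edges
  \<open>ab\<close>, \<open>ap\<close>, \<open>bp\<close> that repair the tight cuts properly inside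
  the triple; in \<open>half\<close>, the numbers \<open>\<alpha>\<close> and \<open>\<beta>\<close>
  are the weights from \<open>a\<close> and \<open>b\<close> to the outside.\<close>

lemma contract_triple:
  assumes ab: "a \<in> T" "tight {a}" "b \<in> T" "tight {b}" and dist: "a \<noteq> b" "a \<noteq> p" "b \<noteq> p"
    and X: "tight {a, b, p}" "separates {a, b, p} T"
    and sub: "\<And>S. tight S \<Longrightarrow> separates S T \<Longrightarrow> S \<subseteq> {a, b, p} \<Longrightarrow> S \<in> {{a}, {b}, {a, b}, {a, b, p}}"
    and solve: "\<And>\<alpha> \<beta> \<gamma> :: real. \<exists>x y z :: real. (w a b = 0 \<longrightarrow> x = 0) \<and> (w a p = 0 \<longrightarrow> y = 0) \<and> (w b p = 0 \<longrightarrow> z = 0)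
      \<and> x + y = \<alpha> \<and> x + z = \<beta> \<and> (tight {a, b} \<longrightarrow> y + z = \<gamma>)"
    and half: "\<And>\<alpha> \<beta>. 2 * \<alpha> \<in> \<int> \<Longrightarrow> 2 * \<beta> \<in> \<int> \<Longrightarrow> w a b + w a p = 1 - \<alpha> \<Longrightarrow> w a b + w b p = 1 - \<beta> \<Longrightarrow>
      2 * w a b \<in> \<int> \<and> 2 * w a p \<in> \<int> \<and> 2 * w b p \<in> \<int>"
    and T: "card T \<le> 5" and IH: half_cactus_below
  shows "half_cactus V w"
proof -
  have XV: "{a, b, p} \<subseteq> V" using X by (simp add: tight_def)
  have lift: "liftable {a, b, p}"
    unfolding liftable_def
  proof (intro allI impI)
    fix d
    assume d: "supported d"
      "\<forall>S. tight S \<longrightarrow> separates S T \<longrightarrow> {a, b, p} \<subseteq> S \<longrightarrow> cutval V d S = 0"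
    obtain x y z where xyz: "w a b = 0 \<longrightarrow> x = 0" "w a p = 0 \<longrightarrow> y = 0" "w b p = 0 \<longrightarrow> z = 0"
      "x + y = - cutval V d {a}" "x + z = - cutval V d {b}" "tight {a, b} \<longrightarrow> y + z = - cutval V d {a, b}"
      using solve[of "- cutval V d {a}" "- cutval V d {b}" "- cutval V d {a, b}"] by blast
    define e where "e u v = edge_fn a b x u v + (edge_fn a p y u v + edge_fn b p z u v)" for u v
    have se: "supported e"
      unfolding e_def using xyz by (intro supported_add supported_edge_fn_0) auto
    have inside: "\<forall>u v. e u v \<noteq> 0 \<longrightarrow> u \<in> {a, b, p} \<and> v \<in> {a, b, p}"
      by (auto simp: e_def edge_fn_def doubleton_eq_iff)
    have ce: "cutval V e S = (if (a \<in> S) = (b \<in> S) then 0 else x)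
        + ((if (a \<in> S) = (p \<in> S) then 0 else y) + (if (b \<in> S) = (p \<in> S) then 0 else z))"
      if "S \<subseteq> V" for S
      unfolding e_def cutval_add using that XV dist finV by (simp add: cutval_edge_fn)
    have dX: "cutval V d {a, b, p} = 0" using d(2) X by blast
    have "cutval V (\<lambda>u v. d u v + e u v) S = 0" if S: "tight S" "separates S T" for S
    proof (rule noncrossing_suffices[OF X(1) supported_add[OF d(1) se] _ _ X(2) S])
      show "cutval V (\<lambda>u v. d u v + e u v) S = 0" if S: "tight S" "separates S T" "S \<subseteq> {a, b, p}" for S
      proof -
        consider "S = {a}" | "S = {b}" | "S = {a, b}" | "S = {a, b, p}" using sub[OF S] by blast
        then show ?thesis
          by cases (use S(1) XV dist xyz dX in \<open>simp_all add: cutval_add ce\<close>)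
      qed
      show "cutval V (\<lambda>u v. d u v + e u v) S = 0" if S: "tight S" "separates S T" "{a, b, p} \<subseteq> S" for S
        using S d(2) cutval_inside[of e "{a, b, p}" S] inside by (simp add: cutval_add)
    qed
    then show "\<exists>e. supported e \<and> (\<forall>u v. e u v \<noteq> 0 \<longrightarrow> u \<in> {a, b, p} \<and> v \<in> {a, b, p}) \<and>
        (\<forall>S. tight S \<longrightarrow> separates S T \<longrightarrow> cutval V d S + cutval V e S = 0)"
      using se inside by (intro exI[of _ e]) (simp add: cutval_add)
  qed
  have X': "a \<in> {a, b, p}" "b \<in> {a, b, p}" "{a, b, p} \<noteq> V" "{a, b, p} \<inter> T \<noteq> {}"
    using X ab by (auto simp: tight_def)
  note c = contraction[OF XV X'(1,2) dist(1) X'(3) T X'(4) lift IH]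
  have 1: "1 = w a b + w a p + (\<Sum>v\<in>V - {a, b, p}. w a v)"
  proof -
    have "1 = (\<Sum>v\<in>V - {a}. w a v)" using ab cutval_singleton[of a V w] T_sub by (auto simp: tight_def)
    also have "V - {a} = insert b (insert p (V - {a, b, p}))" using XV dist by auto
    finally show ?thesis using finV dist by (simp add: insert_commute)
  qed
  have 2: "1 = w a b + w b p + (\<Sum>v\<in>V - {a, b, p}. w b v)"
  proof -
    have "1 = (\<Sum>v\<in>V - {b}. w b v)" using ab cutval_singleton[of b V w] T_sub by (auto simp: tight_def)
    also have "V - {b} = insert a (insert p (V - {a, b, p}))" using XV dist by auto
    finally show ?thesis using finV dist w_commute[of a b] by (simp add: insert_commute)
  qed
  have "2 * (\<Sum>v\<in>V - {a, b, p}. w a v) \<in> \<int>" "2 * (\<Sum>v\<in>V - {a, b, p}. w b v) \<in> \<int>"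
    by (rule half_integral_outside, rule c(1), blast)+
  then have in_half: "2 * w a b \<in> \<int> \<and> 2 * w a p \<in> \<int> \<and> 2 * w b p \<in> \<int>"
    by (rule half) (use 1 2 in auto)
  have "2 * w u v \<in> \<int>" for u v
  proof (cases "u \<in> {a, b, p} \<and> v \<in> {a, b, p}")
    case True
    then show ?thesis using in_half w_irrefl w_commute by (metis Ints_0 insertE mult_zero_right singletonD)
  next
    case False
    then show ?thesis using c(1)[of u v] by blast
  qed
  moreover have "\<exists>S\<subseteq>V. u \<in> S \<and> v \<notin> S \<and> cutval V w S = 1"
    if uv: "u \<in> V" "v \<in> V" "u \<noteq> v" for u v
  proof (cases "u \<in> {a, b, p} \<and> v \<in> {a, b, p}")
    case True
    note tt = tight_Compl[OF ab(2)] tight_Compl[OF ab(4)] ab(2,4)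
    consider "u = a" | "u = b" | "v = a" "u = p" | "v = b" "u = p" using True uv by blast
    then show ?thesis
    proof cases
      case 1 then show ?thesis using tt uv by (intro exI[of _ "{a}"]) (auto simp: tight_def)
    next
      case 2 then show ?thesis using tt uv by (intro exI[of _ "{b}"]) (auto simp: tight_def)
    next
      case 3 then show ?thesis using tt uv by (intro exI[of _ "V - {a}"]) (auto simp: tight_def)
    next
      case 4 then show ?thesis using tt uv by (intro exI[of _ "V - {b}"]) (auto simp: tight_def)
    qed
  next
    case False
    then show ?thesis using c(2)[OF uv] by blast
  qed
  ultimately show ?thesis by (simp add: half_cactus_def)
qed

text \<open>A minimal set \<open>X\<close> of this kind has no tight Steiner subsets but
  \<open>{a}\<close>, \<open>{b}\<close>, \<open>{a, b}\<close> and itself, so no edges join its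
  nonterminals. With so few equations inside \<open>X\<close>, few edges fit, and \<open>X\<close>
  has exactly one nonterminal \<open>p\<close>.\<close>

lemma half_cactus_if_nonpair_terminal_set:
  assumes all: "\<And>t. t \<in> T \<Longrightarrow> tight {t}"
    and single: "\<And>S t. tight S \<Longrightarrow> separates S T \<Longrightarrow> S \<inter> T = {t} \<Longrightarrow> S = {t}"
    and S: "tight S" "separates S T" "S \<inter> T = {a, b}" "S \<noteq> {a, b}" and ab: "a \<noteq> b"
    and T: "card T \<le> 5" and IH: half_cactus_below
  shows "half_cactus V w"
proof -
  define P where "P X \<longleftrightarrow> tight X \<and> separates X T \<and> X \<inter> T = {a, b} \<and> X \<noteq> {a, b}" for X
  have "P S" using S by (simp add: P_def)
  then obtain X where X: "P X" and min: "\<And>Y. P Y \<Longrightarrow> card X \<le> card Y"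
    using ex_has_least_nat[of P S card] by blast
  have XV: "X \<subseteq> V" using X by (auto simp: P_def tight_def)
  have finX: "finite X" using XV finV finite_subset by blast
  have XT: "X \<inter> T = {a, b}" "T - X \<noteq> {}" "tight X" "separates X T" "X \<noteq> {a, b}"
    using X by (auto simp: P_def separates_def)
  have abX: "a \<in> X" "b \<in> X" "a \<in> T" "b \<in> T" "a \<in> V" "b \<in> V" using XT XV by auto
  note tab = all[OF abX(3)] all[OF abX(4)]
  have sub: "Y \<in> {{a}, {b}, {a, b}, X}" if Y: "tight Y" "separates Y T" "Y \<subseteq> X" for Y
  proof -
    have "Y \<inter> T \<subseteq> {a, b}" "Y \<inter> T \<noteq> {}" using XT(1) Y by (auto simp: separates_def)
    then consider "Y \<inter> T = {a}" | "Y \<inter> T = {b}" | "Y \<inter> T = {a, b}" by blast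
    then show ?thesis
    proof cases
      case 3
      show ?thesis
      proof (cases "Y = X")
        case False
        then have "card Y < card X" using Y finX by (intro psubset_card_mono) auto
        then have "\<not> P Y" using min[of Y] by auto
        then show ?thesis using Y 3 by (simp add: P_def)
      qed simp
    qed (use single[OF Y(1,2)] in simp_all)
  qed
  have no_edge: "w p q = 0" if "p \<in> X - {a, b}" "q \<in> X - {a, b}" for p q
  proof (rule no_edge_in_atom)
    show "p \<in> Y \<longleftrightarrow> q \<in> Y" if "tight Y" "separates Y T" "Y \<subseteq> X" for Y
      using sub[OF that] \<open>p \<in> X - {a, b}\<close> \<open>q \<in> X - {a, b}\<close> by auto
  qed (use XT that in auto)
  have isolated: False if "p \<in> X" "\<And>q. q \<in> X \<Longrightarrow> w p q = 0" for p
  proof -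
    have "1 \<le> cutval V w {p}" "1 \<le> cutval V w (X - {p})"
      by (rule cut_ge_1; use XV XT ab abX that in auto)+
    moreover have "cutval V w {p} + cutval V w (X - {p}) = cutval V w {} + cutval V w X"
      by (rule cutval_insert_uncross) (use XV that in auto)
    ultimately show False using XT(3) by (simp add: tight_def)
  qed
  obtain p where p: "p \<in> X" "p \<noteq> a" "p \<noteq> b" using XT abX by blast
  have pT: "p \<notin> T" "p \<in> V" using p XT(1) XV by auto
  show ?thesis
  \<comment> \<open>If \<open>{a, b}\<close> is tight, the three equations inside \<open>X\<close>
    go with a full triangle. Otherwise there are only two equations, and two edges.\<close>
  proof (cases "tight {a, b}")
    case True
    have ge: "1 \<le> cutval V w {a, b, p}" "1 \<le> cutval V w (X - {p})"
      by (rule cut_ge_1; use XV XT p abX T_sub in blast)+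
    have "cutval V w (insert p {a, b}) + cutval V w (X - {p}) = cutval V w {a, b} + cutval V w X"
      by (rule cutval_insert_uncross) (use XV abX p no_edge in auto)
    then have "tight {a, b, p}"
      using ge True XT XV p pT abX by (simp add: tight_def insert_commute)
    moreover have "separates {a, b, p} T" "{a, b, p} \<inter> T = {a, b}" "{a, b, p} \<noteq> {a, b}"
      using XT abX pT p by (auto simp: separates_def)
    ultimately have "P {a, b, p}" by (simp add: P_def)
    then have Xeq: "X = {a, b, p}"
      using min[of "{a, b, p}"] card_seteq[OF finX, of "{a, b, p}"] abX p by auto
    have wab: "w a b = 1 / 2"
      using cutval_pair[where d = w, OF abX(5,6) ab w_commute] True tab by (simp add: tight_def)
    have cX: "cutval V w X = 1 + cutval V w {p} - 2 * (w a p + w b p)"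
      using cutval_Un[where d = w and A = "{a, b}" and B = "{p}", OF finV w_commute] True abX p pT ab Xeq
      by (auto simp: tight_def weight_def insert_commute)
    \<comment> \<open>Equality would make \<open>{c, p}\<close> tight, against
      \<open>single\<close>. It would occur if one of the edges \<open>ap\<close> and
      \<open>bp\<close> were missing, since tightness of \<open>X\<close> gives \<open>p\<close> a
      star of weight \<open>2 * (w a p + w b p)\<close>.\<close>
    have nz: False if c: "c \<in> {a, b}" "cutval V w {p} = 2 * w c p" for c
    proof -
      have cc: "c \<in> V" "c \<in> T" "c \<noteq> p" "tight {c}" using c abX p tab by auto
      have "cutval V w {c, p} = 1"
        using cutval_pair[where d = w, OF cc(1) pT(2) cc(3) w_commute] c cc by (simp add: tight_def)
      then have "tight {c, p}" using cc pT by (simp add: tight_def)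
      moreover have "separates {c, p} T" "{c, p} \<inter> T = {c}"
        using cc pT XT abX p c by (auto simp: separates_def)
      ultimately have "{c, p} = {c}" by (rule single)
      then show False using cc by auto
    qed
    have "w a p \<noteq> 0" using nz[of b] cX XT(3) by (auto simp: tight_def)
    moreover have "w b p \<noteq> 0" using nz[of a] cX XT(3) by (auto simp: tight_def)
    ultimately show ?thesis
    proof (intro contract_triple[of a b p])
      show "\<exists>x y z. (w a b = 0 \<longrightarrow> x = 0) \<and> (w a p = 0 \<longrightarrow> y = 0) \<and> (w b p = 0 \<longrightarrow> z = 0)
        \<and> x + y = \<alpha> \<and> x + z = \<beta> \<and> (tight {a, b} \<longrightarrow> y + z = \<gamma>)"
        if "w a p \<noteq> 0" "w b p \<noteq> 0" for \<alpha> \<beta> \<gamma> :: real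
        using that wab by (intro exI[of _ "(\<alpha> + \<beta> - \<gamma>) / 2"] exI[of _ "(\<alpha> - \<beta> + \<gamma>) / 2"]
          exI[of _ "(\<beta> - \<alpha> + \<gamma>) / 2"]) (auto simp: field_simps)
      show "2 * w a b \<in> \<int> \<and> 2 * w a p \<in> \<int> \<and> 2 * w b p \<in> \<int>"
        if "2 * \<alpha> \<in> \<int>" "2 * \<beta> \<in> \<int>" "w a b + w a p = 1 - \<alpha>" "w a b + w b p = 1 - \<beta>" for \<alpha> \<beta>
      proof -
        have eq: "2 * w a p = 1 - 2 * \<alpha>" "2 * w b p = 1 - 2 * \<beta>" "2 * w a b = 1" using that wab by auto
        show ?thesis unfolding eq using that(1,2) by simp
      qed
    qed (use abX tab ab p XT Xeq sub T IH in auto)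
  next
    case False
    \<comment> \<open>The stars of \<open>a\<close> and \<open>b\<close> are the only equations
      inside \<open>X\<close>.\<close>
    have kernel: "d u v = 0"
      if d: "supported d" "\<And>u v. d u v \<noteq> 0 \<Longrightarrow> u \<in> X \<and> v \<in> X" "cutval V d {a} = 0" "cutval V d {b} = 0"
      for d u v
    proof (rule unique[OF d(1)], rule noncrossing_suffices[OF XT(3) d(1) _ _ XT(4)])
      show out: "cutval V d S = 0" if "X \<subseteq> S" for S
        using cutval_inside[of d X S] d(2) that by blast
      show "cutval V d S = 0" if S: "tight S" "separates S T" "S \<subseteq> X" for S
        using sub[OF S] False S(1) d(3,4) out by auto
    qed
    have one_nbr: "q = r"
      if c: "c \<in> {a, b}" and qr: "q \<in> X - {a, b}" "r \<in> X - {a, b}" "w c q \<noteq> 0" "w c r \<noteq> 0" for c q r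
    proof (rule ccontr)
      assume ne: "q \<noteq> r"
      define d where "d u v = edge_fn c q 1 u v + edge_fn c r (-1) u v" for u v
      have "d c q = 0"
      proof (rule kernel)
        show "supported d" unfolding d_def by (intro supported_add supported_edge_fn qr)
        show "d u v \<noteq> 0 \<Longrightarrow> u \<in> X \<and> v \<in> X" for u v
          using c qr abX by (auto simp: d_def edge_fn_def doubleton_eq_iff split: if_splits)
        show "cutval V d {a} = 0" "cutval V d {b} = 0"
          unfolding d_def cutval_add using c qr abX ab by (auto simp: cutval_edge_fn')
      qed
      then show False using ne c qr by (auto simp: d_def edge_fn_def doubleton_eq_iff)
    qed
    have no_path: False
      if qr: "q \<in> X - {a, b}" "r \<in> X - {a, b}" "w a b \<noteq> 0" "w a q \<noteq> 0" "w b r \<noteq> 0" for q r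
    proof -
      define d where "d u v = edge_fn a b 1 u v + (edge_fn a q (-1) u v + edge_fn b r (-1) u v)" for u v
      have "d a b = 0"
      proof (rule kernel)
        show "supported d" unfolding d_def by (intro supported_add supported_edge_fn qr)
        show "d u v \<noteq> 0 \<Longrightarrow> u \<in> X \<and> v \<in> X" for u v
          using qr abX by (auto simp: d_def edge_fn_def doubleton_eq_iff split: if_splits)
        show "cutval V d {a} = 0" "cutval V d {b} = 0"
          unfolding d_def cutval_add using qr abX ab by (auto simp: cutval_edge_fn')
      qed
      then show False using ab qr by (auto simp: d_def edge_fn_def doubleton_eq_iff)
    qed
    have nbr: "w a q \<noteq> 0 \<or> w b q \<noteq> 0" if "q \<in> X - {a, b}" for q
    proof (rule ccontr)
      assume "\<not> (w a q \<noteq> 0 \<or> w b q \<noteq> 0)"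
      then have "w q r = 0" if "r \<in> X" for r
        using no_edge[of q r] that \<open>q \<in> X - {a, b}\<close> w_commute[of q] by (cases "r \<in> {a, b}") auto
      then show False using isolated[of q] that by blast
    qed
    \<comment> \<open>Otherwise \<open>X\<close> would fall apart into \<open>{a, q}\<close> and
      \<open>{b, r}\<close> without edges between them, and its cut would weigh at least
      two.\<close>
    have two: False
      if qr: "q \<in> X - {a, b}" "r \<in> X - {a, b}" "q \<noteq> r" "w a q \<noteq> 0" "w b r \<noteq> 0" for q r
    proof -
      have "x \<in> {q, r}" if "x \<in> X - {a, b}" for x
        using nbr[OF that] one_nbr[of a x q] one_nbr[of b x r] that qr by auto
      then have Xeq: "X = {a, q} \<union> {b, r}" using qr abX by blast
      have z: "w a r = 0" "w q b = 0" "w a b = 0" "w q r = 0"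
        using one_nbr[of a q r] one_nbr[of b q r] no_path[of q r] no_edge[of q r] qr w_commute[of q b]
        by auto
      have disj: "{a, q} \<inter> {b, r} = {}" using qr ab by auto
      have "weight w {a, q} {b, r} = 0" unfolding weight_def using z qr ab by auto
      then have "cutval V w X = cutval V w {a, q} + cutval V w {b, r}"
        unfolding Xeq using cutval_Un[where d = w, OF finV w_commute _ _ disj] qr abX XV by auto
      moreover have "1 \<le> cutval V w {a, q}" "1 \<le> cutval V w {b, r}"
        by (rule cut_ge_1; use qr abX XV disj in blast)+
      ultimately show False using XT(3) by (simp add: tight_def)
    qed
    have "q = p" if q: "q \<in> X - {a, b}" for q
    proof (rule ccontr)
      assume ne: "q \<noteq> p"
      have p': "p \<in> X - {a, b}" using p by blast
      show False
        using nbr[OF q] nbr[OF p'] one_nbr[OF _ q p'] two[OF q p' ne] two[OF p' q] ne by auto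
    qed
    then have Xeq: "X = {a, b, p}" using p abX by blast
    have iso: "w a b \<noteq> 0 \<or> w a p \<noteq> 0" "w a b \<noteq> 0 \<or> w b p \<noteq> 0" "w a p \<noteq> 0 \<or> w b p \<noteq> 0"
    proof -
      have "\<exists>q\<in>{a, b, p}. w a q \<noteq> 0" "\<exists>q\<in>{a, b, p}. w b q \<noteq> 0"
        using isolated[of a] isolated[of b] abX Xeq by blast+
      then show "w a b \<noteq> 0 \<or> w a p \<noteq> 0" "w a b \<noteq> 0 \<or> w b p \<noteq> 0"
        using w_irrefl w_commute[of b a] by auto
      show "w a p \<noteq> 0 \<or> w b p \<noteq> 0" using nbr[of p] p by blast
    qed
    have tri: "w a b = 0 \<or> w a p = 0 \<or> w b p = 0" using no_path[of p p] p by blast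
    show ?thesis
    proof (rule contract_triple[of a b p])
      show "\<exists>x y z. (w a b = 0 \<longrightarrow> x = 0) \<and> (w a p = 0 \<longrightarrow> y = 0) \<and> (w b p = 0 \<longrightarrow> z = 0)
        \<and> x + y = \<alpha> \<and> x + z = \<beta> \<and> (tight {a, b} \<longrightarrow> y + z = \<gamma>)" for \<alpha> \<beta> \<gamma> :: real
      proof -
        consider "w a b = 0" | "w a p = 0" | "w b p = 0" using tri by blast
        then show ?thesis
        proof cases
          case 1
          then show ?thesis using iso False by (intro exI[of _ 0] exI[of _ \<alpha>] exI[of _ \<beta>]) auto
        next
          case 2
          then show ?thesis using iso False by (intro exI[of _ \<alpha>] exI[of _ 0] exI[of _ "\<beta> - \<alpha>"]) auto
        next
          case 3
          then show ?thesis using iso False by (intro exI[of _ \<beta>] exI[of _ "\<alpha> - \<beta>"] exI[of _ 0]) auto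
        qed
      qed
      show "2 * w a b \<in> \<int> \<and> 2 * w a p \<in> \<int> \<and> 2 * w b p \<in> \<int>"
        if h: "2 * \<alpha> \<in> \<int>" "2 * \<beta> \<in> \<int>" "w a b + w a p = 1 - \<alpha>" "w a b + w b p = 1 - \<beta>" for \<alpha> \<beta>
      proof -
        consider "w a b = 0" | "w a p = 0" | "w b p = 0" using tri by blast
        then show ?thesis
        proof cases
          case 1
          then have eq: "2 * w a p = 2 - 2 * \<alpha>" "2 * w b p = 2 - 2 * \<beta>" using h by auto
          show ?thesis unfolding eq using h(1,2) 1 by simp
        next
          case 2
          then have eq: "2 * w a b = 2 - 2 * \<alpha>" "2 * w b p = 2 * \<alpha> - 2 * \<beta>" using h by auto
          show ?thesis unfolding eq using h(1,2) 2 by simp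
        next
          case 3
          then have eq: "2 * w a b = 2 - 2 * \<beta>" "2 * w a p = 2 * \<beta> - 2 * \<alpha>" using h by auto
          show ?thesis unfolding eq using h(1,2) 3 by simp
        qed
      qed
    qed (use abX tab ab p XT Xeq sub T IH in auto)
  qed
qed

end

subsection \<open>Counting edges against tight cuts\<close>

lemma homogeneous_solution:
  fixes M :: "'i \<Rightarrow> 'e \<Rightarrow> real"
  assumes "finite I" "finite E" "card I < card E"
  shows "\<exists>x. (\<exists>e\<in>E. x e \<noteq> 0) \<and> (\<forall>i\<in>I. (\<Sum>e\<in>E. M i e * x e) = 0)"
  using assms
proof (induction I arbitrary: E M rule: finite_induct)
  case empty
  then obtain e where "e \<in> E" by fastforce
  then show ?case by (intro exI[of _ "\<lambda>_. 1"]) auto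
next
  case (insert i I)
  have cI: "card I < card E" "card I + 1 < card E" using insert by auto
  show ?case
  proof (cases "\<forall>e\<in>E. M i e = 0")
    case True
    then show ?thesis using insert.IH[OF insert.prems(1) cI(1), of M] by auto
  next
    case False
    then obtain g where g: "g \<in> E" "M i g \<noteq> 0" by blast
    \<comment> \<open>Elimination of the unknown \<open>g\<close> by means of equation
      \<open>i\<close>.\<close>
    define M' where "M' j e = M j e - M j g * M i e / M i g" for j e
    have "card I < card (E - {g})" using cI g insert.prems by simp
    then obtain x where x: "\<exists>e\<in>E - {g}. x e \<noteq> 0" "\<forall>j\<in>I. (\<Sum>e\<in>E - {g}. M' j e * x e) = 0"
      using insert.IH[of "E - {g}" M'] insert.prems by auto
    define y where "y e = (if e = g then - (\<Sum>e\<in>E - {g}. M i e * x e) / M i g else x e)" for e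
    have split: "(\<Sum>e\<in>E. M j e * y e) = M j g * y g + (\<Sum>e\<in>E - {g}. M j e * x e)" for j
      using g insert.prems by (simp add: sum.remove[of E g] y_def)
    have "(\<Sum>e\<in>E. M i e * y e) = 0"
      unfolding split using g by (simp add: y_def)
    moreover have "(\<Sum>e\<in>E. M j e * y e) = 0" if "j \<in> I" for j
    proof -
      have "(\<Sum>e\<in>E - {g}. M' j e * x e)
          = (\<Sum>e\<in>E - {g}. M j e * x e - (M j g / M i g) * (M i e * x e))"
        by (intro sum.cong refl) (simp add: M'_def algebra_simps)
      also have "\<dots> = (\<Sum>e\<in>E - {g}. M j e * x e) - (M j g / M i g) * (\<Sum>e\<in>E - {g}. M i e * x e)"
        by (simp add: sum_subtractf sum_distrib_left)
      finally show ?thesis unfolding split using x(2) that by (simp add: y_def)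
    qed
    moreover have "\<exists>e\<in>E. y e \<noteq> 0" using x(1) by (auto simp: y_def)
    ultimately show ?thesis by blast
  qed
qed

text \<open>Handshake lemma; the relation will be that of being mates.\<close>

lemma even_sum_card_symmetric:
  assumes "finite A" "\<And>s t. R s t \<longleftrightarrow> R t s" "\<And>t. \<not> R t t"
  shows "even (\<Sum>t\<in>A. card {s \<in> A. R t s})"
  using assms(1)
proof (induction A rule: finite_induct)
  case (insert a A)
  have "{s \<in> insert a A. R t s} = {s \<in> A. R t s} \<union> (if R a t then {a} else {})" for t
    using assms(2) by auto
  then have "card {s \<in> insert a A. R t s} = card {s \<in> A. R t s} + (if R a t then 1 else 0)" for t
    using insert by simp
  then have "(\<Sum>t\<in>insert a A. card {s \<in> insert a A. R t s})
      = card {s \<in> A. R a s} + ((\<Sum>t\<in>A. card {s \<in> A. R t s}) + (\<Sum>t\<in>A. if R a t then 1 else 0))"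
    using insert assms(3)[of a] by (simp add: sum.distrib)
  also have "(\<Sum>t\<in>A. if R a t then 1 else 0) = card {s \<in> A. R a s}"
    using insert by (simp add: sum.inter_filter[symmetric])
  finally show ?case using insert.IH by simp
qed simp

lemma sum_card_incident:
  assumes "finite E" "finite A"
  shows "(\<Sum>t\<in>A. card {e \<in> E. t \<in> e}) = (\<Sum>e\<in>E. card (e \<inter> A))"
proof -
  have "(\<Sum>t\<in>A. card {e \<in> E. t \<in> e}) = (\<Sum>t\<in>A. \<Sum>e\<in>E. if t \<in> e then 1 else 0)"
    using assms by (simp add: sum.inter_filter[symmetric])
  also have "\<dots> = (\<Sum>e\<in>E. \<Sum>t\<in>A. if t \<in> e then 1 else 0)" by (rule sum.swap)
  also have "\<dots> = (\<Sum>e\<in>E. card (e \<inter> A))"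
    using assms by (intro sum.cong refl) (simp add: sum.inter_filter[symmetric] Int_def conj_commute)
  finally show ?thesis .
qed

section \<open>Weights that admit no reduction\<close>

locale reduced_steiner_vertex = steiner_vertex +
  assumes tight_terminal: "t \<in> T \<Longrightarrow> tight {t}"
    and single: "tight S \<Longrightarrow> separates S T \<Longrightarrow> S \<inter> T = {t} \<Longrightarrow> S = {t}"
    and pair: "tight S \<Longrightarrow> separates S T \<Longrightarrow> S \<inter> T = {a, b} \<Longrightarrow> a \<noteq> b \<Longrightarrow> S = {a, b}"
    and no_leaf: "t \<in> T \<Longrightarrow> w t p \<noteq> 0 \<Longrightarrow> \<exists>v. v \<noteq> p \<and> w t v \<noteq> 0"
    and card_T: "card T \<le> 5"
    and card_V: "3 \<le> card V"
begin

text \<open>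
  For tight terminals \<open>a\<close> and \<open>b\<close>, the pair \<open>{a, b}\<close> is tight iff \<open>w a b = 1 / 2\<close>. A perturbation that
  vanishes on these cuts vanishes on such edges, so only the other edges are unknowns.
\<close>

definition free_edges :: "'a set set" where
  "free_edges = {e. \<exists>u v. e = {u, v} \<and> w u v \<noteq> 0 \<and> \<not> (u \<in> T \<and> v \<in> T \<and> w u v = 1 / 2)}"

definition mates :: "'a \<Rightarrow> 'a set" where
  "mates t = {s \<in> T. w t s = 1 / 2}"

definition frees :: "'a \<Rightarrow> 'a set" where
  "frees t = {v. w t v \<noteq> 0 \<and> \<not> (t \<in> T \<and> v \<in> T \<and> w t v = 1 / 2)}"

lemma finT: "finite T"
  using T_sub finV finite_subset by blast

lemma cut_terminal: "t \<in> T \<Longrightarrow> cutval V w {t} = 1"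
  using tight_terminal by (simp add: tight_def)

lemma frees_sub: "frees t \<subseteq> V - {t}"
  using w_in2 w_irrefl by (auto simp: frees_def)

lemma finite_frees: "finite (frees t)"
  using frees_sub finV finite_subset by blast

lemma mates_sub: "mates t \<subseteq> T - {t}"
  using w_irrefl by (auto simp: mates_def)

lemma finite_mates: "finite (mates t)"
  using mates_sub finT finite_subset by blast

lemma in_frees_commute: "v \<in> frees u \<longleftrightarrow> u \<in> frees v"
  using w_commute by (auto simp: frees_def)

lemma in_mates_commute: "u \<in> T \<Longrightarrow> v \<in> T \<Longrightarrow> v \<in> mates u \<longleftrightarrow> u \<in> mates v"
  using w_commute by (auto simp: mates_def)

lemma free_edge_iff: "{u, v} \<in> free_edges \<longleftrightarrow> v \<in> frees u"
  unfolding free_edges_def frees_def using w_commute by (auto simp: doubleton_eq_iff)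

lemma free_edges_sub: "free_edges \<subseteq> Pow V"
  using w_in w_in2 by (auto simp: free_edges_def)

lemma finite_free_edges: "finite free_edges"
  using free_edges_sub finV finite_subset by blast

lemma free_edgeE:
  assumes "e \<in> free_edges"
  obtains u v where "e = {u, v}" "u \<noteq> v" "u \<in> V" "v \<in> V" "w u v \<noteq> 0"
    "\<not> (u \<in> T \<and> v \<in> T \<and> w u v = 1 / 2)"
  using assms w_in w_in2 w_irrefl unfolding free_edges_def by blast

lemma incident_free_edges: "{e \<in> free_edges. v \<in> e} = (\<lambda>u. {v, u}) ` frees v"
proof -
  have "\<exists>u\<in>frees v. e = {v, u}" if e: "e \<in> free_edges" "v \<in> e" for e
  proof -
    obtain x y where xy: "e = {x, y}" using e(1) by (auto simp: free_edges_def)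
    then obtain u where "e = {v, u}" using e(2) by blast
    then show ?thesis using free_edge_iff e(1) by blast
  qed
  then show ?thesis using free_edge_iff by blast
qed

lemma inj_on_doubleton: "inj_on (\<lambda>u. {v, u}) A"
  by (auto simp: inj_on_def doubleton_eq_iff)

lemma card_incident_free_edges: "card {e \<in> free_edges. v \<in> e} = card (frees v)"
  unfolding incident_free_edges by (rule card_image[OF inj_on_doubleton])

lemma sum_card_frees:
  "A \<subseteq> V \<Longrightarrow> (\<Sum>t\<in>A. card (frees t)) = (\<Sum>e\<in>free_edges. card (e \<inter> A))"
  using sum_card_incident[OF finite_free_edges, of A] finV finite_subset
  by (auto simp: card_incident_free_edges)

lemma card_T_ge_2: "2 \<le> card T"
proof (rule ccontr)
  assume "\<not> 2 \<le> card T"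
  then have "card T \<le> 1" by simp
  then have "\<And>x y. x \<in> T \<Longrightarrow> y \<in> T \<Longrightarrow> x = y" using card_le_Suc0_iff_eq[OF finT] by auto
  then have "\<not> separates S T" for S unfolding separates_def by blast
  then have w0: "w u v = 0" for u v by (intro unique[OF supported_w]) auto
  obtain v where v: "v \<in> V" using card_V by fastforce
  have "{v} \<noteq> V" using card_V by auto
  then have "1 \<le> cutval V w {v}" using v by (intro cut_ge_1) auto
  then show False using w0 by (simp add: cutval_def weight_def)
qed

lemma separates_terminal: "t \<in> T \<Longrightarrow> S \<inter> T = {t} \<Longrightarrow> separates S T"
proof -
  assume t: "t \<in> T" "S \<inter> T = {t}"
  have "T \<noteq> {t}" using card_T_ge_2 by auto
  then show ?thesis using t by (auto simp: separates_def)
qed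

lemma pair_not_V: "{a, b} \<noteq> V"
proof
  assume "{a, b} = V"
  then have "card V = card {a, b}" by simp
  also have "\<dots> \<le> 2" by (cases "a = b") auto
  finally have "card V \<le> 2" .
  then show False using card_V by simp
qed

lemma le_half:
  assumes "s \<in> T" "t \<in> T" "s \<noteq> t"
  shows "w s t \<le> 1 / 2"
proof -
  have V: "s \<in> V" "t \<in> V" using assms T_sub by auto
  have "1 \<le> cutval V w {s, t}" using V pair_not_V by (intro cut_ge_1) auto
  then show ?thesis
    using cutval_pair[where d = w, OF V assms(3) w_commute] cut_terminal assms by simp
qed

text \<open>The place where five matters: a tight Steiner set or its complement contains at most two
  terminals, so by \<open>single\<close> and \<open>pair\<close> it is one terminal or two. Stars
  and pairs of weight 1/2 are all the equations there are.\<close>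

lemma unique_reduced:
  assumes d: "supported d" "\<And>t. t \<in> T \<Longrightarrow> cutval V d {t} = 0"
    "\<And>s t. s \<in> T \<Longrightarrow> t \<in> T \<Longrightarrow> w s t = 1 / 2 \<Longrightarrow> d s t = 0"
  shows "d u v = 0"
proof (rule unique[OF d(1)])
  have key: "cutval V d S = 0" if S: "tight S" "separates S T" "card (S \<inter> T) \<le> 2" for S
  proof -
    have "S \<inter> T \<noteq> {}" using S by (simp add: separates_def)
    then have "card (S \<inter> T) \<noteq> 0" using finT by simp
    then consider "card (S \<inter> T) = 1" | "card (S \<inter> T) = 2" using S(3) by linarith
    then show ?thesis
    proof cases
      case 1
      then obtain t where t: "S \<inter> T = {t}" by (auto simp: card_1_singleton_iff)
      then have "S = {t}" using single S by blast
      then show ?thesis using d(2) t by auto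
    next
      case 2
      then obtain a b where ab: "S \<inter> T = {a, b}" "a \<noteq> b" by (auto simp: card_2_iff)
      then have S_eq: "S = {a, b}" using pair S by blast
      have ab': "a \<in> T" "b \<in> T" "a \<in> V" "b \<in> V" using ab T_sub by auto
      have "w a b = 1 / 2"
        using cutval_pair[where d = w, OF ab'(3,4) ab(2) w_commute] S(1) ab' cut_terminal S_eq
        by (simp add: tight_def)
      then have "d a b = 0" using d(3) ab' by blast
      then show ?thesis
        using cutval_pair[where d = d, OF ab'(3,4) ab(2) supportedD(1)[OF d(1)]] ab' d(2) S_eq by simp
    qed
  qed
  fix S
  assume S: "tight S" "separates S T"
  have SV: "S \<subseteq> V" by (rule tightD(1)[OF S(1)])
  have "card (S \<inter> T) + card ((V - S) \<inter> T) = card T"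
  proof -
    have "T = (S \<inter> T) \<union> ((V - S) \<inter> T)" using T_sub by auto
    moreover have "card (S \<inter> T \<union> (V - S) \<inter> T) = card (S \<inter> T) + card ((V - S) \<inter> T)"
      using finT by (intro card_Un_disjoint) auto
    ultimately show ?thesis by metis
  qed
  then have "card (S \<inter> T) \<le> 2 \<or> card ((V - S) \<inter> T) \<le> 2" using card_T by linarith
  then show "cutval V d S = 0"
    using key[OF S] key[OF tight_Compl[OF S(1)] separates_Compl[OF SV S(2)]]
      cutval_supported_Compl[OF d(1) SV] by auto
qed

text \<open>An edge between two nonterminals occurs in none of the equations of
  \<open>unique_reduced\<close>.\<close>

lemma no_edge_outside: "u \<notin> T \<Longrightarrow> v \<notin> T \<Longrightarrow> w u v = 0"
proof (rule ccontr)
  assume uv: "u \<notin> T" "v \<notin> T" and w: "w u v \<noteq> 0"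
  have "edge_fn u v 1 u v = 0"
    by (rule unique_reduced[OF supported_edge_fn[OF w]])
      (use uv T_sub w in \<open>auto simp: cutval_edge_fn' edge_fn_def doubleton_eq_iff\<close>)
  then show False by (simp add: edge_fn_def)
qed

text \<open>By \<open>single\<close> the pair \<open>{t, z}\<close> is not tight, so its cut, of
  weight \<open>1 + cutval V w {z} - 2 * w t z\<close>, exceeds one.\<close>

lemma twice_lt_cut:
  assumes "z \<in> V - T" "t \<in> T"
  shows "2 * w t z < cutval V w {z}"
proof -
  have tz: "t \<in> V" "z \<in> V" "t \<noteq> z" using assms T_sub by auto
  have eq: "cutval V w {t, z} = 1 + cutval V w {z} - 2 * w t z"
    using cutval_pair[where d = w, OF tz w_commute] cut_terminal assms by simp
  have "{t, z} \<inter> T = {t}" using assms by auto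
  then have "\<not> tight {t, z}" using single[of "{t, z}" t] separates_terminal[OF assms(2)] tz by auto
  moreover have "1 \<le> cutval V w {t, z}" using tz pair_not_V by (intro cut_ge_1) auto
  ultimately show ?thesis using eq tz by (auto simp: tight_def)
qed

text \<open>Each edge at \<open>z\<close> carries less than half of the star of \<open>z\<close>, so
  two edges cannot fill it.\<close>

lemma card_frees_outside:
  assumes z: "z \<in> V - T"
  shows "3 \<le> card (frees z)"
proof -
  have fr: "frees z = {v. w z v \<noteq> 0}" using z by (auto simp: frees_def)
  have "frees z \<subseteq> T" using no_edge_outside z fr by auto
  have "{z} \<noteq> V" using card_V by auto
  then have c1: "1 \<le> cutval V w {z}" using z by (intro cut_ge_1) auto
  have c: "cutval V w {z} = (\<Sum>v\<in>frees z. w z v)"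
    unfolding cutval_singleton[of z V w, OF DiffD1[OF z]]
    using w_in2 w_irrefl finV by (intro sum.mono_neutral_right) (auto simp: fr)
  have "w z v < cutval V w {z} / 2" if "v \<in> frees z" for v
    using twice_lt_cut[OF z, of v] that \<open>frees z \<subseteq> T\<close> w_commute[of z v] by auto
  moreover have "card (frees z) > 0" using c c1 finite_frees by (auto simp: card_gt_0_iff)
  ultimately have "(\<Sum>v\<in>frees z. w z v) < real (card (frees z)) * (cutval V w {z} / 2)"
    by (intro sum_bounded_above_strict) auto
  then have "cutval V w {z} * 2 < cutval V w {z} * real (card (frees z))"
    using c by (simp add: mult.commute)
  then have "2 < real (card (frees z))" using c1 by (simp add: mult_less_cancel_left)
  then show ?thesis by simp
qed

lemma terminal_sum:
  assumes t: "t \<in> T"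
  shows "real (card (mates t)) / 2 + (\<Sum>v\<in>frees t. w t v) = 1"
proof -
  have tV: "t \<in> V" using t T_sub by auto
  have "1 = (\<Sum>v\<in>V - {t}. w t v)" using cut_terminal[OF t] cutval_singleton[OF tV, of w] by simp
  also have "\<dots> = (\<Sum>v\<in>mates t \<union> frees t. w t v)"
    using finV frees_sub mates_sub T_sub t
    by (intro sum.mono_neutral_right) (auto simp: frees_def mates_def)
  also have "\<dots> = (\<Sum>v\<in>mates t. w t v) + (\<Sum>v\<in>frees t. w t v)"
    using t by (intro sum.union_disjoint finite_mates finite_frees) (auto simp: frees_def mates_def)
  also have "(\<Sum>v\<in>mates t. w t v) = (\<Sum>v\<in>mates t. 1 / 2)"
    by (intro sum.cong) (auto simp: mates_def)
  finally show ?thesis by simp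
qed

lemma w_pos_frees: "v \<in> frees t \<Longrightarrow> 0 < w t v"
  using w_nonneg[of t v] by (auto simp: frees_def)

lemma card_mates_le: "t \<in> T \<Longrightarrow> card (mates t) \<le> 2"
  using terminal_sum[of t] sum_nonneg[of "frees t" "w t", OF w_nonneg] by simp

lemma frees_empty_iff: "t \<in> T \<Longrightarrow> frees t = {} \<longleftrightarrow> card (mates t) = 2"
  using terminal_sum[of t] sum_pos[of "frees t" "w t"] finite_frees w_pos_frees by fastforce

text \<open>The free edges are the unknowns, and the stars of terminals with a free edge are the
  equations. More unknowns than equations would give a nonzero perturbation.\<close>

lemma card_free_edges_le: "card free_edges \<le> card {t \<in> T. frees t \<noteq> {}}"
proof (rule ccontr)
  assume "\<not> ?thesis"
  then have "card {t \<in> T. frees t \<noteq> {}} < card free_edges" by simp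
  then obtain x where x: "\<exists>e\<in>free_edges. x e \<noteq> 0"
    "\<forall>t\<in>{t \<in> T. frees t \<noteq> {}}. (\<Sum>e\<in>free_edges. (if t \<in> e then 1 else 0) * x e) = (0::real)"
    using homogeneous_solution[of "{t \<in> T. frees t \<noteq> {}}" free_edges "\<lambda>t e. if t \<in> e then 1 else 0"]
      finT finite_free_edges by auto
  define d where "d u v = (if {u, v} \<in> free_edges then x {u, v} else 0)" for u v
  have sd: "supported d"
    using w_commute by (auto simp: supported_def d_def insert_commute free_edge_iff frees_def)
  have d1: "cutval V d {t} = 0" if t: "t \<in> T" for t
  proof -
    have tV: "t \<in> V" using t T_sub by auto
    have "cutval V d {t} = (\<Sum>v\<in>V - {t}. d t v)" by (rule cutval_singleton[OF tV])
    also have "\<dots> = (\<Sum>v\<in>frees t. x {t, v})"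
      using finV frees_sub by (intro sum.mono_neutral_cong_right) (auto simp: d_def free_edge_iff)
    also have "\<dots> = (\<Sum>e\<in>{e \<in> free_edges. t \<in> e}. x e)"
      unfolding incident_free_edges by (simp add: sum.reindex[OF inj_on_doubleton])
    also have "\<dots> = (\<Sum>e\<in>free_edges. (if t \<in> e then 1 else 0) * x e)"
      unfolding sum.inter_filter[OF finite_free_edges] by (intro sum.cong) auto
    also have "\<dots> = 0"
    proof (cases "frees t = {}")
      case True
      then have "\<forall>e\<in>free_edges. t \<notin> e" using incident_free_edges[of t] by blast
      then show ?thesis by (intro sum.neutral) auto
    next
      case False
      then show ?thesis using x(2) t by blast
    qed
    finally show ?thesis .
  qed
  have d2: "d s t = 0" if "s \<in> T" "t \<in> T" "w s t = 1 / 2" for s t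
    using that by (auto simp: d_def free_edge_iff frees_def)
  have d0: "d u v = 0" for u v by (rule unique_reduced[OF sd d1 d2])
  obtain e where e: "e \<in> free_edges" "x e \<noteq> 0" using x(1) by blast
  obtain u v where "e = {u, v}" by (rule free_edgeE[OF e(1)])
  then show False using d0[of u v] e by (simp add: d_def)
qed

definition with_mates :: "nat \<Rightarrow> 'a set" where
  "with_mates n = {t \<in> T. card (mates t) = n}"

lemma finite_with_mates: "finite (with_mates n)"
  using finT by (simp add: with_mates_def)

lemma terminals_by_mates: "T = with_mates 0 \<union> with_mates 1 \<union> with_mates 2"
  using card_mates_le by (force simp: with_mates_def)

lemma with_mates_disjoint: "m \<noteq> n \<Longrightarrow> with_mates m \<inter> with_mates n = {}"
  by (auto simp: with_mates_def)

lemma sum_terminals_by_mates: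
  fixes f :: "'a \<Rightarrow> nat"
  shows "sum f T = sum f (with_mates 0) + sum f (with_mates 1) + sum f (with_mates 2)"
proof -
  have "sum f T = sum f (with_mates 0 \<union> with_mates 1 \<union> with_mates 2)"
    using terminals_by_mates by simp
  also have "\<dots> = sum f (with_mates 0 \<union> with_mates 1) + sum f (with_mates 2)"
    by (rule sum.union_disjoint) (auto simp: finite_with_mates, auto simp: with_mates_def)
  also have "sum f (with_mates 0 \<union> with_mates 1) = sum f (with_mates 0) + sum f (with_mates 1)"
    by (rule sum.union_disjoint) (auto simp: finite_with_mates, auto simp: with_mates_def)
  finally show ?thesis .
qed

lemma card_terminals: "card T = card (with_mates 0) + card (with_mates 1) + card (with_mates 2)"
  using sum_terminals_by_mates[of "\<lambda>_. 1"] by simp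

lemma card_free_edges_le_mates: "card free_edges \<le> card (with_mates 0) + card (with_mates 1)"
proof -
  have "{t \<in> T. frees t \<noteq> {}} = with_mates 0 \<union> with_mates 1"
    using frees_empty_iff card_mates_le by (force simp: with_mates_def)
  then show ?thesis
    using card_free_edges_le card_Un_disjoint[OF finite_with_mates finite_with_mates with_mates_disjoint]
    by simp
qed

text \<open>The sum of the numbers of mates is even, and modulo two only terminals with one mate
  contribute.\<close>

lemma even_with_mates_1: "even (card (with_mates 1))"
proof -
  have "even (\<Sum>t\<in>T. card (mates t))"
    unfolding mates_def by (rule even_sum_card_symmetric[OF finT]) (use w_commute w_irrefl in auto)
  also note sum_terminals_by_mates
  also have "(\<Sum>t\<in>with_mates 0. card (mates t)) + (\<Sum>t\<in>with_mates 1. card (mates t))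
      + (\<Sum>t\<in>with_mates 2. card (mates t))
    = 0 * card (with_mates 0) + 1 * card (with_mates 1) + 2 * card (with_mates 2)"
    by (simp add: with_mates_def)
  finally show ?thesis by simp
qed

lemma sum_frees_ge:
  assumes "\<And>t. t \<in> with_mates 0 \<Longrightarrow> i \<le> card (frees t)" "\<And>t. t \<in> with_mates 1 \<Longrightarrow> j \<le> card (frees t)"
  shows "i * card (with_mates 0) + j * card (with_mates 1) \<le> (\<Sum>t\<in>T. card (frees t))"
proof -
  have "i * card (with_mates 0) \<le> (\<Sum>t\<in>with_mates 0. card (frees t))"
    using sum_bounded_below[of "with_mates 0" i] assms(1) by (simp add: mult.commute)
  moreover have "j * card (with_mates 1) \<le> (\<Sum>t\<in>with_mates 1. card (frees t))"
    using sum_bounded_below[of "with_mates 1" j] assms(2) by (simp add: mult.commute)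
  moreover have "(\<Sum>t\<in>with_mates 0. card (frees t)) + (\<Sum>t\<in>with_mates 1. card (frees t))
      = (\<Sum>t\<in>with_mates 0 \<union> with_mates 1. card (frees t))"
    using with_mates_disjoint[of 0 1] by (simp add: sum.union_disjoint finite_with_mates)
  moreover have "\<dots> \<le> (\<Sum>t\<in>T. card (frees t))"
    by (rule sum_mono2[OF finT]) (auto simp: with_mates_def)
  ultimately show ?thesis by linarith
qed

text \<open>At most one terminal remains besides the four. If no two of the four were mates, it
  would be the mate of all of them, but a terminal has at most two mates.\<close>

lemma mated_pair_exists:
  assumes "card (with_mates 1) = 4"
  obtains s t a b where "with_mates 1 = {s, t, a, b}" "distinct [s, t, a, b]"
    "mates s = {t}" "mates t = {s}"
proof -
  have "\<exists>s\<in>with_mates 1. mates s \<inter> with_mates 1 \<noteq> {}"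
  proof (rule ccontr)
    assume contra: "\<not> ?thesis"
    have m: "mates s \<noteq> {}" "mates s \<subseteq> T - with_mates 1" if "s \<in> with_mates 1" for s
      using that contra mates_sub[of s] by (auto simp: with_mates_def)
    have "card (T - with_mates 1) \<le> 1"
      using card_T assms by (subst card_Diff_subset) (auto simp: finite_with_mates with_mates_def finT)
    moreover have "T - with_mates 1 \<noteq> {}"
    proof -
      obtain s where "s \<in> with_mates 1" using assms by fastforce
      then show ?thesis using m by blast
    qed
    ultimately have "card (T - with_mates 1) = 1"
      using finT card_0_eq[of "T - with_mates 1"] by (simp add: le_Suc_eq)
    then obtain q where q: "T - with_mates 1 = {q}" by (rule card_1_singletonE)
    have "s \<in> mates q" if "s \<in> with_mates 1" for s
      using m[OF that] q that in_mates_commute[of s q] by (auto simp: with_mates_def)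
    then have "card (with_mates 1) \<le> card (mates q)" by (intro card_mono finite_mates) auto
    then show False using card_mates_le[of q] q assms by auto
  qed
  then obtain s t where st: "s \<in> with_mates 1" "t \<in> mates s" "t \<in> with_mates 1" by blast
  then have ms: "mates s = {t}" "s \<noteq> t" "s \<in> T" "t \<in> T"
    using mates_sub by (auto simp: with_mates_def card_1_singleton_iff)
  have "s \<in> mates t" using st ms in_mates_commute by blast
  then have mt: "mates t = {s}" using st by (auto simp: with_mates_def card_1_singleton_iff)
  have "card (with_mates 1 - {s, t}) = 2"
    using assms st ms by (subst card_Diff_subset) auto
  then obtain a b where ab: "with_mates 1 - {s, t} = {a, b}" "a \<noteq> b" by (auto simp: card_2_iff)
  then have "with_mates 1 = {s, t, a, b}" "distinct [s, t, a, b]" using st ms by auto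
  then show ?thesis using that ms mt by blast
qed

text \<open>Counting leaves no terminal without mates and, by parity, zero or four terminals with
  one mate. Four are excluded by an alternating cycle. Then each terminal has two mates, and all
  weights are 1/2.\<close>

lemma half_cactus_if_all_terminals:
  assumes TV: "T = V"
  shows "half_cactus V w"
proof -
  have lt: "w t v < 1 / 2" if "t \<in> T" "v \<in> frees t" for t v
  proof -
    have v: "v \<in> T" "v \<noteq> t" using that frees_sub TV by auto
    then have "w t v \<le> 1 / 2" using le_half that(1) by blast
    then show ?thesis using that v by (auto simp: frees_def)
  qed
  \<comment> \<open>The free edges at \<open>t\<close> must fill what \<open>m\<close> mates leave
    of the star, namely \<open>1 - m / 2\<close>, with weights below 1/2; this takes more than
    \<open>2 - m\<close> of them.\<close>
  have card_frees: "2 - card (mates t) < card (frees t)" if t: "t \<in> T" "frees t \<noteq> {}" for t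
  proof -
    have "(\<Sum>v\<in>frees t. w t v) < real (card (frees t)) * (1 / 2)"
      using lt[OF t(1)] t(2) finite_frees by (intro sum_bounded_above_strict) (auto simp: card_gt_0_iff)
    then have "2 < real (card (mates t)) + real (card (frees t))"
      using terminal_sum[OF t(1)] by simp
    then have "2 < card (mates t) + card (frees t)" by linarith
    then show ?thesis using card_mates_le[OF t(1)] by linarith
  qed
  have fr: "frees t \<noteq> {}" if "t \<in> with_mates n" "n < 2" for t n
    using frees_empty_iff that by (auto simp: with_mates_def)
  have "(\<Sum>t\<in>T. card (frees t)) = (\<Sum>e\<in>free_edges. 2)"
  proof (subst sum_card_frees[OF T_sub], rule sum.cong[OF refl])
    fix e
    assume "e \<in> free_edges"
    then obtain u v where "e = {u, v}" "u \<noteq> v" "u \<in> V" "v \<in> V" by (rule free_edgeE)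
    then show "card (e \<inter> T) = 2" using TV by simp
  qed
  moreover have "3 * card (with_mates 0) + 2 * card (with_mates 1) \<le> (\<Sum>t\<in>T. card (frees t))"
  proof (rule sum_frees_ge)
    show "3 \<le> card (frees t)" if "t \<in> with_mates 0" for t
      using card_frees[of t] fr[OF that] that by (auto simp: with_mates_def)
    show "2 \<le> card (frees t)" if "t \<in> with_mates 1" for t
      using card_frees[of t] fr[OF that] that by (auto simp: with_mates_def)
  qed
  \<comment> \<open>With \<open>n0\<close> and \<open>n1\<close> terminals having no mate and one
    mate, twice the number of free edges is at least \<open>3 * n0 + 2 * n1\<close> and at most
    \<open>2 * n0 + 2 * n1\<close>.\<close>
  ultimately have "card (with_mates 0) = 0" using card_free_edges_le_mates by simp
  then have W0: "with_mates 0 = {}" using finite_with_mates by simp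
  have W1: "with_mates 1 = {}"
  proof (rule ccontr)
    assume "with_mates 1 \<noteq> {}"
    then obtain c where c: "c \<in> with_mates 1" by blast
    have two: "2 \<le> card (frees t)" "frees t \<subseteq> with_mates 1 - {t}" if t: "t \<in> with_mates 1" for t
    proof -
      have tT: "t \<in> T" using t by (simp add: with_mates_def)
      show "2 \<le> card (frees t)"
        using card_frees[OF tT] fr[OF t] t by (auto simp: with_mates_def)
      have "v \<in> with_mates 1" if "v \<in> frees t" for v
      proof -
        have v: "v \<in> T" "frees v \<noteq> {}" using that frees_sub TV in_frees_commute by auto
        then have "v \<notin> with_mates 2" using frees_empty_iff[of v] by (simp add: with_mates_def)
        then show ?thesis using v(1) terminals_by_mates W0 by blast
      qed
      then show "frees t \<subseteq> with_mates 1 - {t}" using frees_sub by auto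
    qed
    have "2 \<le> card (with_mates 1 - {c})"
      using two[OF c] card_mono[of "with_mates 1 - {c}" "frees c"] finite_with_mates by fastforce
    then have "3 \<le> card (with_mates 1)" using c finite_with_mates[of 1] by simp
    moreover have "card (with_mates 1) \<le> 5" using card_terminals card_T by simp
    ultimately have "card (with_mates 1) = 3 \<or> card (with_mates 1) = 4 \<or> card (with_mates 1) = 5"
      by linarith
    then have "card (with_mates 1) = 4" using even_with_mates_1 by auto
    then obtain s t a b where st: "with_mates 1 = {s, t, a, b}" "distinct [s, t, a, b]"
      "mates s = {t}" "mates t = {s}" by (rule mated_pair_exists)
    have frees_eq: "frees c = {a, b}" if "c \<in> {s, t}" for c
    proof -
      have "frees c \<subseteq> {a, b}"
        using two(2)[of c] that st by (auto simp: frees_def mates_def)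
      moreover have "card {a, b} \<le> card (frees c)" using two(1)[of c] that st by auto
      ultimately show ?thesis by (intro card_seteq) auto
    qed
    have ab: "a \<in> frees s" "b \<in> frees s" "a \<in> frees t" "b \<in> frees t" using frees_eq by auto
    have nz: "w s a \<noteq> 0" "w s b \<noteq> 0" "w t a \<noteq> 0" "w t b \<noteq> 0"
      using ab by (auto simp: frees_def)
    \<comment> \<open>Alternating signs on the 4-cycle through \<open>s\<close>, \<open>a\<close>,
      \<open>t\<close>, \<open>b\<close>, all of whose edges are free: every star sees 0.\<close>
    define d where "d u v = edge_fn s a 1 u v + (edge_fn s b (-1) u v
      + (edge_fn t a (-1) u v + edge_fn t b 1 u v))" for u v
    have sd: "supported d" unfolding d_def by (intro supported_add supported_edge_fn nz)
    have d1: "cutval V d {c} = 0" if "c \<in> T" for c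
      unfolding d_def cutval_add using that TV st(2) nz by (auto simp: cutval_edge_fn')
    have d2: "d u v = 0" if uv: "u \<in> T" "v \<in> T" "w u v = 1 / 2" for u v
    proof -
      have "v \<notin> frees u" using uv by (simp add: frees_def)
      then have "{u, v} \<noteq> {s, a}" "{u, v} \<noteq> {s, b}" "{u, v} \<noteq> {t, a}" "{u, v} \<noteq> {t, b}"
        using ab in_frees_commute by (auto simp: doubleton_eq_iff)
      then show ?thesis by (simp add: d_def edge_fn_def)
    qed
    have "d s a = 0" by (rule unique_reduced[OF sd d1 d2])
    then show False using st(2) by (auto simp: d_def edge_fn_def doubleton_eq_iff)
  qed
  have "2 * w u v \<in> \<int>" for u v
  proof (cases "w u v = 0")
    case False
    then have uv: "u \<in> T" "v \<in> T" using w_in w_in2 TV by auto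
    then have "u \<in> with_mates 2" using terminals_by_mates W0 W1 by blast
    then have "frees u = {}" using uv frees_empty_iff[of u] by (simp add: with_mates_def)
    then have eq: "2 * w u v = 1" using False uv by (auto simp: frees_def)
    show ?thesis unfolding eq by simp
  qed simp
  moreover have "\<exists>S\<subseteq>V. u \<in> S \<and> v \<notin> S \<and> cutval V w S = 1" if "u \<in> V" "v \<in> V" "u \<noteq> v" for u v
    using that cut_terminal[of u] TV by (intro exI[of _ "{u}"]) auto
  ultimately show ?thesis by (simp add: half_cactus_def)
qed

text \<open>A nonterminal has at least three free edges. Counting then leaves a single nonterminal
  \<open>z\<close>, four terminals with one mate and at most one further terminal \<open>q\<close>.
  The remaining configurations are excluded by tight sets that violate \<open>pair\<close>, or by
  weights on six nodes that need too many edges.\<close>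

lemma all_terminals: "T = V"
proof (rule ccontr)
  assume "T \<noteq> V"
  then have Z_ne: "V - T \<noteq> {}" using T_sub by blast
  define Ea where "Ea = {e \<in> free_edges. \<not> e \<subseteq> T}"
  define Eb where "Eb = {e \<in> free_edges. e \<subseteq> T}"
  have EE: "free_edges = Ea \<union> Eb" "Ea \<inter> Eb = {}" "finite Ea" "finite Eb"
    using finite_free_edges by (auto simp: Ea_def Eb_def)
  then have cE: "card free_edges = card Ea + card Eb" using card_Un_disjoint by metis
  have Ea: "card (e \<inter> T) = 1 \<and> card (e \<inter> (V - T)) = 1" if "e \<in> Ea" for e
  proof -
    have "e \<in> free_edges" using that by (simp add: Ea_def)
    then obtain u v where uv: "e = {u, v}" "u \<noteq> v" "u \<in> V" "v \<in> V" "w u v \<noteq> 0"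
      by (rule free_edgeE)
    then have "(u \<in> T \<and> v \<notin> T) \<or> (u \<notin> T \<and> v \<in> T)"
      using that no_edge_outside by (auto simp: Ea_def)
    then show ?thesis using uv by (auto simp: Int_insert_left)
  qed
  have Eb: "card (e \<inter> T) = 2 \<and> card (e \<inter> (V - T)) = 0" if "e \<in> Eb" for e
  proof -
    have "e \<in> free_edges" using that by (simp add: Eb_def)
    then obtain u v where uv: "e = {u, v}" "u \<noteq> v" by (rule free_edgeE)
    then show ?thesis using that by (auto simp: Eb_def Int_insert_left)
  qed
  have sT: "(\<Sum>t\<in>T. card (frees t)) = card Ea + 2 * card Eb"
    unfolding sum_card_frees[OF T_sub] EE(1) using EE Ea Eb by (simp add: sum.union_disjoint)
  have sZ: "(\<Sum>t\<in>V - T. card (frees t)) = card Ea"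
    unfolding sum_card_frees[OF Diff_subset] EE(1) using EE Ea Eb by (simp add: sum.union_disjoint)
  have cZ: "3 * card (V - T) \<le> card Ea"
    using sum_bounded_below[of "V - T" 3 "\<lambda>t. card (frees t)"] card_frees_outside sZ
    by (simp add: mult.commute)
  have "2 * card (with_mates 0) + 1 * card (with_mates 1) \<le> card Ea + 2 * card Eb"
    unfolding sT[symmetric]
  proof (rule sum_frees_ge)
    show "1 \<le> card (frees t)" if "t \<in> with_mates 1" for t
      using that frees_empty_iff[of t] finite_frees[of t] by (auto simp: with_mates_def Suc_le_eq card_gt_0_iff)
    show "2 \<le> card (frees t)" if t: "t \<in> with_mates 0" for t
    proof -
      have tT: "t \<in> T" "mates t = {}" using t finite_mates by (auto simp: with_mates_def)
      then have fr: "frees t = {v. w t v \<noteq> 0}"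
        using w_in2 w_irrefl unfolding frees_def mates_def by blast
      have "frees t \<noteq> {}" using frees_empty_iff[OF tT(1)] tT(2) by simp
      then obtain v where v: "v \<in> frees t" by blast
      obtain v' where v': "v' \<noteq> v" "v' \<in> frees t" using no_leaf[OF tT(1), of v] v fr by auto
      have "card {v, v'} \<le> card (frees t)" using v v' by (intro card_mono finite_frees) auto
      then show ?thesis using v' by simp
    qed
  qed
  \<comment> \<open>Twice the inequality \<open>card Ea + card Eb \<le> n0 + n1\<close> is compared
    with \<open>2 * n0 + n1 \<le> card Ea + 2 * card Eb\<close>.\<close>
  then have Ea_le: "card Ea \<le> card (with_mates 1)" using card_free_edges_le_mates cE by linarith
  have cT: "card (with_mates 0) + card (with_mates 1) \<le> 5" using card_terminals card_T by linarith
  have "card (V - T) \<noteq> 0" using Z_ne finV by simp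
  then have "3 \<le> card (with_mates 1)" using cZ Ea_le by linarith
  then have "card (with_mates 1) = 3 \<or> card (with_mates 1) = 4 \<or> card (with_mates 1) = 5"
    using cT by linarith
  then have W1: "card (with_mates 1) = 4" using even_with_mates_1 by auto
  then have "card (V - T) = 1" using cZ Ea_le \<open>card (V - T) \<noteq> 0\<close> by linarith
  then obtain z where Z: "V - T = {z}" by (rule card_1_singletonE)
  have z: "z \<in> V" "z \<notin> T" using Z by auto
  have cz: "card (frees z) = card Ea" using sZ Z by simp
  obtain s t a b where st: "with_mates 1 = {s, t, a, b}" and dist: "distinct [s, t, a, b]"
    and ms: "mates s = {t}" and mt: "mates t = {s}" using mated_pair_exists[OF W1] by blast
  have in_T: "s \<in> T" "t \<in> T" "a \<in> T" "b \<in> T" using st by (auto simp: with_mates_def)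
  have in_V: "s \<in> V" "t \<in> V" "a \<in> V" "b \<in> V" using in_T T_sub by auto
  have wst: "w s t = 1 / 2" using ms by (auto simp: mates_def)
  have mates_sub': "mates r \<subseteq> T - {r, s, t}" if "r \<in> T" "r \<noteq> s" "r \<noteq> t" for r
    using mates_sub[of r] in_mates_commute[of r s] in_mates_commute[of r t] in_T ms mt that by auto
  \<comment> \<open>The complement \<open>{s, t, z}\<close> would be a tight set with two terminals
    and one more node.\<close>
  have no_tight: False if "tight (T - {s, t})"
  proof -
    have "V - (T - {s, t}) = {s, t, z}" using Z in_V T_sub by auto
    then have tt: "tight {s, t, z}" using tight_Compl[OF that] by simp
    moreover have "separates {s, t, z} T" "{s, t, z} \<inter> T = {s, t}"
      using in_T dist z by (auto simp: separates_def)
    ultimately show False using pair[of "{s, t, z}" s t] dist z in_T by auto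
  qed
  obtain r where r: "mates a = {r}" using st by (auto simp: with_mates_def card_1_singleton_iff)
  have rT: "r \<in> T" "r \<noteq> a" "r \<noteq> s" "r \<noteq> t" using mates_sub'[of a] r in_T dist by auto
  have cut_ab: "cutval V w {a, b} = 2 - 2 * w a b"
    using cutval_pair[where d = w, OF in_V(3,4) _ w_commute] cut_terminal in_T dist by simp
  \<comment> \<open>The fifth terminal, if there is one.\<close>
  define Q where "Q = T - {s, t, a, b}"
  have T_eq: "T = {s, t, a, b} \<union> Q" using in_T by (auto simp: Q_def)
  have "card Q \<le> 1"
    unfolding Q_def using card_T dist in_T finT by (subst card_Diff_subset) auto
  then consider "Q = {}" | q where "Q = {q}"
    using finT card_0_eq[of Q] card_1_singletonE[of Q] by (auto simp: Q_def le_Suc_eq)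
  then show False
  proof cases
    case 1
    then have "T - {s, t} = {a, b}" "r = b" using T_eq dist rT by auto
    moreover have "w a b = 1 / 2" using r \<open>r = b\<close> by (auto simp: mates_def)
    ultimately show False using no_tight cut_ab in_V by (simp add: tight_def)
  next
    case (2 q)
    have q: "q \<in> T" "q \<noteq> s" "q \<noteq> t" "q \<noteq> a" "q \<noteq> b" "q \<in> V" "q \<noteq> z"
      using 2 T_sub z by (auto simp: Q_def)
    have zd: "z \<noteq> s" "z \<noteq> t" "z \<noteq> a" "z \<noteq> b" using z in_T by auto
    have Tab: "T - {s, t} = {a, b, q}" using T_eq 2 dist q by auto
    have mq: "mates q \<subseteq> {a, b}" using mates_sub'[OF q(1-3)] Tab by auto
    have "q \<notin> with_mates 1" using st q by auto
    then consider "card (mates q) = 2" | "mates q = {}"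
      using card_mates_le[OF q(1)] q(1) finite_mates card_0_eq
      by (force simp: with_mates_def le_Suc_eq numeral_2_eq_2)
    then show False
    proof cases
      case 1
      then have "mates q = {a, b}" using mq dist by (intro card_seteq) auto
      then have wq: "w q a = 1 / 2" "w q b = 1 / 2" by (auto simp: mates_def)
      have "cutval V w ({a, b} \<union> {q}) = cutval V w {a, b} + cutval V w {q} - 2 * weight w {a, b} {q}"
        by (rule cutval_Un[OF finV w_commute]) (use in_V q in auto)
      also have "weight w {a, b} {q} = 1"
        using wq dist w_commute[of a q] w_commute[of b q] by (simp add: weight_def)
      finally have eq: "cutval V w {a, b, q} = 1 - 2 * w a b"
        using cut_ab cut_terminal[OF q(1)] by (simp add: insert_commute)
      have "1 \<le> cutval V w {a, b, q}" using in_V q dist by (intro cut_ge_1) auto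
      then have "cutval V w {a, b, q} = 1" using eq w_nonneg[of a b] by linarith
      then show False using no_tight Tab in_V q by (simp add: tight_def)
    next
      case 2
      have "r \<noteq> q" using r in_mates_commute[OF in_T(3) q(1)] 2 by auto
      then have "r = b" using rT T_eq \<open>Q = {q}\<close> by auto
      then have wab: "w a b = 1 / 2" using r by (auto simp: mates_def)
      have V_eq: "V = {s, t, a, b, q, z}" using T_eq Z \<open>Q = {q}\<close> T_sub by auto
      have "V - {s} = {t, a, b, q, z}" "V - {t} = {s, a, b, q, z}" "V - {a} = {s, t, b, q, z}"
        "V - {b} = {s, t, a, q, z}" "V - {q} = {s, t, a, b, z}" "V - {z} = {s, t, a, b, q}"
        using V_eq dist q zd by auto
      then have deg: "cutval V w {s} = w s t + w s a + w s b + w s q + w s z"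
        "cutval V w {t} = w s t + w t a + w t b + w t q + w t z"
        "cutval V w {a} = w s a + w t a + w a b + w a q + w a z"
        "cutval V w {b} = w s b + w t b + w a b + w b q + w b z"
        "cutval V w {q} = w s q + w t q + w a q + w b q + w q z"
        "cutval V w {z} = w s z + w t z + w a z + w b z + w q z"
        using cutval_singleton[of _ V w] in_V q(6) z(1) dist q zd
        by (simp_all add: w_commute[of t s] w_commute[of a s] w_commute[of b s] w_commute[of q s]
          w_commute[of z s] w_commute[of a t] w_commute[of b t] w_commute[of q t] w_commute[of z t]
          w_commute[of b a] w_commute[of q a] w_commute[of z a] w_commute[of q b] w_commute[of z b]
          w_commute[of z q])
      have one: "cutval V w {c} = 1" if "c \<in> {s, t, a, b, q}" for c
        using that cut_terminal in_T q by auto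
      \<comment> \<open>Total weights between the groups \<open>{s, t}\<close>,
        \<open>{a, b}\<close> and \<open>{q}\<close>: here between the first two, then from
        \<open>q\<close> to each of them. The stars of the terminals determine the weight from
        \<open>z\<close> to each group.\<close>
      define p where "p = w s a + w s b + w t a + w t b"
      define r1 where "r1 = w s q + w t q"
      define r2 where "r2 = w a q + w b q"
      have x: "w s z + w t z = 1 - p - r1" and y: "w a z + w b z = 1 - p - r2"
        and qz: "w q z = 1 - r1 - r2"
        using deg one wst wab by (simp_all add: p_def r1_def r2_def)
      have p_lt: "p < 1 / 2"
        using twice_lt_cut[of z q] z q deg(6) x y qz by simp
      have not_tight: "1 < cutval V w {c, e, z}"
        if c: "c \<in> T" "e \<in> T" "c \<noteq> e" "f \<in> T - {c, e}" for c e f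
      proof -
        have sep: "{c, e, z} \<inter> T = {c, e}" "separates {c, e, z} T" using c z by (auto simp: separates_def)
        have "\<not> tight {c, e, z}"
        proof
          assume tt: "tight {c, e, z}"
          have "z \<in> {c, e, z}" by simp
          also have "{c, e, z} = {c, e}" by (rule pair[OF tt sep(2,1) c(3)])
          finally show False using z c by auto
        qed
        moreover have sub: "{c, e, z} \<subseteq> V" "{c, e, z} \<noteq> V"
        proof -
          show "{c, e, z} \<subseteq> V" using c T_sub z by auto
          have "f \<in> V" "f \<notin> {c, e, z}" using c T_sub z by auto
          then show "{c, e, z} \<noteq> V" by metis
        qed
        ultimately have "cutval V w {c, e, z} \<noteq> 1" by (simp add: tight_def)
        then show ?thesis using cut_ge_1[OF sub(1) _ sub(2)] by simp
      qed
      have cut3: "cutval V w {c, e, z} = cutval V w {c, e} + cutval V w {z} - 2 * (w c z + w e z)"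
        if "c \<in> T" "e \<in> T" "c \<noteq> e" for c e
        using cutval_Un[where d = w and A = "{c, e}" and B = "{z}", OF finV w_commute] that T_sub z
        by (auto simp: weight_def insert_commute)
      have cut_st: "cutval V w {s, t} = 1"
        using cutval_pair[where d = w, OF in_V(1,2) _ w_commute] cut_terminal in_T dist wst by simp
      have "1 < cutval V w {s, t, z}" using not_tight[of s t a] in_T dist by auto
      then have r2_lt: "r2 < 1 / 2"
        using cut3[of s t] cut_st in_T dist deg(6) x y qz by auto
      have "1 < cutval V w {a, b, z}" using not_tight[of a b s] in_T dist by auto
      then have r1_lt: "r1 < 1 / 2"
        using cut3[of a b] cut_ab wab in_T dist deg(6) x y qz by auto
      have "w s z \<le> 1 / 2" "w t z \<le> 1 / 2" "w a z \<le> 1 / 2" "w b z \<le> 1 / 2"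
        using deg(1-4) one[of s] one[of t] one[of a] one[of b] wst wab
          w_nonneg[of s a] w_nonneg[of s b] w_nonneg[of s q] w_nonneg[of t a] w_nonneg[of t b]
          w_nonneg[of t q] w_nonneg[of a q] w_nonneg[of b q] by simp_all
      then have half: "w c z \<le> 1 / 2" if "c \<in> {s, t, a, b}" for c using that by blast
      have in_frees_z: "c \<in> frees z \<longleftrightarrow> w c z \<noteq> 0" for c
        using z by (auto simp: frees_def w_commute[of z c])
      have in_Eb: "{u, v} \<in> Eb" if uv: "w u v \<noteq> 0" "u \<in> T" "v \<in> T" "v \<notin> mates u" for u v
        using uv by (auto simp: Eb_def free_edge_iff frees_def mates_def)
      have p_edge: "\<exists>u\<in>{s, t}. \<exists>v\<in>{a, b}. {u, v} \<in> Eb" if "0 < p"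
      proof -
        have "\<exists>u\<in>{s, t}. \<exists>v\<in>{a, b}. w u v \<noteq> 0" using that by (auto simp: p_def)
        then obtain u v where uv: "u \<in> {s, t}" "v \<in> {a, b}" "w u v \<noteq> 0" by blast
        then have "{u, v} \<in> Eb" using ms mt in_T dist by (intro in_Eb) auto
        then show ?thesis using uv by blast
      qed
      have q_edge: "\<exists>u\<in>{c, e}. {q, u} \<in> Eb" if ce: "0 < w c q + w e q" "c \<in> T" "e \<in> T" for c e
      proof -
        have "w q c \<noteq> 0 \<or> w q e \<noteq> 0" using ce(1) w_commute[of q c] w_commute[of q e] by auto
        then obtain u where u: "u \<in> {c, e}" "w q u \<noteq> 0" by blast
        then have "{q, u} \<in> Eb" using 2 ce q by (intro in_Eb) auto
        then show ?thesis using u by blast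
      qed
      have qf: "q \<in> frees z" using qz r1_lt r2_lt by (simp add: in_frees_z)
      \<comment> \<open>There is room for five free edges, at most four of them at \<open>z\<close>.
        In each case below, the edges at \<open>z\<close> together with those between terminals
        forced by missing edges at \<open>z\<close> exceed one of these bounds.\<close>
      have total: "card (frees z) + card Eb \<le> 5" "card (frees z) \<le> 4"
        using cz cE cT card_free_edges_le_mates Ea_le W1 by linarith+
      have sub_z: "card A \<le> card (frees z)" if "A \<subseteq> frees z" for A
        using that by (intro card_mono finite_frees)
      have sub_b: "card A \<le> card Eb" if "A \<subseteq> Eb" for A
        using that EE by (intro card_mono)
      consider (both) "s \<in> frees z" "t \<in> frees z" | (not_both) "s \<notin> frees z \<or> t \<notin> frees z" by blast
      then show False
      proof cases
        case both
        show False
        proof (cases "a \<in> frees z \<and> b \<in> frees z")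
          case True
          then show False using sub_z[of "{s, t, a, b, q}"] both qf total dist q by auto
        next
          case False
          then have "1 / 2 \<le> p + r2" using y half[of a] half[of b] by (auto simp: in_frees_z)
          then have "0 < p" "0 < r2" using p_lt r2_lt by linarith+
          then obtain u v u' where e: "u \<in> {s, t}" "v \<in> {a, b}" "{u, v} \<in> Eb" "u' \<in> {a, b}" "{q, u'} \<in> Eb"
            using p_edge q_edge[of a b] in_T unfolding r2_def by blast
          have "{u, v} \<noteq> {q, u'}" using e q by (auto simp: doubleton_eq_iff)
          then have "2 \<le> card Eb" using sub_b[of "{{u, v}, {q, u'}}"] e by simp
          moreover have "\<exists>c\<in>{a, b}. c \<in> frees z" using y p_lt r2_lt by (auto simp: in_frees_z)
          then obtain c where "c \<in> {a, b}" "c \<in> frees z" by blast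
          then have "4 \<le> card (frees z)" using sub_z[of "{s, t, c, q}"] both qf dist q by auto
          ultimately show False using total by linarith
        qed
      next
        case not_both
        then have "1 / 2 \<le> p + r1" using x half[of s] half[of t] by (auto simp: in_frees_z)
        then have "0 < p" "0 < r1" using p_lt r1_lt by linarith+
        then obtain u v u' where e: "u \<in> {s, t}" "v \<in> {a, b}" "{u, v} \<in> Eb" "u' \<in> {s, t}" "{q, u'} \<in> Eb"
          using p_edge q_edge[of s t] in_T unfolding r1_def by blast
        have ne: "{u, v} \<noteq> {q, u'}" using e q by (auto simp: doubleton_eq_iff)
        have "\<exists>c\<in>{s, t}. c \<in> frees z" using x p_lt r1_lt by (auto simp: in_frees_z)
        then obtain c where c: "c \<in> {s, t}" "c \<in> frees z" by blast
        show False
        proof (cases "a \<in> frees z \<and> b \<in> frees z")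
          case True
          have "2 \<le> card Eb" using sub_b[of "{{u, v}, {q, u'}}"] e ne by simp
          moreover have "4 \<le> card (frees z)" using sub_z[of "{a, b, c, q}"] True c qf dist q by auto
          ultimately show False using total by linarith
        next
          case False
          then have "1 / 2 \<le> p + r2" using y half[of a] half[of b] by (auto simp: in_frees_z)
          then have "0 < r2" using p_lt by linarith
          then obtain u'' where e': "u'' \<in> {a, b}" "{q, u''} \<in> Eb"
            using q_edge[of a b] in_T unfolding r2_def by blast
          have "{u, v} \<noteq> {q, u''}" "{q, u'} \<noteq> {q, u''}"
            using e e' q dist by (auto simp: doubleton_eq_iff)
          then have "3 \<le> card Eb" using sub_b[of "{{u, v}, {q, u'}, {q, u''}}"] e e' ne by simp
          moreover have "\<exists>c\<in>{a, b}. c \<in> frees z" using y p_lt r2_lt by (auto simp: in_frees_z)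
          then obtain c' where "c' \<in> {a, b}" "c' \<in> frees z" by blast
          then have "3 \<le> card (frees z)" using sub_z[of "{c, c', q}"] c qf dist q by auto
          ultimately show False using total by linarith
        qed
      qed
    qed
  qed
qed

end

text \<open>The terminals vary in the induction, both for passing to those with tight star and
  because a contraction maps them to the quotient.\<close>

lemma half_cactus_of_steiner_vertex:
  assumes "steiner_vertex V w T" "card T \<le> 5" "2 \<le> card V"
  shows "half_cactus V w"
  using assms
proof (induction "card V" arbitrary: V w T rule: less_induct)
  case less
  interpret O: steiner_vertex V w T by (rule less.prems(1))
  define T' where "T' = {t \<in> T. O.tight {t}}"
  interpret S: steiner_vertex V w T'
    unfolding T'_def by (rule O.steiner_vertex_tight_terminals)
  have finT: "finite T" using O.T_sub O.finV finite_subset by blast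
  have cT: "card T' \<le> 5"
    using card_mono[OF finT, of T'] less.prems(2) by (auto simp: T'_def)
  have IH: "S.half_cactus_below" unfolding S.half_cactus_below_def using less.hyps by blast
  have tT: "O.tight {t}" if "t \<in> T'" for t using that by (simp add: T'_def)
  \<comment> \<open>Two nodes are treated apart because contracting a leaf edge needs a third
    node.\<close>
  show ?case
  proof (cases "card V = 2")
    case True
    then obtain a b where V: "V = {a, b}" "a \<noteq> b" by (auto simp: card_2_iff)
    have "V - {a} = {b}" "V - {b} = {a}" "a \<in> V" "b \<in> V" using V by auto
    then have cut_eq: "cutval V w {a} = w a b" "cutval V w {b} = w b a"
      by (simp_all add: cutval_singleton)
    have "cutval V w {a} = 1"
    proof (rule ccontr)
      assume n1: "cutval V w {a} \<noteq> 1"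
      have "\<not> O.tight S" for S
      proof
        assume S: "O.tight S"
        then have "S \<subseteq> {a, b}" "S \<noteq> {}" "S \<noteq> {a, b}"
          using O.tight_nonempty[OF S] V O.tightD(1)[OF S] by auto
        then have "S = {a} \<or> S = {b}" by blast
        then show False using S n1 cut_eq O.w_commute[of a b] by (auto simp: O.tight_def)
      qed
      then have "w a b = 0" using S.unique[OF O.supported_w, of a b] by blast
      moreover have "1 \<le> cutval V w {a}" using V by (intro O.cut_ge_1) auto
      ultimately show False using cut_eq by simp
    qed
    then have w1: "w a b = 1" "w b a = 1" using cut_eq O.w_commute[of a b] by auto
    have "2 * w u v \<in> \<int>" for u v
    proof (cases "w u v = 0")
      case False
      then have "u \<in> V" "v \<in> V" "u \<noteq> v" using O.w_in O.w_in2 O.w_irrefl by blast+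
      then show ?thesis using V w1 by auto
    qed simp
    moreover have "\<exists>S\<subseteq>V. u \<in> S \<and> v \<notin> S \<and> cutval V w S = 1" if "u \<in> V" "v \<in> V" "u \<noteq> v" for u v
      using that V w1 cut_eq by (intro exI[of _ "{u}"]) auto
    ultimately show ?thesis by (simp add: half_cactus_def)
  next
    case False
    then have V3: "3 \<le> card V" using less.prems(3) by simp
    show ?thesis
    proof (rule ccontr)
      \<comment> \<open>Under this assumption every reduction must fail, and the failing hypotheses
        are the assumptions of \<open>reduced_steiner_vertex\<close>.\<close>
      assume neg: "\<not> half_cactus V w"
      have single: "S = {t}" if "O.tight S" "separates S T'" "S \<inter> T' = {t}" for S t
        using S.half_cactus_if_nonsingleton_terminal_set[OF _ tT that _ cT IH] that neg by blast
      interpret R: reduced_steiner_vertex V w T'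
      proof
        show "O.tight {t}" if "t \<in> T'" for t by (rule tT[OF that])
        show "S = {t}" if "O.tight S" "separates S T'" "S \<inter> T' = {t}" for S t
          by (rule single[OF that])
        show "S = {a, b}" if "O.tight S" "separates S T'" "S \<inter> T' = {a, b}" "a \<noteq> b" for S a b
          using S.half_cactus_if_nonpair_terminal_set[OF tT single that(1-3) _ that(4) cT IH] neg by blast
        show "\<exists>v. v \<noteq> p \<and> w t v \<noteq> 0" if "t \<in> T'" "w t p \<noteq> 0" for t p
          using S.half_cactus_if_leaf[OF that(1) tT[OF that(1)] that(2) _ cT V3 IH] neg by blast
      qed (rule cT, rule V3)
      show False using neg R.half_cactus_if_all_terminals[OF R.all_terminals] by blast
    qed
  qed
qed

subsection \<open>Facets of dominants\<close>

lemma inner_sum_components: "(c :: real ^ 'e::finite) \<bullet> x = (\<Sum>e\<in>UNIV. c $ e * x $ e)"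
  by (simp add: inner_vec_def)

lemma inner_incidence_vector: "(c :: real ^ 'e::finite) \<bullet> incidence_vector F = (\<Sum>e\<in>F. c $ e)"
proof -
  have "c \<bullet> incidence_vector F = (\<Sum>e\<in>UNIV. if e \<in> F then c $ e else 0)"
    unfolding inner_sum_components incidence_vector_def by (intro sum.cong) auto
  then show ?thesis by (simp add: sum.If_cases)
qed

definition dominant :: "(real ^ 'e::finite) set \<Rightarrow> (real ^ 'e) set" where
  "dominant K = {x + y | x y. x \<in> convex hull K \<and> (\<forall>e. 0 \<le> y $ e)}"

lemma dominantI: "x \<in> convex hull K \<Longrightarrow> (\<And>e. 0 \<le> y $ e) \<Longrightarrow> x + y \<in> dominant K"
  by (auto simp: dominant_def)

lemma dominant_generator: "k \<in> K \<Longrightarrow> k \<in> dominant K"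
  using dominantI[of k K 0] by (simp add: hull_inc)

lemma dominant_add_axis: "k \<in> K \<Longrightarrow> 0 \<le> t \<Longrightarrow> k + t *\<^sub>R axis e 1 \<in> dominant K"
  by (intro dominantI hull_inc) (auto simp: axis_def)

lemma convex_dominant: "convex (dominant K)"
proof -
  have "convex {y :: real ^ 'a. \<forall>e. 0 \<le> y $ e}"
    by (auto simp: convex_def)
  then have "convex (\<Union>x\<in>convex hull K. \<Union>y\<in>{y. \<forall>e. 0 \<le> y $ e}. {x + y})"
    by (intro convex_sums convex_convex_hull)
  moreover have "(\<Union>x\<in>convex hull K. \<Union>y\<in>{y. \<forall>e. 0 \<le> y $ e}. {x + y}) = dominant K"
    by (auto simp: dominant_def)
  ultimately show ?thesis by simp
qed

lemma dominant_nonneg: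
  assumes "\<And>k e. k \<in> K \<Longrightarrow> 0 \<le> k $ e" "x \<in> dominant K"
  shows "0 \<le> x $ e"
proof -
  have "convex {y :: real ^ 'a. \<forall>e. 0 \<le> y $ e}"
    by (auto simp: convex_def)
  then have "convex hull K \<subseteq> {y. \<forall>e. 0 \<le> y $ e}"
    using assms(1) by (intro hull_minimal) auto
  then show ?thesis using assms(2) by (auto simp: dominant_def)
qed

lemma inner_nonneg: "(\<And>e. 0 \<le> c $ e) \<Longrightarrow> (\<And>e. 0 \<le> y $ e) \<Longrightarrow> 0 \<le> (c :: real ^ 'e::finite) \<bullet> y"
  by (simp add: inner_sum_components sum_nonneg)

lemma valid_dominant_iff:
  assumes "K \<noteq> {}"
  shows "(\<forall>x\<in>dominant K. \<gamma> \<le> c \<bullet> x) \<longleftrightarrow> (\<forall>e. 0 \<le> c $ e) \<and> (\<forall>k\<in>K. \<gamma> \<le> c \<bullet> k)"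
proof
  assume valid: "\<forall>x\<in>dominant K. \<gamma> \<le> c \<bullet> x"
  have "0 \<le> c $ e" for e
  proof (rule ccontr)
    assume neg: "\<not> 0 \<le> c $ e"
    obtain k where k: "k \<in> K" using assms by blast
    \<comment> \<open>The step length at which the value drops to
      \<open>\<gamma> - 1\<close>.\<close>
    define t where "t = (c \<bullet> k - \<gamma> + 1) / (- (c $ e))"
    have "\<gamma> \<le> c \<bullet> k" using valid dominant_generator[OF k] by blast
    then have "0 \<le> t" unfolding t_def using neg by (intro divide_nonneg_nonneg) auto
    then have "\<gamma> \<le> c \<bullet> (k + t *\<^sub>R axis e 1)" using valid dominant_add_axis[OF k] by blast
    also have "\<dots> = c \<bullet> k + t * c $ e" by (simp add: inner_add_right inner_axis)
    also have "\<dots> = \<gamma> - 1" using neg by (simp add: t_def field_simps)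
    finally show False by simp
  qed
  then show "(\<forall>e. 0 \<le> c $ e) \<and> (\<forall>k\<in>K. \<gamma> \<le> c \<bullet> k)"
    using valid dominant_generator by blast
next
  assume c: "(\<forall>e. 0 \<le> c $ e) \<and> (\<forall>k\<in>K. \<gamma> \<le> c \<bullet> k)"
  have "convex hull K \<subseteq> {x. c \<bullet> x \<ge> \<gamma>}"
    using c by (intro hull_minimal convex_halfspace_ge) auto
  then have hull: "\<gamma> \<le> c \<bullet> x" if "x \<in> convex hull K" for x using that by blast
  show "\<forall>x\<in>dominant K. \<gamma> \<le> c \<bullet> x"
  proof
    fix x
    assume "x \<in> dominant K"
    then obtain h y where hy: "x = h + y" "h \<in> convex hull K" "\<forall>e. 0 \<le> y $ e"
      unfolding dominant_def by blast
    have "0 \<le> c \<bullet> y" using c hy(3) by (intro inner_nonneg) auto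
    then show "\<gamma> \<le> c \<bullet> x" using hull[OF hy(2)] hy(1) by (simp add: inner_add_right)
  qed
qed

text \<open>The open orthant above any generator is contained in the dominant.\<close>

lemma aff_dim_dominant:
  assumes "K \<noteq> {}"
  shows "aff_dim (dominant (K :: (real ^ 'e::finite) set)) = int DIM(real ^ 'e)"
proof -
  obtain k where k: "k \<in> K" using assms by blast
  let ?U = "{x :: real ^ 'e. \<forall>e. k $ e < x $ e}"
  have "?U = (\<Inter>e\<in>UNIV. {x. k $ e < x $ e})" by auto
  then have "open ?U" by (simp add: open_INT open_halfspace_component_gt_cart)
  moreover have "?U \<subseteq> dominant K"
  proof
    fix x
    assume "x \<in> ?U"
    then have "k + (x - k) \<in> dominant K" using k by (intro dominantI hull_inc) (auto simp: less_imp_le)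
    then show "x \<in> dominant K" by simp
  qed
  ultimately have "?U \<subseteq> interior (dominant K)" by (rule interior_maximal[rotated])
  moreover have "k + 1 \<in> ?U" by simp
  ultimately have "interior (dominant K) \<noteq> {}" by blast
  then show ?thesis by (rule aff_dim_nonempty_interior)
qed

text \<open>A convex combination that attains the minimum gives positive coefficients only to
  generators that attain it.\<close>

lemma hull_orthogonal:
  assumes "finite K" "\<And>k. k \<in> K \<Longrightarrow> \<gamma> \<le> c \<bullet> k" "\<And>k. k \<in> K \<Longrightarrow> c \<bullet> k = \<gamma> \<Longrightarrow> d \<bullet> k = 0"
    and "h \<in> convex hull K" "c \<bullet> h = \<gamma>"
  shows "d \<bullet> h = (0 :: real)"
proof -
  obtain u where u: "\<forall>k\<in>K. 0 \<le> u k" "sum u K = 1" "(\<Sum>k\<in>K. u k *\<^sub>R k) = h"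
    using assms(4) unfolding convex_hull_finite[OF assms(1)] by blast
  have "(\<Sum>k\<in>K. u k * (c \<bullet> k - \<gamma>)) = (\<Sum>k\<in>K. u k * (c \<bullet> k)) - \<gamma> * sum u K"
    by (simp add: algebra_simps sum_subtractf sum_distrib_left)
  also have "(\<Sum>k\<in>K. u k * (c \<bullet> k)) = c \<bullet> h"
    unfolding u(3)[symmetric] by (simp add: inner_sum_right)
  finally have "(\<Sum>k\<in>K. u k * (c \<bullet> k - \<gamma>)) = 0" using u(2) assms(5) by simp
  then have "\<forall>k\<in>K. u k * (c \<bullet> k - \<gamma>) = 0"
    using u(1) assms(1,2) by (subst (asm) sum_nonneg_eq_0_iff) auto
  then have "\<forall>k\<in>K. u k * (d \<bullet> k) = 0" using assms(3) by (metis eq_iff_diff_eq_0 mult_eq_0_iff)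
  then have "(\<Sum>k\<in>K. u k * (d \<bullet> k)) = 0" by (intro sum.neutral)
  then show ?thesis unfolding u(3)[symmetric] by (simp add: inner_sum_right)
qed

text \<open>The face is spanned by the tight generators together with the axis directions where
  \<open>c\<close> is zero. It is a facet iff these span the whole space, that is, iff no nonzero
  \<open>d\<close> is orthogonal to all of them.\<close>

lemma defines_facet_dominant_iff:
  fixes K :: "(real ^ 'e::finite) set"
  assumes K: "finite K" "K \<noteq> {}" and \<gamma>: "0 < \<gamma>"
  shows "defines_facet (dominant K) c \<gamma> \<longleftrightarrow> (\<forall>e. 0 \<le> c $ e) \<and> (\<forall>k\<in>K. \<gamma> \<le> c \<bullet> k) \<and>
    (\<forall>d. (\<forall>e. c $ e = 0 \<longrightarrow> d $ e = 0) \<longrightarrow> (\<forall>k\<in>K. c \<bullet> k = \<gamma> \<longrightarrow> d \<bullet> k = 0) \<longrightarrow> d = 0)"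
    (is "_ \<longleftrightarrow> ?nonneg \<and> ?valid \<and> ?unique")
proof (cases "?nonneg \<and> ?valid")
  case False
  then show ?thesis using valid_dominant_iff[OF K(2), of \<gamma> c] by (auto simp: defines_facet_def)
next
  case True
  then have valid: "\<forall>x\<in>dominant K. \<gamma> \<le> c \<bullet> x" using valid_dominant_iff[OF K(2)] by blast
  define F where "F = {x \<in> dominant K. c \<bullet> x = \<gamma>}"
  have "F = dominant K \<inter> {x. c \<bullet> x = \<gamma>}" by (auto simp: F_def)
  then have face: "F face_of dominant K"
    using face_of_Int_supporting_hyperplane_ge[OF convex_dominant[of K], of \<gamma> c] valid by simp
  have "affine hull F \<subseteq> {x. c \<bullet> x = \<gamma>}"
    by (rule hull_minimal) (auto simp: F_def affine_hyperplane)
  \<comment> \<open>A positive right-hand side keeps the origin off the hyperplane, so affine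
    dimension can be traded for the dimension of the span.\<close>
  then have "0 \<notin> affine hull F" using \<gamma> by auto
  then have "aff_dim (insert 0 F) = aff_dim F + 1" by (simp add: aff_dim_insert)
  moreover have "aff_dim (insert 0 F) = int (dim (insert 0 F))"
    by (rule aff_dim_zero) (simp add: hull_inc)
  moreover have "dim (insert 0 F) = dim F" by (metis dim_span span_insert_0)
  ultimately have aff: "aff_dim F = int (dim F) - 1" by simp
  have facet: "defines_facet (dominant K) c \<gamma> \<longleftrightarrow> F \<noteq> {} \<and> dim F = DIM(real ^ 'e)"
    using valid face aff aff_dim_dominant[OF K(2)]
    unfolding defines_facet_def facet_of_def F_def[symmetric] by auto
  have "F \<noteq> {} \<and> dim F = DIM(real ^ 'e) \<longleftrightarrow> ?unique"
  proof
    assume dimF: "F \<noteq> {} \<and> dim F = DIM(real ^ 'e)"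
    then have span: "span F = UNIV" using dim_eq_full by blast
    show ?unique
    proof (intro allI impI)
      fix d
      assume d: "\<forall>e. c $ e = 0 \<longrightarrow> d $ e = 0" "\<forall>k\<in>K. c \<bullet> k = \<gamma> \<longrightarrow> d \<bullet> k = 0"
      have "d \<bullet> x = 0" if "x \<in> F" for x
      proof -
        have "x \<in> dominant K" using that by (simp add: F_def)
        then obtain h y where hy: "x = h + y" "h \<in> convex hull K" "\<forall>e. 0 \<le> y $ e"
          unfolding dominant_def by blast
        have ch: "\<gamma> \<le> c \<bullet> h" using valid dominantI[OF hy(2), of 0] by auto
        have cy: "0 \<le> c \<bullet> y" using True hy(3) by (intro inner_nonneg) auto
        have "c \<bullet> h + c \<bullet> y = \<gamma>" using that hy(1) by (simp add: F_def inner_add_right)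
        then have eq: "c \<bullet> h = \<gamma>" "c \<bullet> y = 0" using ch cy by linarith+
        have "\<forall>e. c $ e * y $ e = 0"
          using eq(2) True hy(3) unfolding inner_sum_components by (subst (asm) sum_nonneg_eq_0_iff) auto
        then have "\<forall>e. d $ e * y $ e = 0" using d(1) by (metis mult_eq_0_iff)
        then have "d \<bullet> y = 0" unfolding inner_sum_components by (intro sum.neutral) simp
        moreover have "d \<bullet> h = 0"
          by (rule hull_orthogonal[OF K(1) _ _ hy(2) eq(1)]) (use True d(2) in auto)
        ultimately show ?thesis using hy(1) by (simp add: inner_add_right)
      qed
      then have "orthogonal d d"
        using orthogonal_to_span[of d F d] span by (auto simp: orthogonal_def)
      then show "d = 0" by (simp add: orthogonal_self)
    qed
  next
    assume U: ?unique
    have "\<exists>k\<in>K. c \<bullet> k = \<gamma>"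
    proof (rule ccontr)
      assume "\<not> ?thesis"
      then have "c = 0" using U[rule_format, of c] by blast
      moreover obtain k where "k \<in> K" using K(2) by blast
      ultimately have "\<gamma> \<le> 0" using True by auto
      then show False using \<gamma> by simp
    qed
    then obtain k where k: "k \<in> K" "c \<bullet> k = \<gamma>" by blast
    then have kF: "k \<in> F" using dominant_generator by (simp add: F_def)
    have "span F = UNIV"
    proof (rule ccontr)
      assume "span F \<noteq> UNIV"
      then obtain d where d: "d \<noteq> 0" "span F \<subseteq> {x. d \<bullet> x = 0}"
        using span_not_univ_subset_hyperplane[of F] by blast
      have dF: "d \<bullet> x = 0" if "x \<in> F" for x using d(2) span_base[OF that] by auto
      have "d $ e = 0" if "c $ e = 0" for e
      proof -
        have "k + 1 *\<^sub>R axis e 1 \<in> dominant K" by (rule dominant_add_axis[OF k(1)]) simp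
        then have "k + axis e 1 \<in> F" using k(2) that by (simp add: F_def inner_add_right inner_axis)
        then have "d \<bullet> (k + axis e 1) = 0" by (rule dF)
        then show ?thesis using dF[OF kF] by (simp add: inner_add_right inner_axis)
      qed
      moreover have "d \<bullet> k' = 0" if "k' \<in> K" "c \<bullet> k' = \<gamma>" for k'
        by (rule dF) (simp add: F_def that dominant_generator)
      ultimately have "d = 0" using U[rule_format, of d] by blast
      then show False using d(1) by blast
    qed
    then show "F \<noteq> {} \<and> dim F = DIM(real ^ 'e)" using kF dim_eq_full by blast
  qed
  then show ?thesis using facet True by blast
qed

text \<open>For two distinct coordinates, the direction with entries \<open>a $ f\<close> at
  \<open>e\<close> and \<open>- a $ e\<close> at \<open>f\<close> lies in the hyperplane; its
  vanishing makes the axis direction \<open>e\<close> available too.\<close>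

lemma hyperplane_two_zero_coordinates:
  fixes a :: "real ^ 'e::finite"
  assumes "{x. a \<bullet> x = b} \<noteq> {}" "{x. a \<bullet> x = b} \<subseteq> {x. x $ e = 0}" "{x. a \<bullet> x = b} \<subseteq> {x. x $ f = 0}"
  shows "e = f"
proof (rule ccontr)
  assume ne: "e \<noteq> f"
  obtain x where x: "a \<bullet> x = b" using assms(1) by blast
  have move: "v $ e = 0 \<and> v $ f = 0" if "a \<bullet> v = 0" for v
  proof -
    have "a \<bullet> (x + v) = b" using x that by (simp add: inner_add_right)
    then have m: "x + v \<in> {x. a \<bullet> x = b}" "x \<in> {x. a \<bullet> x = b}" using x by simp_all
    have "(x + v) $ e = 0" "x $ e = 0"
      using subsetD[OF assms(2) m(1)] subsetD[OF assms(2) m(2)] by (simp_all only: mem_Collect_eq)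
    moreover have "(x + v) $ f = 0" "x $ f = 0"
      using subsetD[OF assms(3) m(1)] subsetD[OF assms(3) m(2)] by (simp_all only: mem_Collect_eq)
    ultimately show ?thesis by simp
  qed
  have "a \<bullet> ((a $ f) *\<^sub>R axis e 1 - (a $ e) *\<^sub>R axis f 1) = 0"
    by (simp add: inner_diff_right inner_axis)
  from move[OF this] have "a $ e = 0" using ne by (simp add: axis_def)
  then have "a \<bullet> axis e 1 = 0" by (simp add: inner_axis)
  from move[OF this] show False by simp
qed

text \<open>With right-hand side zero, the face lies in \<open>x $ e = 0\<close> for each
  \<open>e\<close> with \<open>c $ e \<noteq> 0\<close>. Its affine hull is a hyperplane, so there
  is only one such \<open>e\<close>, and the normalization makes \<open>c\<close> the axis
  vector.\<close>

lemma facet_of_dominant_zero: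
  fixes K :: "(real ^ 'e::finite) set"
  assumes K: "K \<noteq> {}" "\<And>k e. k \<in> K \<Longrightarrow> 0 \<le> k $ e"
    and facet: "defines_facet (dominant K) c \<gamma>" and c: "minimum_integer_form c"
    and not: "\<not> nonnegativity_constraint c \<gamma>"
  shows "0 < \<gamma>"
proof (rule ccontr)
  assume "\<not> 0 < \<gamma>"
  define F where "F = {x \<in> dominant K. c \<bullet> x = \<gamma>}"
  have valid: "\<forall>x\<in>dominant K. \<gamma> \<le> c \<bullet> x" and F: "F \<noteq> {}" "aff_dim F = int DIM(real ^ 'e) - 1"
    using facet aff_dim_dominant[OF K(1)] by (auto simp: defines_facet_def facet_of_def F_def)
  have c0: "0 \<le> c $ e" for e using valid valid_dominant_iff[OF K(1)] by blast
  have x0: "0 \<le> x $ e" if "x \<in> dominant K" for x e by (rule dominant_nonneg[OF K(2) that])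
  obtain x where "x \<in> dominant K" "c \<bullet> x = \<gamma>" using F(1) by (auto simp: F_def)
  then have "0 \<le> \<gamma>" using inner_nonneg[of c x] c0 x0 by blast
  then have \<gamma>0: "\<gamma> = 0" using \<open>\<not> 0 < \<gamma>\<close> by simp
  obtain a where a: "\<And>e. c $ e = real (a e)" "Gcd (range a) = (1 :: nat)"
    using c by (auto simp: minimum_integer_form_def)
  have zero: "x $ e = 0" if "x \<in> F" "c $ e \<noteq> 0" for x e
  proof -
    have "(\<Sum>e\<in>UNIV. c $ e * x $ e) = 0" using that \<gamma>0 by (simp add: F_def inner_sum_components)
    then have "\<forall>e. c $ e * x $ e = 0"
      using c0 x0 that by (subst (asm) sum_nonneg_eq_0_iff) (auto simp: F_def)
    then show ?thesis using that(2) by (metis mult_eq_0_iff)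
  qed
  obtain b r where br: "b \<noteq> 0" "affine hull F = {x. b \<bullet> x = r}"
    using aff_dim_eq_hyperplane[of F] F(2) by auto
  have sub: "{x. b \<bullet> x = r} \<subseteq> {x. x $ e = 0}" if "c $ e \<noteq> 0" for e
  proof -
    have "affine {x :: real ^ 'e. axis e 1 \<bullet> x = 0}" by (rule affine_hyperplane)
    then have "affine hull F \<subseteq> {x. axis e 1 \<bullet> x = 0}"
      using zero that by (intro hull_minimal) (auto simp: inner_axis')
    then show ?thesis using br by (simp add: inner_axis')
  qed
  have ne: "{x. b \<bullet> x = r} \<noteq> {}" using br(2) F(1) by (metis affine_hull_eq_empty)
  have "\<exists>e. c $ e \<noteq> 0"
  proof (rule ccontr)
    assume "\<not> ?thesis"
    then have "range a = {0}" using a(1) by auto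
    then show False using a(2) by simp
  qed
  then obtain e where e: "c $ e \<noteq> 0" by blast
  have other: "a f = 0" if "f \<noteq> e" for f
    using hyperplane_two_zero_coordinates[OF ne sub sub, of e f] e that a(1)[of f] by auto
  have "a e dvd a f" for f using other[of f] by (cases "f = e") auto
  then have "a e dvd Gcd (range a)" by (intro Gcd_greatest) auto
  then have "a e = 1" using a(2) by simp
  then have "c = axis e 1" using other a(1) by (auto simp: vec_eq_iff axis_def)
  then show False using not \<gamma>0 by (auto simp: nonnegativity_constraint_def)
qed

subsection \<open>Cycles in simple graphs\<close>

lemma rtranclp_distinct_path:
  assumes "r\<^sup>*\<^sup>* a b"
  shows "\<exists>xs. xs \<noteq> [] \<and> distinct xs \<and> hd xs = a \<and> last xs = b \<and>
    (\<forall>i. Suc i < length xs \<longrightarrow> r (xs ! i) (xs ! Suc i))"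
  using assms
proof (induction rule: rtranclp_induct)
  case base
  show ?case by (intro exI[of _ "[a]"]) auto
next
  case (step y z)
  then obtain xs where xs: "xs \<noteq> []" "distinct xs" "hd xs = a" "last xs = y"
    "\<forall>i. Suc i < length xs \<longrightarrow> r (xs ! i) (xs ! Suc i)" by blast
  show ?case
  proof (cases "z \<in> set xs")
    case True
    then obtain k where k: "k < length xs" "xs ! k = z" by (auto simp: in_set_conv_nth)
    let ?ys = "take (Suc k) xs"
    have "last ?ys = z" using k by (simp add: take_Suc_conv_app_nth)
    moreover have "hd ?ys = a" using xs by (simp add: hd_take)
    moreover have "\<forall>i. Suc i < length ?ys \<longrightarrow> r (?ys ! i) (?ys ! Suc i)" using xs(5) by auto
    ultimately show ?thesis using xs by (intro exI[of _ ?ys]) auto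
  next
    case False
    have "r ((xs @ [z]) ! i) ((xs @ [z]) ! Suc i)" if "Suc i < length (xs @ [z])" for i
    proof (cases "Suc i < length xs")
      case True
      then show ?thesis using xs(5) by (simp add: nth_append)
    next
      case False
      then have i: "Suc i = length xs" using that by simp
      then have "xs ! i = y" using xs(1,4) by (metis diff_Suc_1 last_conv_nth)
      then show ?thesis using step(2) i by (auto simp: nth_append)
    qed
    then show ?thesis using xs False by (intro exI[of _ "xs @ [z]"]) auto
  qed
qed

lemma mod_add_right_cancel_nat: "(i + k) mod n = (j + k) mod n \<longleftrightarrow> i mod n = j mod (n :: nat)"
proof (cases "i \<le> j")
  case True
  then show ?thesis
    using mod_eq_dvd_iff_nat[of "i + k" "j + k" n] mod_eq_dvd_iff_nat[of i j n] by (auto dest: sym)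
next
  case False
  then show ?thesis
    using mod_eq_dvd_iff_nat[of "j + k" "i + k" n] mod_eq_dvd_iff_nat[of j i n] by auto
qed

locale simple_ends =
  fixes ends :: "'e::finite \<Rightarrow> 'v::finite set"
  assumes simple: "simple_graph ends"
begin

lemma ends_inj: "ends e = ends f \<Longrightarrow> e = f"
  using simple by (auto simp: simple_graph_def inj_def)

lemma endsE:
  obtains a b where "ends e = {a, b}" "a \<noteq> b"
proof -
  have "card (ends e) = 2" using simple by (simp add: simple_graph_def)
  then show ?thesis using that by (auto simp: card_2_iff)
qed

lemma ends_distinct: "ends e = {a, b} \<Longrightarrow> a \<noteq> b"
  using simple unfolding simple_graph_def by (metis card_2_iff' insert_absorb2 singletonD singletonI)

lemma cut_iff: "ends e = {a, b} \<Longrightarrow> e \<in> cut ends S \<longleftrightarrow> (a \<in> S) \<noteq> (b \<in> S)"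
  using ends_distinct[of e a b] by (auto simp: cut_def Int_insert_left)

lemma cut_Compl: "cut ends (- S) = cut ends S"
proof -
  have "e \<in> cut ends (- S) \<longleftrightarrow> e \<in> cut ends S" for e
    by (rule endsE[of e]) (simp add: cut_iff)
  then show ?thesis by blast
qed

text \<open>Periodic enumeration of nodes and edges by all natural numbers: rotating the cycle is a
  shift of the index, and \<open>x n = x 0\<close> closes it without wrap-around cases.\<close>

definition cyclic :: "'e set \<Rightarrow> nat \<Rightarrow> (nat \<Rightarrow> 'v) \<Rightarrow> (nat \<Rightarrow> 'e) \<Rightarrow> bool" where
  "cyclic C n x g \<longleftrightarrow> 3 \<le> n \<and> (\<forall>i j. x i = x j \<longleftrightarrow> i mod n = j mod n) \<and>
    (\<forall>i. ends (g i) = {x i, x (Suc i)}) \<and> C = range g"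

lemma cyclic_exists:
  assumes "is_cycle ends C"
  obtains n x g where "cyclic C n x g"
proof -
  obtain vs where vs: "3 \<le> length vs" "distinct vs"
    "ends ` C = {{vs ! i, vs ! (Suc i mod length vs)} | i. i < length vs}"
    using assms by (auto simp: is_cycle_def)
  define n where "n = length vs"
  define x where "x i = vs ! (i mod n)" for i
  have n: "3 \<le> n" using vs by (simp add: n_def)
  have xS: "x (Suc i) = vs ! (Suc (i mod n) mod n)" for i by (simp add: x_def mod_Suc_eq)
  have "\<exists>e\<in>C. ends e = {x i, x (Suc i)}" for i
  proof -
    have "{x i, x (Suc i)} \<in> ends ` C"
      unfolding vs(3) xS using n by (auto simp: x_def n_def[symmetric] intro!: exI[of _ "i mod n"])
    then show ?thesis by auto
  qed
  then obtain g where g: "\<And>i. g i \<in> C" "\<And>i. ends (g i) = {x i, x (Suc i)}" by metis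
  have "x i = x j \<longleftrightarrow> i mod n = j mod n" for i j
  proof -
    have "i mod n < length vs" "j mod n < length vs" using n by (auto simp: n_def[symmetric])
    then show ?thesis using vs(2) by (simp add: x_def nth_eq_iff_index_eq)
  qed
  moreover have "C = range g"
  proof
    show "C \<subseteq> range g"
    proof
      fix e
      assume "e \<in> C"
      then obtain i where "i < n" "ends e = {vs ! i, vs ! (Suc i mod n)}"
        using vs(3) unfolding n_def by blast
      then have "ends e = ends (g i)" using g(2) by (simp add: x_def)
      then show "e \<in> range g" using ends_inj by blast
    qed
  qed (use g in auto)
  ultimately have "cyclic C n x g" using n g by (simp add: cyclic_def)
  then show ?thesis by (rule that)
qed

text \<open>Depends on \<open>3 \<le> n\<close>: equal edges with exchanged ends would make
  \<open>n\<close> divide 2.\<close>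

lemma cyclic_edge_eq:
  assumes "cyclic C n x g"
  shows "g i = g j \<longleftrightarrow> i mod n = j mod n"
proof
  have n: "3 \<le> n" and x: "\<And>i j. x i = x j \<longleftrightarrow> i mod n = j mod n"
    and ends: "\<And>i. ends (g i) = {x i, x (Suc i)}"
    using assms by (auto simp: cyclic_def)
  show "i mod n = j mod n" if "g i = g j"
  proof (rule ccontr)
    assume ne: "i mod n \<noteq> j mod n"
    have "{x i, x (Suc i)} = {x j, x (Suc j)}" using ends that by metis
    then have "x i = x (Suc j)" "x (Suc i) = x j" using x ne by (auto simp: doubleton_eq_iff)
    then have "i mod n = Suc j mod n" "Suc i mod n = j mod n" using x by auto
    then have "Suc (Suc j) mod n = j mod n" by (metis mod_Suc_eq)
    then have "(j + 2) mod n = j mod n" by simp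
    then have "n dvd 2" using mod_eq_dvd_iff_nat[of j "j + 2" n] by simp
    then show False using n by (auto dest: dvd_imp_le)
  qed
  show "g i = g j" if "i mod n = j mod n"
  proof -
    have "Suc i mod n = Suc j mod n" using that by (metis mod_Suc_eq)
    then have "x i = x j" "x (Suc i) = x (Suc j)" using that x by blast+
    then have "ends (g i) = ends (g j)" using ends by simp
    then show ?thesis by (rule ends_inj)
  qed
qed

lemma cyclic_shift:
  assumes "cyclic C n x g"
  shows "cyclic C n (\<lambda>i. x (i + k)) (\<lambda>i. g (i + k))"
proof -
  have n: "3 \<le> n" using assms by (simp add: cyclic_def)
  have "range (\<lambda>i. g (i + k)) = range g"
  proof
    show "range g \<subseteq> range (\<lambda>i. g (i + k))"
    proof
      fix e
      assume "e \<in> range g"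
      then obtain i where "e = g i" by blast
      \<comment> \<open>Modulo \<open>n\<close>, shifting back by \<open>k\<close> is shifting
        forward by \<open>k * (n - 1)\<close>.\<close>
      moreover have "g i = g (i + k * (n - 1) + k)"
      proof -
        have "k * (n - 1) + k = k * n" using n by (cases n) auto
        then have "i + k * (n - 1) + k = i + k * n" by simp
        then have "(i + k * (n - 1) + k) mod n = i mod n" by (simp only: mod_mult_self1)
        then show ?thesis using cyclic_edge_eq[OF assms] by metis
      qed
      ultimately show "e \<in> range (\<lambda>i. g (i + k))" by blast
    qed
  qed auto
  moreover have "(i + k) mod n = (j + k) mod n \<longleftrightarrow> i mod n = j mod n" for i j
    by (rule mod_add_right_cancel_nat)
  ultimately show ?thesis using assms by (simp add: cyclic_def)
qed

lemma cyclic_from_edge: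
  assumes "is_cycle ends C" "e \<in> C"
  obtains n x g where "cyclic C n x g" "g 0 = e"
proof -
  obtain n x g where c: "cyclic C n x g" by (rule cyclic_exists[OF assms(1)])
  then obtain k where "g k = e" using assms(2) by (auto simp: cyclic_def)
  then show ?thesis using that[OF cyclic_shift[OF c, of k]] by simp
qed

lemma cycle_nodes_cyclic: "cyclic C n x g \<Longrightarrow> cycle_nodes ends C = range x"
  by (auto simp: cyclic_def cycle_nodes_def)

lemma cyclic_from_node:
  assumes "is_cycle ends C" "v \<in> cycle_nodes ends C"
  obtains n x g where "cyclic C n x g" "x 0 = v"
proof -
  obtain n x g where c: "cyclic C n x g" by (rule cyclic_exists[OF assms(1)])
  then obtain k where "x k = v" using assms(2) cycle_nodes_cyclic[OF c] by auto
  then show ?thesis using that[OF cyclic_shift[OF c, of k]] by simp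
qed

lemma cyclic_node_lt:
  assumes "cyclic C n x g" "v \<in> cycle_nodes ends C"
  obtains i where "i < n" "x i = v"
proof -
  obtain k where k: "v = x k" using assms cycle_nodes_cyclic by auto
  have "x (k mod n) = v" "k mod n < n" using assms k by (auto simp: cyclic_def)
  then show ?thesis using that by blast
qed

lemma cyclic_edge_lt:
  assumes "cyclic C n x g" "e \<in> C"
  obtains i where "i < n" "g i = e"
proof -
  obtain k where k: "e = g k" using assms by (auto simp: cyclic_def)
  have "g (k mod n) = g k" using cyclic_edge_eq[OF assms(1)] by simp
  moreover have "k mod n < n" using assms by (auto simp: cyclic_def)
  ultimately show ?thesis using that k by metis
qed

lemma cyclic_crossing:
  assumes "cyclic C n x g" "i \<le> j" "(x i \<in> S) \<noteq> (x j \<in> S)"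
  obtains k where "i \<le> k" "k < j" "g k \<in> cut ends S"
proof -
  have "\<exists>k. i \<le> k \<and> k < j \<and> g k \<in> cut ends S"
  proof (rule ccontr)
    assume contra: "\<not> ?thesis"
    have "k \<le> j \<longrightarrow> (x k \<in> S \<longleftrightarrow> x i \<in> S)" if "i \<le> k" for k
      using that
    proof (induction k rule: dec_induct)
      case (step k)
      have "ends (g k) = {x k, x (Suc k)}" using assms(1) by (simp add: cyclic_def)
      then show ?case using contra step cut_iff by (metis Suc_le_lessD le_SucI less_or_eq_imp_le)
    qed simp
    then show False using assms(2,3) by blast
  qed
  then show ?thesis using that by blast
qed

text \<open>After crossing the cut along \<open>e\<close>, the cycle has to cross it again to
  return.\<close>

lemma cut_cycle_other:
  assumes "is_cycle ends C" "e \<in> C" "e \<in> cut ends S"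
  obtains f where "f \<in> C" "f \<in> cut ends S" "f \<noteq> e"
proof -
  obtain n x g where c: "cyclic C n x g" and e: "g 0 = e" by (rule cyclic_from_edge[OF assms(1,2)])
  have n: "3 \<le> n" "x n = x 0" "ends (g 0) = {x 0, x (Suc 0)}" "C = range g"
    using c by (auto simp: cyclic_def)
  have "(x 1 \<in> S) \<noteq> (x n \<in> S)" using cut_iff[OF n(3)] assms(3) e n(2) by auto
  then obtain k where k: "1 \<le> k" "k < n" "g k \<in> cut ends S"
    using cyclic_crossing[OF c, of 1 n S] n by auto
  have "g k \<noteq> g 0" using cyclic_edge_eq[OF c] k by simp
  then show ?thesis using that[of "g k"] k e n(4) by auto
qed

lemma cycle_through:
  assumes "(adjacent ends (F - {e}))\<^sup>*\<^sup>* a b" "e \<in> F" "ends e = {a, b}"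
  obtains C where "C \<in> cycles ends F" "e \<in> C"
proof -
  obtain xs where xs: "xs \<noteq> []" "distinct xs" "hd xs = a" "last xs = b"
    "\<forall>i. Suc i < length xs \<longrightarrow> adjacent ends (F - {e}) (xs ! i) (xs ! Suc i)"
    using rtranclp_distinct_path[OF assms(1)] by blast
  define n where "n = length xs"
  have ab: "a \<noteq> b" by (rule ends_distinct[OF assms(3)])
  have x0: "xs ! 0 = a" and xl: "xs ! (n - 1) = b"
    using xs by (auto simp: hd_conv_nth last_conv_nth n_def)
  have "n \<noteq> 0" using xs by (simp add: n_def)
  moreover have "n \<noteq> 1" using x0 xl ab by auto
  \<comment> \<open>In a simple graph a path of one edge between the ends of \<open>e\<close> would
    be \<open>e\<close> itself.\<close>
  moreover have "n \<noteq> 2"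
  proof
    assume "n = 2"
    then have "adjacent ends (F - {e}) a b" using xs(5) x0 xl by (auto simp: n_def)
    then show False using assms(3) ends_inj by (auto simp: adjacent_def)
  qed
  ultimately have n: "3 \<le> n" by linarith
  define P where "P = {{xs ! i, xs ! (Suc i mod n)} | i. i < n}"
  define C where "C = {f \<in> F. ends f \<in> P}"
  have "P \<subseteq> ends ` F"
  proof
    fix p
    assume "p \<in> P"
    then obtain i where i: "i < n" "p = {xs ! i, xs ! (Suc i mod n)}" by (auto simp: P_def)
    show "p \<in> ends ` F"
    proof (cases "Suc i < n")
      case True
      then have "adjacent ends (F - {e}) (xs ! i) (xs ! Suc i)" using xs(5) by (simp add: n_def)
      then show ?thesis using i True by (auto simp: adjacent_def)
    next
      case False
      then have "Suc i = n" using i by linarith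
      then have "i = n - 1" "Suc i mod n = 0" by auto
      then have "p = ends e" using i x0 xl assms(3) by auto
      then show ?thesis using assms(2) by blast
    qed
  qed
  then have "ends ` C = P" by (auto simp: C_def)
  then have "is_cycle ends C"
    unfolding is_cycle_def using n xs(2) by (intro exI[of _ xs]) (simp add: n_def P_def)
  moreover have "e \<in> C"
  proof -
    have "Suc (n - 1) mod n = 0" "n - 1 < n" using n by auto
    then have "ends e \<in> P" unfolding P_def using x0 xl assms(3)
      by (intro CollectI exI[of _ "n - 1"]) auto
    then show ?thesis using assms(2) by (simp add: C_def)
  qed
  ultimately show ?thesis using that[of C] by (auto simp: cycles_def C_def)
qed

lemma reachable_cut:
  "f \<in> cut ends {v. (adjacent ends F)\<^sup>*\<^sup>* a v} \<Longrightarrow> f \<notin> F"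
proof
  assume f: "f \<in> cut ends {v. (adjacent ends F)\<^sup>*\<^sup>* a v}" "f \<in> F"
  obtain c d where cd: "ends f = {c, d}" by (rule endsE)
  then have "adjacent ends F c d" "adjacent ends F d c" using f(2) by (auto simp: adjacent_def insert_commute)
  then show False using f(1) cut_iff[OF cd] by (auto intro: rtranclp.rtrancl_into_rtrancl)
qed

text \<open>\<open>S\<close> is what \<open>a\<close> reaches without \<open>e\<close>; reaching
  \<open>b\<close> would close a cycle through \<open>e\<close>.\<close>

lemma bridge_cut:
  assumes "e \<in> F" "\<And>C. C \<in> cycles ends F \<Longrightarrow> e \<notin> C" "ends e = {a, b}"
  obtains S where "a \<in> S" "b \<notin> S" "cut ends S \<inter> F = {e}"
proof
  let ?S = "{v. (adjacent ends (F - {e}))\<^sup>*\<^sup>* a v}"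
  show a: "a \<in> ?S" by simp
  show b: "b \<notin> ?S" using cycle_through[OF _ assms(1,3)] assms(2) by blast
  show "cut ends ?S \<inter> F = {e}"
    using reachable_cut[of _ "F - {e}" a] cut_iff[OF assms(3), of ?S] a b assms(1) by blast
qed

text \<open>The cactus condition without the existence of a cycle, so that spanning trees and cacti
  are treated together.\<close>

definition edge_disjoint_cycles :: "'e set \<Rightarrow> bool" where
  "edge_disjoint_cycles F \<longleftrightarrow>
    (\<forall>C\<in>cycles ends F. \<forall>D\<in>cycles ends F. C \<inter> D \<noteq> {} \<longrightarrow> C = D)"

lemma cycles_mono: "F \<subseteq> G \<Longrightarrow> cycles ends F \<subseteq> cycles ends G"
  by (auto simp: cycles_def)

lemma cyclesD: "C \<in> cycles ends F \<Longrightarrow> is_cycle ends C" "C \<in> cycles ends F \<Longrightarrow> C \<subseteq> F"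
  by (auto simp: cycles_def)

text \<open>Without \<open>e\<close> the edge \<open>f\<close> lies on no cycle, since that cycle
  would be \<open>C\<close>. The cut in which \<open>f\<close> is alone must be crossed by
  \<open>C\<close> a second time, which only \<open>e\<close> can do.\<close>

lemma cycle_pair_cut:
  assumes "edge_disjoint_cycles F" "C \<in> cycles ends F" "e \<in> C" "f \<in> C" "e \<noteq> f"
  obtains S where "cut ends S \<inter> F = {e, f}"
proof -
  have F: "f \<in> F - {e}" using assms cyclesD(2) by blast
  have nc: "f \<notin> D" if "D \<in> cycles ends (F - {e})" for D
  proof
    assume "f \<in> D"
    have D: "D \<in> cycles ends F" "e \<notin> D" using that cycles_mono[of "F - {e}" F] cyclesD(2)[OF that] by auto
    then have "D = C" using assms \<open>f \<in> D\<close> unfolding edge_disjoint_cycles_def by blast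
    then show False using D assms by blast
  qed
  obtain a b where "ends f = {a, b}" by (rule endsE)
  then obtain S where S: "cut ends S \<inter> (F - {e}) = {f}" using bridge_cut[OF F nc] by blast
  then have "f \<in> cut ends S" by blast
  then obtain h where "h \<in> C" "h \<in> cut ends S" "h \<noteq> f"
    using cut_cycle_other[OF cyclesD(1)[OF assms(2)] assms(4)] by blast
  then have "h = e" using S cyclesD(2)[OF assms(2)] by blast
  then have "cut ends S \<inter> F = {e, f}" using S \<open>h \<in> cut ends S\<close> assms cyclesD(2)[OF assms(2)] by blast
  then show ?thesis by (rule that)
qed

text \<open>Deleting an edge of a cycle destroys at least one cycle; without cycles the graph is
  split at a bridge.\<close>

lemma card_edges_le:
  assumes "\<And>e. e \<in> F \<Longrightarrow> ends e \<subseteq> S" "S \<noteq> {}"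
  shows "card F + 1 \<le> card S + card (cycles ends F)"
  using assms
proof (induction "card F" arbitrary: F S rule: less_induct)
  case less
  show ?case
  proof (cases "cycles ends F = {}")
    case False
    then obtain C where C: "C \<in> cycles ends F" by blast
    obtain n x g where "cyclic C n x g" by (rule cyclic_exists[OF cyclesD(1)[OF C]])
    then obtain e where e: "e \<in> C" by (auto simp: cyclic_def)
    have eF: "e \<in> F" using C e cyclesD by blast
    have "card (F - {e}) + 1 \<le> card S + card (cycles ends (F - {e}))"
      by (rule less.hyps[OF card_Diff1_less]) (use less.prems eF in auto)
    moreover have "cycles ends (F - {e}) \<subset> cycles ends F"
      using C e cycles_mono[of "F - {e}" F] cyclesD(2)[of C "F - {e}"] by blast
    then have "card (cycles ends (F - {e})) < card (cycles ends F)"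
      by (intro psubset_card_mono) auto
    moreover have "card F = card (F - {e}) + 1" using card_Suc_Diff1[of F e] eF by simp
    ultimately show ?thesis by linarith
  next
    case True
    show ?thesis
    proof (cases "F = {}")
      case True
      then show ?thesis using less.prems by (simp add: Suc_le_eq card_gt_0_iff)
    next
      case False
      then obtain e where e: "e \<in> F" by blast
      obtain a b where ab: "ends e = {a, b}" by (rule endsE)
      then obtain R where R: "a \<in> R" "b \<notin> R" "cut ends R \<inter> F = {e}"
        using bridge_cut[OF e] \<open>cycles ends F = {}\<close> by blast
      define F1 where "F1 = {f \<in> F - {e}. ends f \<subseteq> R}"
      define F2 where "F2 = {f \<in> F - {e}. ends f \<subseteq> - R}"
      have "f \<in> F1 \<union> F2" if "f \<in> F - {e}" for f
      proof -
        obtain c d where cd: "ends f = {c, d}" by (rule endsE)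
        have "f \<notin> cut ends R" using that R by blast
        then show ?thesis using cut_iff[OF cd] that cd by (auto simp: F1_def F2_def)
      qed
      then have F: "F - {e} = F1 \<union> F2" by (auto simp: F1_def F2_def)
      have "F1 \<inter> F2 = {}"
      proof -
        have "ends f \<noteq> {}" for f by (rule endsE[of f]) auto
        then show ?thesis by (auto simp: F1_def F2_def)
      qed
      then have "card (F - {e}) = card F1 + card F2" unfolding F by (intro card_Un_disjoint) auto
      then have cF: "card F = card F1 + card F2 + 1" using card_Suc_Diff1[of F e] e by simp
      have abS: "a \<in> S" "b \<in> S" using less.prems(1)[OF e] ab by auto
      have "card F1 + 1 \<le> card (S \<inter> R) + card (cycles ends F1)"
        by (rule less.hyps) (use less.prems cF abS R in \<open>auto simp: F1_def\<close>)
      moreover have "card F2 + 1 \<le> card (S - R) + card (cycles ends F2)"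
        by (rule less.hyps) (use less.prems cF abS R in \<open>auto simp: F2_def\<close>)
      moreover have "cycles ends F1 = {}" "cycles ends F2 = {}"
        using cycles_mono[of F1 F] cycles_mono[of F2 F] True by (auto simp: F1_def F2_def)
      moreover have "card S = card (S \<inter> R) + card (S - R)"
        using card_Un_disjoint[of "S \<inter> R" "S - R"] by (simp add: Int_Diff_Un) blast
      ultimately show ?thesis using cF by simp
    qed
  qed
qed

subsection \<open>Degrees, leaves and defects\<close>

definition incident :: "'e set \<Rightarrow> 'v \<Rightarrow> 'e set" where
  "incident F v = {e \<in> F. v \<in> ends e}"

definition attached :: "'e set \<Rightarrow> 'e set \<Rightarrow> 'v \<Rightarrow> bool" where
  "attached F C v \<longleftrightarrow>
    v \<in> cycle_nodes ends C \<and> (\<exists>u. u \<notin> cycle_nodes ends C \<and> adjacent ends F v u)"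

definition attachments :: "'e set \<Rightarrow> 'v \<Rightarrow> 'e set set" where
  "attachments F v = {C \<in> cycles ends F. attached F C v}"

lemma cycle_degree_eq: "cycle_degree ends F C = card {v. attached F C v}"
  by (simp add: cycle_degree_def attached_def)

lemma leaves_eq: "leaves ends F = {v. card (incident F v) = 1}"
  by (simp add: leaves_def incident_def)

lemma card_inter_ends:
  "card (ends e \<inter> S) = 2 * (if ends e \<subseteq> S then 1 else 0) + (if e \<in> cut ends S then 1 else 0)"
proof -
  obtain a b where ab: "ends e = {a, b}" "a \<noteq> b" by (rule endsE)
  show ?thesis
    using cut_iff[OF ab(1), of S] ab by (auto simp: Int_insert_left)
qed

lemma sum_card_incident_edges:
  "(\<Sum>v\<in>S. card (incident F v)) = 2 * card {e \<in> F. ends e \<subseteq> S} + card (cut ends S \<inter> F)"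
proof -
  have "(\<Sum>v\<in>S. card (incident F v)) = (\<Sum>e\<in>F. card (ends e \<inter> S))"
    unfolding incident_def
    by (rule sum_multicount_gen) (auto simp: Int_commute Int_def intro!: arg_cong[where f = card])
  also have "\<dots> = 2 * card {e \<in> F. ends e \<subseteq> S} + card {e \<in> F. e \<in> cut ends S}"
    unfolding card_inter_ends sum.distrib sum_distrib_left[symmetric]
    by (simp add: sum.inter_filter[symmetric])
  also have "{e \<in> F. e \<in> cut ends S} = cut ends S \<inter> F" by blast
  finally show ?thesis .
qed

lemma card_cycle_incident_ge_2:
  assumes "is_cycle ends C" "v \<in> cycle_nodes ends C"
  shows "2 \<le> card (incident C v)"
proof -
  obtain n x g where c: "cyclic C n x g" "x 0 = v" by (rule cyclic_from_node[OF assms])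
  have n: "3 \<le> n" and ends: "\<And>i. ends (g i) = {x i, x (Suc i)}" and C: "C = range g"
    using c by (auto simp: cyclic_def)
  have "x i = x j \<longleftrightarrow> i mod n = j mod n" for i j using c by (simp add: cyclic_def)
  then have "x n = x 0" by simp
  then have "v \<in> ends (g (n - 1))" using ends[of "n - 1"] n c(2) by auto
  moreover have "v \<in> ends (g 0)" using ends[of 0] c(2) by auto
  moreover have "g (n - 1) \<noteq> g 0" using cyclic_edge_eq[OF c(1), of "n - 1" 0] n by auto
  ultimately have "card {g (n - 1), g 0} = 2" "{g (n - 1), g 0} \<subseteq> incident C v"
    using C by (auto simp: incident_def)
  then show ?thesis using card_mono[of "incident C v" "{g (n - 1), g 0}"] by simp
qed

lemma card_cycle_nodes_ge_3:
  assumes "is_cycle ends C"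
  shows "3 \<le> card (cycle_nodes ends C)"
proof -
  obtain n x g where c: "cyclic C n x g" by (rule cyclic_exists[OF assms])
  have n: "3 \<le> n" using c by (simp add: cyclic_def)
  have "inj_on x {..<n}" using c by (auto simp: cyclic_def inj_on_def)
  then have "card (x ` {..<n}) = n" by (simp add: card_image)
  moreover have "x ` {..<n} \<subseteq> cycle_nodes ends C" using cycle_nodes_cyclic[OF c] by auto
  ultimately show ?thesis using n card_mono[OF finite, of "x ` {..<n}" "cycle_nodes ends C"] by simp
qed

text \<open>Each cycle attached at \<open>v\<close> has two edges of its own there. Two cycles
  suffice; for a single one, an edge leaving the cycle is the third; without any, degree one is made
  up for by the leaf term.\<close>

lemma degree_ge:
  assumes F: "edge_disjoint_cycles F" and v: "incident F v \<noteq> {}"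
  shows "2 + card (attachments F v) \<le> card (incident F v) + (if v \<in> leaves ends F then 1 else 0)"
proof (cases "attachments F v = {}")
  case True
  define k where "k = card (incident F v)"
  have "1 \<le> k" using v by (simp add: k_def Suc_le_eq card_gt_0_iff)
  then show ?thesis using True by (auto simp: leaves_eq k_def[symmetric])
next
  case False
  let ?U = "\<Union>C\<in>attachments F v. incident C v"
  have att: "C \<in> cycles ends F" "v \<in> cycle_nodes ends C" if "C \<in> attachments F v" for C
    using that by (auto simp: attachments_def attached_def)
  have "card ?U = (\<Sum>C\<in>attachments F v. card (incident C v))"
  proof (rule card_UN_disjoint)
    show "\<forall>C\<in>attachments F v. \<forall>D\<in>attachments F v. C \<noteq> D \<longrightarrow> incident C v \<inter> incident D v = {}"
      using F att unfolding edge_disjoint_cycles_def incident_def by blast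
  qed auto
  also have "\<dots> \<ge> (\<Sum>C\<in>attachments F v. 2)"
    using att cyclesD(1) card_cycle_incident_ge_2 by (intro sum_mono) blast
  finally have U: "2 * card (attachments F v) \<le> card ?U" by simp
  have sub: "?U \<subseteq> incident F v" using att cyclesD(2) by (auto simp: incident_def) blast
  have c0: "card (attachments F v) \<noteq> 0" using False by simp
  show ?thesis
  proof (cases "card (attachments F v) = 1")
    case False
    then have "2 + card (attachments F v) \<le> card (incident F v)"
      using U card_mono[OF finite sub] c0 by linarith
    then show ?thesis by simp
  next
    case True
    then obtain C where C: "attachments F v = {C}" by (rule card_1_singletonE)
    then obtain u where u: "u \<notin> cycle_nodes ends C" "adjacent ends F v u"
      by (auto simp: attachments_def attached_def)
    then obtain h where h: "h \<in> F" "ends h = {v, u}" by (auto simp: adjacent_def)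
    have "h \<notin> C" using u(1) h(2) by (auto simp: cycle_nodes_def)
    then have "card (insert h ?U) = card ?U + 1" using C by (simp add: incident_def)
    moreover have "insert h ?U \<subseteq> incident F v" using sub h by (auto simp: incident_def)
    then have "card (insert h ?U) \<le> card (incident F v)" by (intro card_mono) auto
    ultimately have "2 + card (attachments F v) \<le> card (incident F v)" using U True by linarith
    then show ?thesis by simp
  qed
qed

text \<open>Sums \<open>degree_ge\<close> over \<open>S\<close>, counts edges inside
  \<open>S\<close> twice and cut edges once, and bounds the former by
  \<open>card_edges_le\<close>.\<close>

lemma cactus_count:
  assumes F: "edge_disjoint_cycles F" and S: "S \<noteq> {}" and inc: "\<And>v. incident F v \<noteq> {}"
  shows "2 + (\<Sum>v\<in>S. card (attachments F v)) \<le> card (leaves ends F \<inter> S)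
    + 2 * card {C \<in> cycles ends F. \<forall>e\<in>C. ends e \<subseteq> S} + card (cut ends S \<inter> F)"
proof -
  let ?FS = "{e \<in> F. ends e \<subseteq> S}"
  have "(\<Sum>v\<in>S. 2 + card (attachments F v))
      \<le> (\<Sum>v\<in>S. card (incident F v) + (if v \<in> leaves ends F then 1 else 0))"
    by (intro sum_mono degree_ge F inc)
  then have 1: "2 * card S + (\<Sum>v\<in>S. card (attachments F v))
      \<le> 2 * card ?FS + card (cut ends S \<inter> F) + card (leaves ends F \<inter> S)"
  proof -
    have "(\<Sum>v\<in>S. 2 + card (attachments F v)) = 2 * card S + (\<Sum>v\<in>S. card (attachments F v))"
      by (simp only: sum.distrib sum_constant) simp
    moreover have "(\<Sum>v\<in>S. if v \<in> leaves ends F then 1 else 0) = card (leaves ends F \<inter> S)"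
      by (simp add: sum.inter_filter[symmetric] Int_def conj_commute)
    ultimately show ?thesis
      using \<open>(\<Sum>v\<in>S. 2 + card (attachments F v)) \<le> _\<close> by (simp only: sum.distrib sum_card_incident_edges)
  qed
  have 2: "card ?FS + 1 \<le> card S + card (cycles ends ?FS)"
    by (rule card_edges_le[OF _ S]) simp
  have "cycles ends ?FS = {C \<in> cycles ends F. \<forall>e\<in>C. ends e \<subseteq> S}"
    by (auto simp: cycles_def)
  then show ?thesis using 1 2 by simp
qed

lemma sum_card_attachments:
  "(\<Sum>v\<in>S. card (attachments F v)) = (\<Sum>C\<in>cycles ends F. card {v \<in> S. attached F C v})"
  unfolding attachments_def by (rule sum_multicount_gen) auto

lemma connected_cut:
  assumes "connected_spanning ends F" "S \<noteq> {}" "S \<noteq> UNIV"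
  obtains e where "e \<in> F" "e \<in> cut ends S"
proof -
  obtain a b where ab: "a \<in> S" "b \<notin> S" using assms by blast
  have "(adjacent ends F)\<^sup>*\<^sup>* a b" using assms(1) by (simp add: connected_spanning_def)
  then have "\<exists>e\<in>F. e \<in> cut ends S"
  proof (rule contrapos_pp)
    assume no: "\<not> (\<exists>e\<in>F. e \<in> cut ends S)"
    have "c \<in> S" if "(adjacent ends F)\<^sup>*\<^sup>* a c" for c
      using that
    proof (induction rule: rtranclp_induct)
      case (step y z)
      then obtain e where e: "e \<in> F" "ends e = {y, z}" by (auto simp: adjacent_def)
      then show ?case using no cut_iff[OF e(2)] step by blast
    qed (rule ab(1))
    then show "\<not> (adjacent ends F)\<^sup>*\<^sup>* a b" using ab(2) by blast
  qed
  then show ?thesis using that by blast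
qed

lemma connected_incident:
  assumes "connected_spanning ends F" "2 \<le> CARD('v)"
  shows "incident F v \<noteq> {}"
proof -
  have "{v} \<noteq> UNIV" using assms(2) by (metis card.empty card.insert empty_iff finite.emptyI
        not_less_eq_eq numeral_2_eq_2 one_add_one plus_1_eq_Suc le_refl)
  then obtain e where e: "e \<in> F" "e \<in> cut ends {v}" using connected_cut[OF assms(1), of "{v}"] by blast
  then have "card (ends e \<inter> {v}) = 1" by (simp add: cut_def)
  then have "ends e \<inter> {v} \<noteq> {}" by (metis card.empty zero_neq_one)
  then show ?thesis using e(1) by (auto simp: incident_def)
qed

definition cactus_terminals :: "'e set \<Rightarrow> 'v set \<Rightarrow> bool" where
  "cactus_terminals F T \<longleftrightarrow> leaves ends F \<subseteq> T \<and> (\<forall>C\<in>cycles ends F.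
    defect ends F C \<le> card {v \<in> T \<inter> cycle_nodes ends C. \<not> attached F C v})"

text \<open>A cycle has at least three nodes, hence at least as many nodes without outside
  neighbours as its defect.\<close>

lemma cactus_terminals_exist:
  obtains T where "cactus_terminals F T"
    "card T \<le> card (leaves ends F) + (\<Sum>C\<in>cycles ends F. defect ends F C)"
proof -
  have "\<exists>X \<subseteq> {v \<in> cycle_nodes ends C. \<not> attached F C v}. card X = defect ends F C"
    if C: "C \<in> cycles ends F" for C
  proof -
    have "cycle_nodes ends C = {v. attached F C v} \<union> {v \<in> cycle_nodes ends C. \<not> attached F C v}"
      by (auto simp: attached_def)
    then have "card (cycle_nodes ends C) \<le> card {v. attached F C v}
        + card {v \<in> cycle_nodes ends C. \<not> attached F C v}"
      by (metis card_Un_le)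
    then have "defect ends F C \<le> card {v \<in> cycle_nodes ends C. \<not> attached F C v}"
      using card_cycle_nodes_ge_3[OF cyclesD(1)[OF C]] by (simp add: defect_def cycle_degree_eq)
    then show ?thesis by (meson obtain_subset_with_card_n)
  qed
  then obtain X where X: "\<And>C. C \<in> cycles ends F \<Longrightarrow> X C \<subseteq> {v \<in> cycle_nodes ends C. \<not> attached F C v}"
    "\<And>C. C \<in> cycles ends F \<Longrightarrow> card (X C) = defect ends F C"
    by metis
  define T where "T = leaves ends F \<union> (\<Union>C\<in>cycles ends F. X C)"
  have "card T \<le> card (leaves ends F) + card (\<Union>C\<in>cycles ends F. X C)"
    unfolding T_def by (rule card_Un_le)
  also have "card (\<Union>C\<in>cycles ends F. X C) \<le> (\<Sum>C\<in>cycles ends F. card (X C))"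
    by (rule card_UN_le) simp
  also have "\<dots> = (\<Sum>C\<in>cycles ends F. defect ends F C)" using X(2) by simp
  finally have "card T \<le> card (leaves ends F) + (\<Sum>C\<in>cycles ends F. defect ends F C)" by simp
  moreover have "defect ends F C \<le> card {v \<in> T \<inter> cycle_nodes ends C. \<not> attached F C v}"
    if "C \<in> cycles ends F" for C
    unfolding X(2)[OF that, symmetric] using X(1)[OF that] that
    by (intro card_mono) (auto simp: T_def)
  ultimately show ?thesis using that[of T] by (simp add: cactus_terminals_def T_def)
qed

text \<open>\<open>cactus_count\<close> for the set of all nodes, where degree plus defect of each
  cycle is at least three. It yields both the bound of three cycles and the two terminals that a
  Steiner cut needs.\<close>

lemma card_cycles_le:
  assumes "edge_disjoint_cycles F" "connected_spanning ends F" "2 \<le> CARD('v)"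
  shows "card (cycles ends F) + 2 \<le> card (leaves ends F) + (\<Sum>C\<in>cycles ends F. defect ends F C)"
proof -
  have cut: "cut ends UNIV = {}"
  proof -
    have "e \<notin> cut ends UNIV" for e by (rule endsE[of e]) (simp add: cut_iff)
    then show ?thesis by blast
  qed
  have "2 + (\<Sum>C\<in>cycles ends F. cycle_degree ends F C) \<le> card (leaves ends F) + 2 * card (cycles ends F)"
    using cactus_count[OF assms(1) UNIV_not_empty connected_incident[OF assms(2,3)]]
    by (simp add: sum_card_attachments cycle_degree_eq cut)
  moreover have "(\<Sum>C\<in>cycles ends F. 3) \<le> (\<Sum>C\<in>cycles ends F. cycle_degree ends F C + defect ends F C)"
    by (intro sum_mono) (simp add: defect_def)
  ultimately show ?thesis by (simp add: sum.distrib)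
qed

context
  fixes F T
  assumes F: "edge_disjoint_cycles F" "connected_spanning ends F" "2 \<le> CARD('v)"
    and T: "cactus_terminals F T"
begin

lemma attached_degree_ge_3:
  assumes "S \<inter> T = {}" "C \<in> cycles ends F" "\<forall>e\<in>C. ends e \<subseteq> S"
  shows "3 \<le> card {v \<in> S. attached F C v}"
proof -
  have sub: "cycle_nodes ends C \<subseteq> S" using assms(3) by (auto simp: cycle_nodes_def)
  then have "T \<inter> cycle_nodes ends C = {}" using assms(1) by blast
  then have empty: "{v \<in> T \<inter> cycle_nodes ends C. \<not> attached F C v} = {}" by blast
  have "defect ends F C \<le> card {v \<in> T \<inter> cycle_nodes ends C. \<not> attached F C v}"
    using T assms(2) unfolding cactus_terminals_def by blast
  then have "defect ends F C = 0" unfolding empty by simp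
  moreover have "{v. attached F C v} = {v \<in> S. attached F C v}" using sub by (auto simp: attached_def)
  ultimately show ?thesis by (simp add: defect_def cycle_degree_eq)
qed

text \<open>A side without terminals contains no leaf, and each cycle inside it has defect zero,
  hence three attached nodes. Cycles only partly inside add one each for an attached node in
  \<open>S\<close>. So its cut must be large.\<close>

lemma terminal_in_cut_side:
  assumes S: "S \<noteq> {}" "S \<inter> T = {}"
  shows "2 + card {C \<in> cycles ends F. \<forall>e\<in>C. ends e \<subseteq> S}
    + card {C \<in> cycles ends F. \<not> (\<forall>e\<in>C. ends e \<subseteq> S) \<and> (\<exists>v\<in>S. attached F C v)} \<le> card (cut ends S \<inter> F)"
proof -
  let ?in = "{C \<in> cycles ends F. \<forall>e\<in>C. ends e \<subseteq> S}"
  let ?out = "{C \<in> cycles ends F. \<not> (\<forall>e\<in>C. ends e \<subseteq> S) \<and> (\<exists>v\<in>S. attached F C v)}"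
  have "leaves ends F \<inter> S = {}" using T S by (auto simp: cactus_terminals_def)
  then have 1: "2 + (\<Sum>v\<in>S. card (attachments F v)) \<le> 2 * card ?in + card (cut ends S \<inter> F)"
    using cactus_count[OF F(1) S(1) connected_incident[OF F(2,3)]] by simp
  have "3 * card ?in \<le> (\<Sum>C\<in>?in. card {v \<in> S. attached F C v})"
    using sum_bounded_below[of ?in "3 :: nat" "\<lambda>C. card {v \<in> S. attached F C v}"] attached_degree_ge_3[OF S(2)] by (simp add: mult.commute)
  moreover have "1 * card ?out \<le> (\<Sum>C\<in>?out. card {v \<in> S. attached F C v})"
    using sum_bounded_below[of ?out "1 :: nat" "\<lambda>C. card {v \<in> S. attached F C v}"]
    by (auto simp: Suc_le_eq card_gt_0_iff)
  moreover have "(\<Sum>C\<in>?in. card {v \<in> S. attached F C v}) + (\<Sum>C\<in>?out. card {v \<in> S. attached F C v})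
      = (\<Sum>C\<in>?in \<union> ?out. card {v \<in> S. attached F C v})"
    by (rule sum.union_disjoint[symmetric]) auto
  moreover have "\<dots> \<le> (\<Sum>C\<in>cycles ends F. card {v \<in> S. attached F C v})"
    by (rule sum_mono2) auto
  ultimately show ?thesis using 1 by (simp add: sum_card_attachments)
qed

lemma terminal_in_bridge_side:
  assumes "cut ends S \<inter> F = {e}" "S \<noteq> {}"
  shows "S \<inter> T \<noteq> {}"
proof
  assume "S \<inter> T = {}"
  from terminal_in_cut_side[OF assms(2) this] show False unfolding assms(1) by simp
qed

text \<open>\<open>C\<close> itself counts as partly inside, so a side without terminals would need
  three cut edges.\<close>

lemma terminal_in_arc:
  assumes "C \<in> cycles ends F" "e \<in> C" "cut ends S \<inter> F = {e, f}" "v \<in> S"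
    and "attached F C v \<or> v \<in> T"
  shows "S \<inter> T \<noteq> {}"
proof
  assume ST: "S \<inter> T = {}"
  then have v: "attached F C v" using assms by blast
  have "\<not> ends e \<subseteq> S"
  proof -
    obtain a b where ab: "ends e = {a, b}" by (rule endsE)
    have "e \<in> cut ends S" using assms(3) by blast
    then show ?thesis using cut_iff[OF ab] ab by auto
  qed
  then have "C \<in> {C \<in> cycles ends F. \<not> (\<forall>e\<in>C. ends e \<subseteq> S) \<and> (\<exists>v\<in>S. attached F C v)}"
    using assms v by blast
  then have "card {C \<in> cycles ends F. \<not> (\<forall>e\<in>C. ends e \<subseteq> S) \<and> (\<exists>v\<in>S. attached F C v)} \<noteq> 0"
    by auto
  moreover have "card (cut ends S \<inter> F) \<le> 2" unfolding assms(3) by (cases "e = f") auto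
  moreover have "S \<noteq> {}" using assms(4) by blast
  ultimately show False using terminal_in_cut_side[OF _ ST] by linarith
qed

end

subsection \<open>Cacti and tight cuts\<close>

lemma endsE_at:
  assumes "v \<in> ends e"
  obtains u where "ends e = {v, u}"
proof -
  obtain a b where ab: "ends e = {a, b}" by (rule endsE)
  then have "v = a \<or> v = b" using assms by simp
  then show ?thesis
  proof
    assume "v = a"
    then show ?thesis using that[of b] ab by simp
  next
    assume "v = b"
    then show ?thesis using that[of a] ab by (simp add: insert_commute)
  qed
qed

lemma cut_sides:
  assumes "e \<in> cut ends S"
  obtains a b where "ends e = {a, b}" "a \<in> S" "b \<notin> S"
proof -
  obtain a b where ab: "ends e = {a, b}" by (rule endsE)
  then have "(a \<in> S) \<noteq> (b \<in> S)" using cut_iff assms by blast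
  then consider "a \<in> S" "b \<notin> S" | "b \<in> S" "a \<notin> S" by blast
  then show ?thesis
  proof cases
    case 1
    then show ?thesis using that[of a b] ab by simp
  next
    case 2
    then show ?thesis using that[of b a] ab by (simp add: insert_commute)
  qed
qed

lemma sum_cut_support:
  fixes d :: "'e \<Rightarrow> real"
  assumes "\<And>e. e \<notin> F \<Longrightarrow> d e = 0"
  shows "(\<Sum>e\<in>cut ends S. d e) = (\<Sum>e\<in>cut ends S \<inter> F. d e)"
  using assms by (intro sum.mono_neutral_right) auto

lemma cactus_vector_outside: "e \<notin> F \<Longrightarrow> cactus_vector ends F $ e = 0"
  by (simp add: cactus_vector_def)

lemma cactus_vector_cycle: "C \<in> cycles ends F \<Longrightarrow> e \<in> C \<Longrightarrow> cactus_vector ends F $ e = 1"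
  using cyclesD(2) by (auto simp: cactus_vector_def)

lemma cactus_vector_bridge:
  "e \<in> F \<Longrightarrow> (\<And>C. C \<in> cycles ends F \<Longrightarrow> e \<notin> C) \<Longrightarrow> cactus_vector ends F $ e = 2"
  by (auto simp: cactus_vector_def)

lemma cactus_vector_ge_1: "e \<in> F \<Longrightarrow> 1 \<le> cactus_vector ends F $ e"
  by (simp add: cactus_vector_def)

lemma cactus_vector_nonneg: "0 \<le> cactus_vector ends F $ e"
  by (simp add: cactus_vector_def)

lemma cactus_vector_cut_ge:
  assumes "connected_spanning ends F" "S \<noteq> {}" "S \<noteq> UNIV"
  shows "2 \<le> (\<Sum>e\<in>cut ends S. cactus_vector ends F $ e)"
proof -
  obtain e where e: "e \<in> F" "e \<in> cut ends S" by (rule connected_cut[OF assms])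
  show ?thesis
  proof (cases "\<exists>C\<in>cycles ends F. e \<in> C")
    case True
    then obtain C where C: "C \<in> cycles ends F" "e \<in> C" by blast
    obtain f where f: "f \<in> C" "f \<in> cut ends S" "f \<noteq> e"
      by (rule cut_cycle_other[OF cyclesD(1)[OF C(1)] C(2) e(2)])
    have "(\<Sum>h\<in>{e, f}. cactus_vector ends F $ h) \<le> (\<Sum>e\<in>cut ends S. cactus_vector ends F $ e)"
      using e f cactus_vector_nonneg by (intro sum_mono2) auto
    then show ?thesis using cactus_vector_cycle[OF C(1)] C(2) f by simp
  next
    case False
    have "cactus_vector ends F $ e \<le> (\<Sum>e\<in>cut ends S. cactus_vector ends F $ e)"
      using e cactus_vector_nonneg by (intro member_le_sum) auto
    then show ?thesis using cactus_vector_bridge[OF e(1)] False by simp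
  qed
qed

text \<open>As \<open>g i\<close> joins \<open>x i\<close> to \<open>x (Suc i)\<close>, removing
  \<open>g p\<close> and \<open>g q\<close> leaves the arc of indices from \<open>p + 1\<close> to
  \<open>q\<close>, and the arc of the others.\<close>

lemma cyclic_pair_sides:
  assumes c: "cyclic C n x g" and pq: "p < q" "q < n" and S: "cut ends S \<inter> C = {g p, g q}"
    and m1: "p < m1" "m1 \<le> q" and m2: "m2 \<le> p \<or> q < m2" "m2 < n"
  shows "(x m1 \<in> S) \<noteq> (x m2 \<in> S)"
proof -
  have ends: "\<And>i. ends (g i) = {x i, x (Suc i)}" and C: "C = range g"
    using c by (auto simp: cyclic_def)
  have same: "x i \<in> S \<longleftrightarrow> x j \<in> S" if ij: "i \<le> j" "j \<le> n" "\<And>k. i \<le> k \<Longrightarrow> k < j \<Longrightarrow> k \<noteq> p \<and> k \<noteq> q" for i j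
  proof (rule ccontr)
    assume "\<not> ?thesis"
    then obtain k where k: "i \<le> k" "k < j" "g k \<in> cut ends S" using cyclic_crossing[OF c ij(1)] by metis
    then have "g k = g p \<or> g k = g q" using S C by blast
    then have "k = p \<or> k = q" using cyclic_edge_eq[OF c] k ij(2) pq by auto
    then show False using ij(3) k by blast
  qed
  have "g p \<in> cut ends S" "g q \<in> cut ends S" using S by blast+
  then have p: "(x p \<in> S) \<noteq> (x (Suc p) \<in> S)" and q: "(x q \<in> S) \<noteq> (x (Suc q) \<in> S)"
    using cut_iff[OF ends] by blast+
  have 1: "x (Suc p) \<in> S \<longleftrightarrow> x q \<in> S" using pq by (intro same) auto
  have 2: "x m1 \<in> S \<longleftrightarrow> x q \<in> S" using pq m1 by (intro same) auto
  show ?thesis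
  proof (cases "m2 \<le> p")
    case True
    have "x m2 \<in> S \<longleftrightarrow> x p \<in> S" using True pq by (intro same) auto
    then show ?thesis using 1 2 p by blast
  next
    case False
    then have "x (Suc q) \<in> S \<longleftrightarrow> x m2 \<in> S" using m2 pq by (intro same) auto
    then show ?thesis using 2 q by blast
  qed
qed

text \<open>For the ends \<open>x 0\<close> and \<open>x m\<close> of \<open>e\<close>, the two-edge
  cut through \<open>g 0\<close> and \<open>g m\<close> separates them, so \<open>e\<close> must be
  one of these two edges.\<close>

lemma no_chord:
  assumes F: "edge_disjoint_cycles F" and C: "C \<in> cycles ends F"
    and e: "e \<in> F" "ends e \<subseteq> cycle_nodes ends C"
  shows "e \<in> C"
proof -
  obtain u v where uv: "ends e = {u, v}" "u \<noteq> v" by (rule endsE)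
  obtain n x g where c: "cyclic C n x g" and u: "x 0 = u"
    using cyclic_from_node[OF cyclesD(1)[OF C], of u] e(2) uv by auto
  obtain m where m: "m < n" "x m = v" using cyclic_node_lt[OF c, of v] e(2) uv by auto
  have m0: "0 < m" using m u uv by (cases m) auto
  have g: "g 0 \<in> C" "g m \<in> C" "g 0 \<noteq> g m"
    using c cyclic_edge_eq[OF c, of 0 m] m m0 by (auto simp: cyclic_def)
  obtain S where S: "cut ends S \<inter> F = {g 0, g m}" by (rule cycle_pair_cut[OF F C g])
  then have "cut ends S \<inter> C = {g 0, g m}" using cyclesD(2)[OF C] g by blast
  then have "(x m \<in> S) \<noteq> (x 0 \<in> S)"
    using m m0 by (intro cyclic_pair_sides[OF c, of 0 m]) auto
  then have "e \<in> cut ends S" using cut_iff[OF uv(1)] u m by auto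
  then have "e \<in> {g 0, g m}" using S e(1) by (metis IntI)
  then show ?thesis using g by auto
qed

lemma leaf_not_on_cycle:
  assumes "C \<in> cycles ends F" "v \<in> leaves ends F"
  shows "v \<notin> cycle_nodes ends C"
proof
  assume "v \<in> cycle_nodes ends C"
  then have "2 \<le> card (incident C v)" using card_cycle_incident_ge_2 cyclesD(1)[OF assms(1)] by blast
  also have "\<dots> \<le> card (incident F v)"
    using cyclesD(2)[OF assms(1)] by (intro card_mono) (auto simp: incident_def)
  finally show False using assms(2) by (simp add: leaves_eq)
qed

definition tight_steiner :: "'e set \<Rightarrow> 'v set \<Rightarrow> 'v set \<Rightarrow> bool" where
  "tight_steiner F T S \<longleftrightarrow> T \<inter> S \<noteq> {} \<and> T - S \<noteq> {} \<and> (\<Sum>e\<in>cut ends S. cactus_vector ends F $ e) = 2"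

text \<open>What the facet criterion asks of the cactus vector beyond validity, with the terminals
  as the only choice left.\<close>

definition cactus_unique :: "'e set \<Rightarrow> 'v set \<Rightarrow> bool" where
  "cactus_unique F T \<longleftrightarrow> (\<forall>d :: 'e \<Rightarrow> real. (\<forall>e. e \<notin> F \<longrightarrow> d e = 0) \<longrightarrow>
     (\<forall>S. tight_steiner F T S \<longrightarrow> (\<Sum>e\<in>cut ends S. d e) = 0) \<longrightarrow> (\<forall>e. d e = 0))"

lemma cactus_uniqueD:
  assumes "cactus_unique F T" "\<And>e. e \<notin> F \<Longrightarrow> d e = 0"
    and "\<And>S. tight_steiner F T S \<Longrightarrow> (\<Sum>e\<in>cut ends S. d e) = 0"
  shows "d e = (0 :: real)"
  using assms unfolding cactus_unique_def by blast

text \<open>A bridge is a tight Steiner cut by itself. A cycle is divided into at least three arcs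
  by nodes that are attached or terminals, and two edges from different arcs form a tight Steiner
  cut.\<close>

lemma cactus_unique_if_terminals:
  assumes F: "edge_disjoint_cycles F" "connected_spanning ends F" "2 \<le> CARD('v)"
    and T: "cactus_terminals F T"
  shows "cactus_unique F T"
  unfolding cactus_unique_def
proof (intro allI impI)
  fix d :: "'e \<Rightarrow> real" and e
  assume d0: "\<forall>e. e \<notin> F \<longrightarrow> d e = 0"
    and kill: "\<forall>S. tight_steiner F T S \<longrightarrow> (\<Sum>e\<in>cut ends S. d e) = 0"
  have sum_d: "(\<Sum>e\<in>cut ends S. d e) = (\<Sum>e\<in>cut ends S \<inter> F. d e)" for S
    using d0 by (intro sum_cut_support) auto
  have sum_c: "(\<Sum>e\<in>cut ends S. cactus_vector ends F $ e) = (\<Sum>e\<in>cut ends S \<inter> F. cactus_vector ends F $ e)" for S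
    by (intro sum_cut_support cactus_vector_outside)
  show "d e = 0"
  proof (cases "e \<in> F")
    case eF: True
    show ?thesis
    proof (cases "\<exists>C\<in>cycles ends F. e \<in> C")
      case False
      obtain a b where ab: "ends e = {a, b}" by (rule endsE)
      obtain S where S: "a \<in> S" "b \<notin> S" "cut ends S \<inter> F = {e}"
        using bridge_cut[OF eF _ ab] False by blast
      have "S \<inter> T \<noteq> {}" using S by (intro terminal_in_bridge_side[OF F T]) auto
      moreover have "- S \<inter> T \<noteq> {}"
        using S by (intro terminal_in_bridge_side[OF F T, of _ e]) (auto simp: cut_Compl)
      moreover have "(\<Sum>e\<in>cut ends S. cactus_vector ends F $ e) = 2"
        unfolding sum_c S(3) using cactus_vector_bridge[OF eF] False by simp
      ultimately have "tight_steiner F T S" by (auto simp: tight_steiner_def)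
      then have "(\<Sum>e\<in>cut ends S. d e) = 0" using kill by blast
      then show ?thesis unfolding sum_d S(3) by simp
    next
      case True
      then obtain C where C: "C \<in> cycles ends F" "e \<in> C" by blast
      have cyc: "is_cycle ends C" by (rule cyclesD(1)[OF C(1)])
      \<comment> \<open>A side of a two-edge cut through \<open>C\<close> meets \<open>T\<close> as
        soon as it contains one of these nodes, by \<open>terminal_in_arc\<close>.\<close>
      define R where "R = {v \<in> cycle_nodes ends C. attached F C v \<or> v \<in> T}"
      have "R = {v. attached F C v} \<union> {v \<in> T \<inter> cycle_nodes ends C. \<not> attached F C v}"
        by (auto simp: R_def attached_def)
      then have "card R = card {v. attached F C v} + card {v \<in> T \<inter> cycle_nodes ends C. \<not> attached F C v}"
        by (simp only:) (rule card_Un_disjoint, auto)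
      moreover have "defect ends F C \<le> card {v \<in> T \<inter> cycle_nodes ends C. \<not> attached F C v}"
        using T C unfolding cactus_terminals_def by blast
      ultimately have R3: "3 \<le> card R" by (simp add: defect_def cycle_degree_eq)
      then have "R \<noteq> {}" by auto
      then obtain r where r: "r \<in> R" by blast
      then obtain n x g where c: "cyclic C n x g" and x0: "x 0 = r"
        using cyclic_from_node[OF cyc, of r] by (auto simp: R_def)
      have "2 \<le> card (R - {r})" using R3 r by simp
      then obtain Y where Y: "Y \<subseteq> R - {r}" "card Y = 2" by (meson obtain_subset_with_card_n)
      then obtain u v where uv: "u \<in> R" "v \<in> R" "u \<noteq> v" "u \<noteq> r" "v \<noteq> r" by (auto simp: card_2_iff)
      obtain i1 where i1: "i1 < n" "x i1 = u" using cyclic_node_lt[OF c, of u] uv by (auto simp: R_def)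
      obtain i2 where i2: "i2 < n" "x i2 = v" using cyclic_node_lt[OF c, of v] uv by (auto simp: R_def)
      have "i1 \<noteq> i2" using i1 i2 uv by metis
      moreover have "i1 \<noteq> 0" "i2 \<noteq> 0" using i1 i2 uv x0 by metis+
      ultimately consider "0 < i1" "i1 < i2" | "0 < i2" "i2 < i1" by linarith
      then obtain j k where jk: "0 < j" "j < k" "k < n" "x j \<in> R" "x k \<in> R"
        using i1 i2 uv(1,2) by cases blast+
      have x0R: "x 0 \<in> R" using x0 r by simp
      have gC: "g i \<in> C" for i using c by (auto simp: cyclic_def)
      have pair: "d (g p) + d (g q) = 0"
        if pq: "p < q" "q < n" and m1: "p < m1" "m1 \<le> q" "x m1 \<in> R"
          and m2: "m2 \<le> p \<or> q < m2" "m2 < n" "x m2 \<in> R" for p q m1 m2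
      proof -
        have ne: "g p \<noteq> g q" using cyclic_edge_eq[OF c, of p q] pq by simp
        obtain S where S: "cut ends S \<inter> F = {g p, g q}" by (rule cycle_pair_cut[OF F(1) C(1) gC gC ne])
        have S': "cut ends (- S) \<inter> F = {g p, g q}" using S by (simp add: cut_Compl)
        have "cut ends S \<inter> C = {g p, g q}" using S cyclesD(2)[OF C(1)] gC by blast
        then have sides: "(x m1 \<in> S) \<noteq> (x m2 \<in> S)"
          by (rule cyclic_pair_sides[OF c pq _ m1(1,2) m2(1,2)])
        have RS: "S' \<inter> T \<noteq> {}" if "cut ends S' \<inter> F = {g p, g q}" "y \<in> S'" "y \<in> R" for S' y
          using terminal_in_arc[OF F T C(1) gC that(1,2)] that(3) by (auto simp: R_def)
        have "S \<inter> T \<noteq> {}" "- S \<inter> T \<noteq> {}"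
          using sides RS[OF S] RS[OF S'] m1(3) m2(3) by blast+
        moreover have "(\<Sum>e\<in>cut ends S. cactus_vector ends F $ e) = 2"
          unfolding sum_c S using ne cactus_vector_cycle[OF C(1) gC] by simp
        ultimately have "tight_steiner F T S" by (auto simp: tight_steiner_def)
        then have "(\<Sum>e\<in>cut ends S. d e) = 0" using kill by blast
        then show ?thesis unfolding sum_d S using ne by simp
      qed
      \<comment> \<open>The nodes with indices 0, \<open>j\<close>, \<open>k\<close> bound three
        arcs. Edges in different arcs have opposite values, which for three arcs forces
        zero.\<close>
      have 1: "d (g p) + d (g q) = 0" if "p < j" "j \<le> q" "q < k" for p q
        using pair[of p q j k] that jk by auto
      have 2: "d (g q) + d (g s) = 0" if "j \<le> q" "q < k" "k \<le> s" "s < n" for q s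
        using pair[of q s k 0] that jk x0R by auto
      have 3: "d (g p) + d (g s) = 0" if "p < j" "k \<le> s" "s < n" for p s
        using pair[of p s j 0] that jk x0R by auto
      have z: "d (g 0) = 0" "d (g j) = 0" "d (g k) = 0"
        using 1[of 0 j] 2[of j k] 3[of 0 k] jk by auto
      obtain i where i: "i < n" "g i = e" by (rule cyclic_edge_lt[OF c C(2)])
      consider "i < j" | "j \<le> i" "i < k" | "k \<le> i" by linarith
      then have "d (g i) = 0" using 1[of i j] 2[of i k] 3[of 0 i] z i(1) jk by cases auto
      then show ?thesis using i by simp
    qed
  qed (use d0 in blast)
qed

text \<open>The edge at the leaf must lie in a tight Steiner cut, or it could be perturbed alone.
  Its coefficient 2 uses up that cut, so one side is just the leaf.\<close>

lemma terminal_if_leaf: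
  assumes F: "connected_spanning ends F" "2 \<le> CARD('v)"
    and U: "cactus_unique F T" and v: "v \<in> leaves ends F"
  shows "v \<in> T"
proof -
  obtain e where e: "incident F v = {e}" using v by (auto simp: leaves_eq card_1_singleton_iff)
  have eF: "e \<in> F" and ve: "v \<in> ends e" using e by (auto simp: incident_def)
  have bridge: "e \<notin> C" if "C \<in> cycles ends F" for C
    using leaf_not_on_cycle[OF that v] ve by (auto simp: cycle_nodes_def)
  have "\<exists>S. tight_steiner F T S \<and> e \<in> cut ends S"
  proof (rule ccontr)
    assume no: "\<not> ?thesis"
    define d :: "'e \<Rightarrow> real" where "d f = (if f = e then 1 else 0)" for f
    have "d e = 0"
    proof (rule cactus_uniqueD[OF U])
      show "(\<Sum>f\<in>cut ends S. d f) = 0" if "tight_steiner F T S" for S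
        using no that by (intro sum.neutral) (auto simp: d_def)
      show "d f = 0" if "f \<notin> F" for f using that eF by (auto simp: d_def)
    qed
    then show False by (simp add: d_def)
  qed
  then obtain S where S: "tight_steiner F T S" "e \<in> cut ends S" by blast
  have only: "cut ends S \<inter> F = {e}"
  proof (rule ccontr)
    assume "\<not> ?thesis"
    then obtain f where f: "f \<in> cut ends S" "f \<in> F" "f \<noteq> e" using S(2) eF by blast
    have "(\<Sum>h\<in>{e, f}. cactus_vector ends F $ h) \<le> (\<Sum>h\<in>cut ends S. cactus_vector ends F $ h)"
      using S(2) f cactus_vector_nonneg by (intro sum_mono2) auto
    then show False
      using S(1) f cactus_vector_ge_1[OF f(2)] cactus_vector_bridge[OF eF bridge]
      by (simp add: tight_steiner_def)
  qed
  have sing: "S' = {v}" if S': "v \<in> S'" "cut ends S' \<inter> F = {e}" for S'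
  proof (rule ccontr)
    assume "S' \<noteq> {v}"
    then have "S' - {v} \<noteq> {}" "S' - {v} \<noteq> UNIV" using S'(1) by auto
    then obtain f where f: "f \<in> F" "f \<in> cut ends (S' - {v})" by (rule connected_cut[OF F(1)])
    obtain a b where ab: "ends f = {a, b}" by (rule endsE)
    show False
    proof (cases "f = e")
      case True
      then have "v \<in> {a, b}" "f \<in> cut ends S'" using ve ab S'(2) by auto
      then show False using f(2) cut_iff[OF ab] S'(1) by auto
    next
      case False
      then have "v \<notin> {a, b}" using e f(1) ab by (auto simp: incident_def)
      then have "f \<in> cut ends S'" using f(2) cut_iff[OF ab] by auto
      then show False using S'(2) f(1) False by blast
    qed
  qed
  show ?thesis
  proof (cases "v \<in> S")
    case True
    then have "S = {v}" using sing only by blast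
    then show ?thesis using S(1) by (auto simp: tight_steiner_def)
  next
    case False
    then have eq: "- S = {v}" using sing[of "- S"] only by (simp add: cut_Compl)
    obtain t where t: "t \<in> T" "t \<notin> S" using S(1) unfolding tight_steiner_def by blast
    then have "t \<in> - S" by simp
    then have "t = v" unfolding eq by simp
    then show ?thesis using t by simp
  qed
qed

text \<open>Otherwise some edge leaves \<open>S\<close> minus the nodes of \<open>C\<close>. If it
  ends in \<open>S\<close>, that end is an attached node of \<open>C\<close>; if not, it lies in the
  cut of \<open>S\<close> and hence in \<open>C\<close>, though one of its ends does not.\<close>

lemma arc_meets_relevant:
  assumes F: "connected_spanning ends F" and C: "C \<in> cycles ends F"
    and S: "cut ends S \<inter> F \<subseteq> C" and t: "t \<in> S" "t \<in> T"
  shows "\<exists>v\<in>S. v \<in> cycle_nodes ends C \<and> (attached F C v \<or> v \<in> T)"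
proof (rule ccontr)
  assume no: "\<not> ?thesis"
  let ?N = "cycle_nodes ends C"
  have "3 \<le> card ?N" by (rule card_cycle_nodes_ge_3[OF cyclesD(1)[OF C]])
  then have "?N \<noteq> {}" by auto
  have "S - ?N \<noteq> {}" "S - ?N \<noteq> UNIV" using no t \<open>?N \<noteq> {}\<close> by auto
  then obtain h where h: "h \<in> F" "h \<in> cut ends (S - ?N)" by (rule connected_cut[OF F])
  obtain y u where yu: "ends h = {y, u}" "y \<in> S - ?N" "u \<notin> S - ?N" by (rule cut_sides[OF h(2)])
  show False
  proof (cases "u \<in> S")
    case True
    then have "attached F C u"
      using yu h(1) by (auto simp: attached_def adjacent_def insert_commute)
    then show False using no True yu(3) by blast
  next
    case False
    then have "h \<in> cut ends S" using yu cut_iff[OF yu(1)] by blast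
    then have "h \<in> C" using S h(1) by blast
    then show False using yu(1,2) by (auto simp: cycle_nodes_def)
  qed
qed

text \<open>With fewer such terminals, at most two nodes of \<open>C\<close> are attached or
  terminals, and every tight Steiner cut through \<open>C\<close> separates the same two nodes.
  Opposite values on the two arcs between them then contradict uniqueness.\<close>

lemma defect_le_if_unique:
  assumes F: "edge_disjoint_cycles F" "connected_spanning ends F"
    and U: "cactus_unique F T" and C: "C \<in> cycles ends F"
  shows "defect ends F C \<le> card {v \<in> T \<inter> cycle_nodes ends C. \<not> attached F C v}"
proof (rule ccontr)
  assume lt: "\<not> ?thesis"
  have cyc: "is_cycle ends C" by (rule cyclesD(1)[OF C])
  define R where "R = {v \<in> cycle_nodes ends C. attached F C v \<or> v \<in> T}"
  have "R = {v. attached F C v} \<union> {v \<in> T \<inter> cycle_nodes ends C. \<not> attached F C v}"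
    by (auto simp: R_def attached_def)
  then have "card R \<le> card {v. attached F C v} + card {v \<in> T \<inter> cycle_nodes ends C. \<not> attached F C v}"
    by (metis card_Un_le)
  then have R2: "card R \<le> 2" using lt by (simp add: defect_def cycle_degree_eq)
  have tight: "\<exists>e f. e \<noteq> f \<and> e \<in> C \<and> f \<in> C \<and> cut ends S \<inter> F = {e, f}"
    if S: "tight_steiner F T S" "cut ends S \<inter> C \<noteq> {}" for S
  proof -
    obtain e where e: "e \<in> C" "e \<in> cut ends S" using S(2) by blast
    obtain f where f: "f \<in> C" "f \<in> cut ends S" "f \<noteq> e" by (rule cut_cycle_other[OF cyc e])
    have "cut ends S \<inter> F \<subseteq> {e, f}"
    proof
      fix h
      assume h: "h \<in> cut ends S \<inter> F"
      show "h \<in> {e, f}"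
      proof (rule ccontr)
        assume n: "h \<notin> {e, f}"
        have "(\<Sum>i\<in>{e, f, h}. cactus_vector ends F $ i) \<le> (\<Sum>i\<in>cut ends S. cactus_vector ends F $ i)"
          using e f h cactus_vector_nonneg by (intro sum_mono2) auto
        moreover have "e \<noteq> f" "e \<noteq> h" "f \<noteq> h" using f(3) n by auto
        ultimately show False
          using S(1) cactus_vector_ge_1[of h F] h cactus_vector_cycle[OF C e(1)]
            cactus_vector_cycle[OF C f(1)] by (simp add: tight_steiner_def)
      qed
    qed
    moreover have "{e, f} \<subseteq> cut ends S \<inter> F" using e f cyclesD(2)[OF C] by auto
    ultimately have "cut ends S \<inter> F = {e, f}" by (rule subset_antisym)
    then show ?thesis using e f by metis
  qed
  have both: "S \<inter> R \<noteq> {} \<and> R - S \<noteq> {}"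
    if S: "tight_steiner F T S" "cut ends S \<inter> C \<noteq> {}" for S
  proof -
    obtain e f where "e \<in> C" "f \<in> C" "cut ends S \<inter> F = {e, f}" using tight[OF S] by blast
    then have sub: "cut ends S \<inter> F \<subseteq> C" by simp
    then have sub': "cut ends (- S) \<inter> F \<subseteq> C" by (simp add: cut_Compl)
    obtain t t' where "t \<in> S" "t \<in> T" "t' \<in> - S" "t' \<in> T"
      using S(1) by (auto simp: tight_steiner_def)
    then show ?thesis
      using arc_meets_relevant[OF F(2) C sub] arc_meets_relevant[OF F(2) C sub']
      unfolding R_def by blast
  qed
  \<comment> \<open>If no tight Steiner cut meets \<open>C\<close>, any two nodes serve.\<close>
  have "\<exists>y z. y \<noteq> z \<and> y \<in> cycle_nodes ends C \<and> z \<in> cycle_nodes ends C \<and>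
    (\<forall>S. tight_steiner F T S \<longrightarrow> cut ends S \<inter> C \<noteq> {} \<longrightarrow> (y \<in> S) \<noteq> (z \<in> S))"
  proof (cases "\<exists>S. tight_steiner F T S \<and> cut ends S \<inter> C \<noteq> {}")
    case True
    then obtain S where S: "tight_steiner F T S" "cut ends S \<inter> C \<noteq> {}" by blast
    obtain y z where yz: "y \<in> S" "y \<in> R" "z \<in> R" "z \<notin> S" using both[OF S] by blast
    then have ne: "y \<noteq> z" by blast
    have R: "{y, z} = R"
      using R2 yz ne by (intro card_seteq) auto
    have "(y \<in> S') \<noteq> (z \<in> S')" if S': "tight_steiner F T S'" "cut ends S' \<inter> C \<noteq> {}" for S'
    proof -
      obtain p q where "p \<in> S'" "p \<in> {y, z}" "q \<in> {y, z}" "q \<notin> S'"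
        using both[OF S'] R by blast
      then show ?thesis by auto
    qed
    moreover have "y \<in> cycle_nodes ends C" "z \<in> cycle_nodes ends C" using yz by (auto simp: R_def)
    ultimately show ?thesis using ne by blast
  next
    case False
    obtain n x g where c: "cyclic C n x g" by (rule cyclic_exists[OF cyc])
    then have "x 0 \<noteq> x 1" by (simp add: cyclic_def)
    then show ?thesis using cycle_nodes_cyclic[OF c] False by blast
  qed
  then obtain y z where yz: "y \<noteq> z" "y \<in> cycle_nodes ends C" "z \<in> cycle_nodes ends C"
    "\<And>S. tight_steiner F T S \<Longrightarrow> cut ends S \<inter> C \<noteq> {} \<Longrightarrow> (y \<in> S) \<noteq> (z \<in> S)" by blast
  obtain n x g where c: "cyclic C n x g" and x0: "x 0 = y" by (rule cyclic_from_node[OF cyc yz(2)])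
  obtain m where m: "m < n" "x m = z" by (rule cyclic_node_lt[OF c yz(3)])
  have m0: "0 < m" using m x0 yz(1) by (cases m) auto
  have "x i = x j \<longleftrightarrow> i mod n = j mod n" for i j using c by (simp add: cyclic_def)
  then have xn: "x n = x 0" by simp
  \<comment> \<open>Each tight Steiner cut through \<open>C\<close> takes one edge from either
    arc.\<close>
  define d :: "'e \<Rightarrow> real" where "d e = (if e \<in> g ` {..<m} then 1 else if e \<in> C then - 1 else 0)" for e
  have gC: "g i \<in> C" for i using c by (auto simp: cyclic_def)
  have dF: "d e = 0" if "e \<notin> F" for e using that gC cyclesD(2)[OF C] by (auto simp: d_def)
  have dS: "(\<Sum>e\<in>cut ends S. d e) = 0" if S: "tight_steiner F T S" for S
  proof (cases "cut ends S \<inter> C = {}")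
    case True
    then show ?thesis using gC by (intro sum.neutral) (auto simp: d_def)
  next
    case False
    have sep: "(x 0 \<in> S) \<noteq> (x m \<in> S)" using yz(4)[OF S False] x0 m by simp
    obtain k where k: "k < m" "g k \<in> cut ends S" using cyclic_crossing[OF c _ sep] by auto
    have "(x m \<in> S) \<noteq> (x n \<in> S)" using sep xn by simp
    then obtain k' where k': "m \<le> k'" "k' < n" "g k' \<in> cut ends S"
      using cyclic_crossing[OF c, of m n S] m by auto
    have ne: "g k \<noteq> g k'" using cyclic_edge_eq[OF c, of k k'] k k' m by simp
    obtain e f where ef: "cut ends S \<inter> F = {e, f}" using tight[OF S False] by blast
    then have "g k \<in> {e, f}" "g k' \<in> {e, f}" using k k' gC cyclesD(2)[OF C] by blast+
    then have eq: "cut ends S \<inter> F = {g k, g k'}" using ef ne by auto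
    have "g k' \<notin> g ` {..<m}"
    proof
      assume "g k' \<in> g ` {..<m}"
      then obtain i where "i < m" "g k' = g i" by auto
      then show False using cyclic_edge_eq[OF c, of k' i] k' m by simp
    qed
    then have "d (g k) = 1" "d (g k') = - 1" using k gC by (auto simp: d_def)
    then show ?thesis using sum_cut_support[of F d S] dF eq ne by simp
  qed
  have "d (g 0) = 0" by (rule cactus_uniqueD[OF U dF dS])
  then show False using m0 by (simp add: d_def)
qed

text \<open>All edges at a node of \<open>C\<close> without outside neighbours belong to
  \<open>C\<close> by \<open>no_chord\<close>. So the terminals counted for different cycles are
  distinct, and none of them is a leaf.\<close>

lemma cactus_size_le_if_unique:
  assumes F: "edge_disjoint_cycles F" "connected_spanning ends F" "2 \<le> CARD('v)"
    and U: "cactus_unique F T"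
  shows "card (leaves ends F) + (\<Sum>C\<in>cycles ends F. defect ends F C) \<le> card T"
proof -
  let ?N = "\<lambda>C. {v \<in> T \<inter> cycle_nodes ends C. \<not> attached F C v}"
  have disj: "?N C \<inter> ?N D = {}" if CD: "C \<in> cycles ends F" "D \<in> cycles ends F" "C \<noteq> D" for C D
  proof (rule ccontr)
    assume "?N C \<inter> ?N D \<noteq> {}"
    then obtain v where v: "v \<in> cycle_nodes ends C" "v \<in> cycle_nodes ends D" "\<not> attached F C v" by blast
    obtain e where e: "e \<in> D" "v \<in> ends e" using v(2) by (auto simp: cycle_nodes_def)
    obtain u where u: "ends e = {v, u}" by (rule endsE_at[OF e(2)])
    have eF: "e \<in> F" using e(1) cyclesD(2)[OF CD(2)] by blast
    have "u \<in> cycle_nodes ends C"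
      using v u eF by (auto simp: attached_def adjacent_def)
    then have "ends e \<subseteq> cycle_nodes ends C" using u v(1) by simp
    then have "e \<in> C" by (rule no_chord[OF F(1) CD(1) eF])
    then show False using F(1) CD e(1) unfolding edge_disjoint_cycles_def by blast
  qed
  have "(\<Sum>C\<in>cycles ends F. defect ends F C) \<le> (\<Sum>C\<in>cycles ends F. card (?N C))"
    by (intro sum_mono defect_le_if_unique F U)
  also have "\<dots> = card (\<Union>C\<in>cycles ends F. ?N C)"
    by (rule card_UN_disjoint[symmetric]) (use disj in auto)
  also have "card (leaves ends F) + \<dots> = card (leaves ends F \<union> (\<Union>C\<in>cycles ends F. ?N C))"
    by (rule card_Un_disjoint[symmetric]) (use leaf_not_on_cycle in auto)
  also have "\<dots> \<le> card T"
    by (rule card_mono) (use terminal_if_leaf[OF F(2,3) U] in auto)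
  finally show ?thesis by simp
qed

subsection \<open>Half-integral weights are cacti\<close>

definition node_weight :: "('e \<Rightarrow> real) \<Rightarrow> 'v \<Rightarrow> 'v \<Rightarrow> real" where
  "node_weight x u v = (\<Sum>e\<in>UNIV. if ends e = {u, v} then x e else 0)"

lemma node_weight_ends: "ends e = {u, v} \<Longrightarrow> node_weight x u v = x e"
proof -
  assume e: "ends e = {u, v}"
  have "(ends f = {u, v}) = (f = e)" for f using ends_inj[of f e] e by auto
  then show ?thesis by (simp add: node_weight_def)
qed

lemma node_weight_no_edge: "(\<And>e. ends e \<noteq> {u, v}) \<Longrightarrow> node_weight x u v = 0"
  by (simp add: node_weight_def)

lemma node_weight_commute: "node_weight x u v = node_weight x v u"
  by (simp add: node_weight_def insert_commute)

lemma cutval_node_weight: "cutval UNIV (node_weight x) S = (\<Sum>e\<in>cut ends S. x e)"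
proof -
  have "cutval UNIV (node_weight x) S
      = (\<Sum>u\<in>S. \<Sum>v\<in>UNIV - S. \<Sum>e\<in>UNIV. if ends e = {u, v} then x e else 0)"
    by (simp add: cutval_def weight_def node_weight_def)
  also have "\<dots> = (\<Sum>u\<in>S. \<Sum>e\<in>UNIV. \<Sum>v\<in>UNIV - S. if ends e = {u, v} then x e else 0)"
    by (intro sum.cong refl sum.swap)
  also have "\<dots> = (\<Sum>e\<in>UNIV. \<Sum>u\<in>S. \<Sum>v\<in>UNIV - S. if ends e = {u, v} then x e else 0)"
    by (rule sum.swap)
  also have "\<dots> = (\<Sum>e\<in>UNIV. if e \<in> cut ends S then x e else 0)"
  proof (rule sum.cong[OF refl])
    fix e
    obtain a b where ab: "ends e = {a, b}" "a \<noteq> b" by (rule endsE)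
    have "(\<Sum>u\<in>S. \<Sum>v\<in>UNIV - S. if ends e = {u, v} then x e else 0)
        = cutval UNIV (edge_fn a b (x e)) S"
      unfolding cutval_def weight_def edge_fn_def ab(1) by (intro sum.cong refl) auto
    then show "(\<Sum>u\<in>S. \<Sum>v\<in>UNIV - S. if ends e = {u, v} then x e else 0)
        = (if e \<in> cut ends S then x e else 0)"
      using cutval_edge_fn[of UNIV a b S "x e"] ab cut_iff[OF ab(1), of S] by auto
  qed
  also have "\<dots> = (\<Sum>e\<in>cut ends S. x e)" by (simp add: sum.If_cases)
  finally show ?thesis .
qed

lemma cut_weights_node_weight:
  assumes "\<And>e. 0 \<le> x e" "\<And>S. S \<noteq> {} \<Longrightarrow> S \<noteq> UNIV \<Longrightarrow> 1 \<le> (\<Sum>e\<in>cut ends S. x e)"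
  shows "cut_weights UNIV (node_weight x)"
proof
  show "node_weight x u u = 0" for u
    using ends_distinct[of _ u u] by (intro node_weight_no_edge) blast
  show "0 \<le> node_weight x u v" for u v
    using assms(1) by (auto simp: node_weight_def intro: sum_nonneg)
qed (use assms(2) in \<open>auto simp: node_weight_commute cutval_node_weight\<close>)

text \<open>Passage from edge vectors to node functions: a supported function is symmetric and zero
  off the edges, hence of the form \<open>node_weight y\<close>.\<close>

lemma steiner_vertex_node_weight:
  assumes x: "\<And>e. 0 \<le> x e" "\<And>S. S \<noteq> {} \<Longrightarrow> S \<noteq> UNIV \<Longrightarrow> 1 \<le> (\<Sum>e\<in>cut ends S. x e)"
    and unique: "\<And>(y :: 'e \<Rightarrow> real) e. (\<And>e. x e = 0 \<Longrightarrow> y e = 0) \<Longrightarrow>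
      (\<And>S. T \<inter> S \<noteq> {} \<Longrightarrow> T - S \<noteq> {} \<Longrightarrow> (\<Sum>e\<in>cut ends S. x e) = 1 \<Longrightarrow> (\<Sum>e\<in>cut ends S. y e) = 0)
      \<Longrightarrow> y e = 0"
  shows "steiner_vertex UNIV (node_weight x) T"
proof -
  interpret cut_weights UNIV "node_weight x" by (rule cut_weights_node_weight[OF x])
  show ?thesis
  proof
    fix d u v
    assume d: "supported d" and kill: "\<And>S. tight S \<Longrightarrow> separates S T \<Longrightarrow> cutval UNIV d S = 0"
    have "\<exists>r. \<forall>a b. ends e = {a, b} \<longrightarrow> d a b = r" for e
    proof -
      obtain a b where ab: "ends e = {a, b}" by (rule endsE)
      then show ?thesis
        using supportedD(1)[OF d] by (intro exI[of _ "d a b"]) (auto simp: doubleton_eq_iff)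
    qed
    then obtain y where y: "\<And>e a b. ends e = {a, b} \<Longrightarrow> d a b = y e" by metis
    have eq: "d = node_weight y"
    proof (intro ext)
      fix a b
      show "d a b = node_weight y a b"
      proof (cases "\<exists>e. ends e = {a, b}")
        case True
        then obtain e where "ends e = {a, b}" by blast
        then show ?thesis using y node_weight_ends by metis
      next
        case False
        then have "node_weight x a b = 0" "node_weight y a b = 0"
          by (auto intro: node_weight_no_edge)
        then show ?thesis using supportedD(2)[OF d] by metis
      qed
    qed
    have y0: "y e = 0" for e
    proof (rule unique[of y e])
      show "y e = 0" if "x e = 0" for e
      proof -
        obtain a b where ab: "ends e = {a, b}" by (rule endsE)
        then have "node_weight x a b = 0" using that node_weight_ends by metis
        then show ?thesis using supportedD(2)[OF d] y[OF ab] by metis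
      qed
      show "(\<Sum>e\<in>cut ends S. y e) = 0"
        if "T \<inter> S \<noteq> {}" "T - S \<noteq> {}" "(\<Sum>e\<in>cut ends S. x e) = 1" for S
        using kill[of S] that eq by (auto simp: tight_def separates_def cutval_node_weight)
    qed
    show "d u v = 0" unfolding eq node_weight_def by (intro sum.neutral) (simp add: y0)
  qed simp
qed

text \<open>Edges of the support weigh at least 1/2, so a tight cut with two of them consists of
  just these, of weight 1/2 each. Applied to tight cuts that separate the ends of an edge, this
  gives 1/2 on cycles and 1 on bridges.\<close>

lemma cactus_of_half_cactus:
  assumes x: "\<And>e. 0 \<le> x e" "\<And>S. S \<noteq> {} \<Longrightarrow> S \<noteq> UNIV \<Longrightarrow> 1 \<le> (\<Sum>e\<in>cut ends S. x e)"
    and hc: "half_cactus UNIV (node_weight x)" and F: "F = {e. x e \<noteq> 0}"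
  shows "connected_spanning ends F" "edge_disjoint_cycles F"
    "\<And>e. x e = cactus_vector ends F $ e / 2"
proof -
  interpret cut_weights UNIV "node_weight x" by (rule cut_weights_node_weight[OF x])
  have sum_F: "(\<Sum>e\<in>cut ends S. x e) = (\<Sum>e\<in>cut ends S \<inter> F. x e)" for S
    by (intro sum_cut_support) (simp add: F)
  show "connected_spanning ends F"
    unfolding connected_spanning_def
  proof (intro allI)
    fix u v
    let ?R = "{v. (adjacent ends F)\<^sup>*\<^sup>* u v}"
    have "cut ends ?R \<inter> F = {}" using reachable_cut[of _ F u] by blast
    then have "(\<Sum>e\<in>cut ends ?R. x e) = 0" unfolding sum_F by simp
    moreover have "u \<in> ?R" by simp
    ultimately have "?R = UNIV" using x(2)[of ?R] by force
    then show "(adjacent ends F)\<^sup>*\<^sup>* u v" by blast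
  qed
  have ge: "1 / 2 \<le> x e" if "e \<in> F" for e
  proof -
    obtain a b where "ends e = {a, b}" by (rule endsE)
    then have "2 * x e \<in> \<int>" using hc node_weight_ends unfolding half_cactus_def by metis
    then obtain k where k: "2 * x e = of_int k" by (auto elim: Ints_cases)
    have "0 < x e" using that x(1)[of e] by (simp add: F order_less_le)
    then have "0 < k" using k by simp
    then have "1 \<le> k" by simp
    then have "(1::real) \<le> of_int k" by simp
    then show ?thesis using k by linarith
  qed
  have sep: "\<exists>S. u \<in> S \<and> v \<notin> S \<and> (\<Sum>e\<in>cut ends S. x e) = 1" if "u \<noteq> v" for u v
    using hc that unfolding half_cactus_def by (simp add: cutval_node_weight)
  have half: "x e = 1 / 2 \<and> x f = 1 / 2 \<and> cut ends S \<inter> F = {e, f}"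
    if S: "(\<Sum>e\<in>cut ends S. x e) = 1" and ef: "e \<in> cut ends S" "f \<in> cut ends S" "e \<in> F" "f \<in> F" "e \<noteq> f"
    for e f S
  proof -
    have le: "(\<Sum>h\<in>A. x h) \<le> 1" if "A \<subseteq> cut ends S" for A
      using sum_mono2[OF finite that, of x] x(1) S by simp
    have "x e + x f \<le> 1" using le[of "{e, f}"] ef by simp
    then have "x e = 1 / 2" "x f = 1 / 2" using ge[OF ef(3)] ge[OF ef(4)] by linarith+
    moreover have "h \<in> {e, f}" if h: "h \<in> cut ends S" "h \<in> F" for h
    proof (rule ccontr)
      assume "h \<notin> {e, f}"
      then have "x e + (x f + x h) \<le> 1" using le[of "{e, f, h}"] ef h by auto
      then show False using ge[OF ef(3)] ge[OF ef(4)] ge[OF h(2)] by linarith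
    qed
    then have "cut ends S \<inter> F = {e, f}" using ef by auto
    ultimately show ?thesis by blast
  qed
  have on_cycle: "x e = 1 / 2" if C: "C \<in> cycles ends F" "e \<in> C" for C e
  proof -
    obtain a b where ab: "ends e = {a, b}" "a \<noteq> b" by (rule endsE)
    obtain S where S: "a \<in> S" "b \<notin> S" "(\<Sum>e\<in>cut ends S. x e) = 1" using sep[OF ab(2)] by blast
    have e: "e \<in> cut ends S" using cut_iff[OF ab(1)] S by blast
    obtain f where "f \<in> C" "f \<in> cut ends S" "f \<noteq> e"
      by (rule cut_cycle_other[OF cyclesD(1)[OF C(1)] C(2) e])
    then show ?thesis using half[OF S(3) e, of f] cyclesD(2)[OF C(1)] C(2) by blast
  qed
  have off_cycle: "x e = 1" if e: "e \<in> F" "\<And>C. C \<in> cycles ends F \<Longrightarrow> e \<notin> C" for e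
  proof -
    obtain a b where ab: "ends e = {a, b}" "a \<noteq> b" by (rule endsE)
    obtain S where S: "a \<in> S" "b \<notin> S" "cut ends S \<inter> F = {e}" using bridge_cut[OF e ab(1)] by blast
    have "1 \<le> (\<Sum>e\<in>cut ends S. x e)" using S by (intro x(2)) auto
    then have "1 \<le> x e" unfolding sum_F S(3) by simp
    obtain S' where S': "a \<in> S'" "b \<notin> S'" "(\<Sum>e\<in>cut ends S'. x e) = 1" using sep[OF ab(2)] by blast
    have "e \<in> cut ends S'" using cut_iff[OF ab(1)] S' by blast
    then have "x e \<le> (\<Sum>e\<in>cut ends S'. x e)" using x(1) by (intro member_le_sum) auto
    then show ?thesis using S'(3) \<open>1 \<le> x e\<close> by simp
  qed
  show "x e = cactus_vector ends F $ e / 2" for e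
  proof (cases "e \<in> F")
    case True
    then show ?thesis using on_cycle[of _ e] off_cycle[OF True] by (auto simp: cactus_vector_def)
  next
    case False
    then show ?thesis by (simp add: cactus_vector_def F)
  qed
  \<comment> \<open>A tight set with \<open>y 1\<close> but without \<open>y 0\<close> is taken
    minimal. If its second cut edge \<open>h\<close> were not \<open>g 1\<close>, uncrossing with a
    tight set that separates \<open>y 1\<close> from the inner end \<open>p\<close> of
    \<open>h\<close> would make it smaller.\<close>
  have consecutive: "\<exists>S. cut ends S \<inter> F = {g 0, g 1}"
    if C: "C \<in> cycles ends F" and c: "cyclic C n y g" for C n y g
  proof -
    have n: "3 \<le> n" and ends: "\<And>i. ends (g i) = {y i, y (Suc i)}" and Cr: "C = range g"
      and y_eq: "\<And>i j. y i = y j \<longleftrightarrow> i mod n = j mod n"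
      using c by (auto simp: cyclic_def)
    have gF: "g i \<in> F" for i using Cr cyclesD(2)[OF C] by auto
    have y01: "y 1 \<noteq> y 0" using y_eq n by simp
    define P where "P S \<longleftrightarrow> y 1 \<in> S \<and> y 0 \<notin> S \<and> (\<Sum>e\<in>cut ends S. x e) = 1" for S
    have "\<exists>S. P S" using sep[OF y01] by (simp add: P_def)
    then obtain S where S: "P S" and min: "\<And>S'. P S' \<Longrightarrow> card S \<le> card S'"
      using ex_has_least_nat[of P _ card] by blast
    have g0: "g 0 \<in> cut ends S" using cut_iff[OF ends[of 0], of S] S by (simp add: P_def)
    have g01: "g 0 \<noteq> g 1" using cyclic_edge_eq[OF c, of 0 1] n by simp
    have S1: "(\<Sum>e\<in>cut ends S. x e) = 1" using S by (simp add: P_def)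
    show ?thesis
    proof (cases "g 1 \<in> cut ends S")
      case True
      then show ?thesis using half[OF S1 g0 True gF gF g01] by blast
    next
      case False
      obtain h where h: "h \<in> C" "h \<in> cut ends S" "h \<noteq> g 0"
        using cut_cycle_other[OF cyclesD(1)[OF C] _ g0] Cr by auto
      obtain p q where pq: "ends h = {p, q}" "p \<in> S" "q \<notin> S" by (rule cut_sides[OF h(2)])
      have "p \<noteq> y 1"
      proof
        assume p: "p = y 1"
        obtain k where k: "h = g k" using h(1) Cr by blast
        have "y 1 \<in> {y k, y (Suc k)}" using pq(1) p k ends[of k] by auto
        then have "1 mod n = k mod n \<or> Suc 0 mod n = Suc k mod n" using y_eq by auto
        then have "k mod n = 1 mod n \<or> k mod n = 0 mod n"
          using mod_add_right_cancel_nat[of 0 1 n k] by auto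
        then have "h = g 1 \<or> h = g 0" using cyclic_edge_eq[OF c] k by blast
        then show False using h False by blast
      qed
      then obtain S' where S': "y 1 \<in> S'" "p \<notin> S'" "(\<Sum>e\<in>cut ends S'. x e) = 1"
        using sep[of "y 1" p] by blast
      have u: "cutval UNIV (node_weight x) S + cutval UNIV (node_weight x) S'
          = cutval UNIV (node_weight x) (S \<inter> S') + cutval UNIV (node_weight x) (S \<union> S')
            + 2 * weight (node_weight x) (S - S') (S' - S)"
        by (rule cutval_uncross) (auto simp: node_weight_commute)
      \<comment> \<open>If the union is everything, its cut is empty and gives no lower bound. The
        edge \<open>h\<close> of weight 1/2 between the two differences, counted twice, replaces
        it.\<close>
      have "cutval UNIV (node_weight x) (S \<inter> S') \<le> 1"
      proof (cases "S \<union> S' = UNIV")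
        case True
        have "node_weight x p q = x h" by (rule node_weight_ends[OF pq(1)])
        also have "\<dots> = 1 / 2" by (rule on_cycle[OF C h(1)])
        finally have "1 / 2 = node_weight x p q" by simp
        also have "\<dots> \<le> weight (node_weight x) (S - S') (S' - S)"
          using pq S'(2) True by (intro weight_singleton_le w_nonneg) auto
        finally show ?thesis using u True S1 S'(3) by (simp add: cutval_node_weight)
      next
        case False
        then have "1 \<le> cutval UNIV (node_weight x) (S \<union> S')" using S'(1) by (intro cut_ge_1) auto
        moreover have "0 \<le> weight (node_weight x) (S - S') (S' - S)"
          by (rule weight_nonneg[OF w_nonneg])
        ultimately show ?thesis using u S1 S'(3) by (simp add: cutval_node_weight)
      qed
      moreover have "1 \<le> cutval UNIV (node_weight x) (S \<inter> S')"
        using S S'(1) by (intro cut_ge_1) (auto simp: P_def)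
      ultimately have "P (S \<inter> S')" using S S'(1) by (simp add: P_def cutval_node_weight)
      then have "card S \<le> card (S \<inter> S')" by (rule min)
      moreover have "S \<inter> S' \<subset> S" using pq(2) S'(2) by blast
      then have "card (S \<inter> S') < card S" by (intro psubset_card_mono) auto
      ultimately show ?thesis by simp
    qed
  qed
  \<comment> \<open>From a common edge onwards, \<open>D\<close> must cross each two-edge cut at
    consecutive edges of \<open>C\<close> twice, so it also takes the next edge of
    \<open>C\<close>.\<close>
  have sub: "C \<subseteq> D" if CD: "C \<in> cycles ends F" "D \<in> cycles ends F" "C \<inter> D \<noteq> {}" for C D
  proof
    fix f
    assume f: "f \<in> C"
    obtain e where e: "e \<in> C" "e \<in> D" using CD(3) by blast
    obtain n y g where c: "cyclic C n y g" and g0: "g 0 = e"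
      by (rule cyclic_from_edge[OF cyclesD(1)[OF CD(1)] e(1)])
    have gD: "g i \<in> D" for i
    proof (induction i)
      case (Suc i)
      obtain S where S: "cut ends S \<inter> F = {g i, g (Suc i)}"
        using consecutive[OF CD(1) cyclic_shift[OF c, of i]] by auto
      then have "g i \<in> cut ends S" by blast
      then obtain h where h: "h \<in> D" "h \<in> cut ends S" "h \<noteq> g i"
        using cut_cycle_other[OF cyclesD(1)[OF CD(2)] Suc] by blast
      then have "h \<in> {g i, g (Suc i)}" using S cyclesD(2)[OF CD(2)] by (metis IntI subsetD)
      then show ?case using h by auto
    qed (simp add: g0 e)
    then show "f \<in> D" using f c by (auto simp: cyclic_def)
  qed
  show "edge_disjoint_cycles F"
    unfolding edge_disjoint_cycles_def using sub by (metis Int_commute subset_antisym)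
qed

end

subsection \<open>Facets of Steiner cut dominants\<close>

lemma defines_facet_steiner_iff:
  fixes ends :: "'e::finite \<Rightarrow> 'v::finite set"
  assumes T: "2 \<le> card T" and \<gamma>: "0 < \<gamma>"
  shows "defines_facet (steiner_cut_dominant ends T) c \<gamma> \<longleftrightarrow> (\<forall>e. 0 \<le> c $ e) \<and>
    (\<forall>S. T \<inter> S \<noteq> {} \<longrightarrow> T - S \<noteq> {} \<longrightarrow> \<gamma> \<le> (\<Sum>e\<in>cut ends S. c $ e)) \<and>
    (\<forall>d :: 'e \<Rightarrow> real. (\<forall>e. c $ e = 0 \<longrightarrow> d e = 0) \<longrightarrow>
      (\<forall>S. T \<inter> S \<noteq> {} \<longrightarrow> T - S \<noteq> {} \<longrightarrow> (\<Sum>e\<in>cut ends S. c $ e) = \<gamma> \<longrightarrow> (\<Sum>e\<in>cut ends S. d e) = 0)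
      \<longrightarrow> (\<forall>e. d e = 0))"
proof -
  let ?K = "{incidence_vector (cut ends S) | S. T \<inter> S \<noteq> {} \<and> T - S \<noteq> {}}"
  have dom: "steiner_cut_dominant ends T = dominant ?K"
    by (simp add: steiner_cut_dominant_def dominant_def)
  have "?K \<subseteq> range (\<lambda>S. incidence_vector (cut ends S))" by blast
  then have fin: "finite ?K" by (rule finite_subset) simp
  have ne: "?K \<noteq> {}"
  proof -
    obtain Y where "Y \<subseteq> T" "card Y = 2" using obtain_subset_with_card_n[OF T] by blast
    then obtain a b where "a \<in> T" "b \<in> T" "a \<noteq> b" by (auto simp: card_2_iff)
    then have "incidence_vector (cut ends {a}) \<in> ?K" by blast
    then show ?thesis by blast
  qed
  have all_K: "(\<forall>k\<in>?K. P k) \<longleftrightarrow> (\<forall>S. T \<inter> S \<noteq> {} \<longrightarrow> T - S \<noteq> {} \<longrightarrow> P (incidence_vector (cut ends S)))" for P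
    by blast
  have vec: "(\<forall>d :: real ^ 'e. P (($) d) \<longrightarrow> Q (($) d) \<longrightarrow> d = 0) \<longleftrightarrow> (\<forall>d. P d \<longrightarrow> Q d \<longrightarrow> (\<forall>e. d e = 0))"
    for P Q :: "('e \<Rightarrow> real) \<Rightarrow> bool"
  proof
    assume l: "\<forall>d :: real ^ 'e. P (($) d) \<longrightarrow> Q (($) d) \<longrightarrow> d = 0"
    show "\<forall>d. P d \<longrightarrow> Q d \<longrightarrow> (\<forall>e. d e = 0)"
    proof (intro allI impI)
      fix d e
      assume "P d" "Q d"
      moreover have "($) (\<chi> e. d e) = d" by (rule ext) simp
      ultimately have "(\<chi> e. d e) = (0 :: real ^ 'e)" using l by metis
      then show "d e = 0" by (simp add: vec_eq_iff)
    qed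
  next
    assume r: "\<forall>d. P d \<longrightarrow> Q d \<longrightarrow> (\<forall>e. d e = 0)"
    then show "\<forall>d :: real ^ 'e. P (($) d) \<longrightarrow> Q (($) d) \<longrightarrow> d = 0" by (simp add: vec_eq_iff)
  qed
  show ?thesis
    unfolding dom defines_facet_dominant_iff[OF fin ne \<gamma>] all_K inner_incidence_vector
    by (subst vec[symmetric]) (rule refl)
qed

text \<open>The set of all nodes is a witness for \<open>LEAST\<close>, by the facet of the full cut
  dominant.\<close>

lemma steiner_degree_le_iff:
  assumes "defines_facet (cut_dominant ends) c \<gamma>" "2 \<le> CARD('v::finite)"
  shows "steiner_degree (ends :: 'e::finite \<Rightarrow> 'v set) c \<gamma> \<le> n \<longleftrightarrow>
    (\<exists>T. 2 \<le> card T \<and> card T \<le> n \<and> defines_facet (steiner_cut_dominant ends T) c \<gamma>)"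
proof
  let ?P = "\<lambda>\<tau>. \<exists>T. 2 \<le> card T \<and> card T = \<tau> \<and> defines_facet (steiner_cut_dominant ends T) c \<gamma>"
  have "?P CARD('v)" using assms by (auto simp: cut_dominant_def)
  then have "?P (steiner_degree ends c \<gamma>)" unfolding steiner_degree_def by (rule LeastI)
  then show "\<exists>T. 2 \<le> card T \<and> card T \<le> n \<and> defines_facet (steiner_cut_dominant ends T) c \<gamma>"
    if "steiner_degree ends c \<gamma> \<le> n"
    using that by auto
  show "steiner_degree ends c \<gamma> \<le> n"
    if ex: "\<exists>T. 2 \<le> card T \<and> card T \<le> n \<and> defines_facet (steiner_cut_dominant ends T) c \<gamma>"
  proof -
    obtain T where T: "2 \<le> card T" "card T \<le> n" "defines_facet (steiner_cut_dominant ends T) c \<gamma>"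
      using ex by blast
    then have "steiner_degree ends c \<gamma> \<le> card T"
      unfolding steiner_degree_def by (intro Least_le) blast
    then show ?thesis using T(2) by simp
  qed
qed

context simple_ends
begin

lemma defines_facet_scaled_cactus:
  assumes F: "edge_disjoint_cycles F" "connected_spanning ends F" "2 \<le> CARD('v)"
    and U: "cactus_unique F T" and T: "2 \<le> card T" and s: "0 < s"
    and c: "\<And>e. c $ e = s * cactus_vector ends F $ e"
  shows "defines_facet (steiner_cut_dominant ends T) c (2 * s)"
  unfolding defines_facet_steiner_iff[OF T mult_pos_pos[OF zero_less_numeral s]]
proof (intro conjI allI impI)
  have sum_c: "(\<Sum>e\<in>cut ends S. c $ e) = s * (\<Sum>e\<in>cut ends S. cactus_vector ends F $ e)" for S
    by (simp add: c sum_distrib_left)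
  show "0 \<le> c $ e" for e using s cactus_vector_nonneg by (simp add: c)
  show "2 * s \<le> (\<Sum>e\<in>cut ends S. c $ e)" if "T \<inter> S \<noteq> {}" "T - S \<noteq> {}" for S
  proof -
    have "S \<noteq> {}" "S \<noteq> UNIV" using that by auto
    then show ?thesis using cactus_vector_cut_ge[OF F(2)] s by (simp add: sum_c)
  qed
  show "d e = 0"
    if d: "\<forall>e. c $ e = 0 \<longrightarrow> d e = 0"
      and kill: "\<forall>S. T \<inter> S \<noteq> {} \<longrightarrow> T - S \<noteq> {} \<longrightarrow> (\<Sum>e\<in>cut ends S. c $ e) = 2 * s \<longrightarrow> (\<Sum>e\<in>cut ends S. d e) = 0"
    for d :: "'e \<Rightarrow> real" and e
  proof (rule cactus_uniqueD[OF U])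
    show "d e = 0" if "e \<notin> F" for e using d cactus_vector_outside[OF that] by (simp add: c)
    show "(\<Sum>e\<in>cut ends S. d e) = 0" if "tight_steiner F T S" for S
      using kill that by (simp add: tight_steiner_def sum_c)
  qed
qed

lemma cactus_unique_mono:
  assumes "cactus_unique F T" "T \<subseteq> T'"
  shows "cactus_unique F T'"
proof -
  have "tight_steiner F T S \<Longrightarrow> tight_steiner F T' S" for S
    using assms(2) by (auto simp: tight_steiner_def)
  then show ?thesis using assms(1) unfolding cactus_unique_def by blast
qed

text \<open>The factor \<open>s\<close> covers both families: 1/2 turns the cactus vector of a tree
  into its incidence vector, and 1 is for cacti.\<close>

lemma cactus_facet:
  assumes F: "edge_disjoint_cycles F" "connected_spanning ends F" "2 \<le> CARD('v)"
    and size: "card (leaves ends F) + (\<Sum>C\<in>cycles ends F. defect ends F C) \<le> n"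
    and s: "0 < s" and c: "\<And>e. c $ e = s * cactus_vector ends F $ e"
  shows "defines_facet (cut_dominant ends) c (2 * s)" "steiner_degree ends c (2 * s) \<le> n"
proof -
  obtain T where T: "cactus_terminals F T"
    "card T \<le> card (leaves ends F) + (\<Sum>C\<in>cycles ends F. defect ends F C)"
    by (rule cactus_terminals_exist)
  have U: "cactus_unique F T" by (rule cactus_unique_if_terminals[OF F T(1)])
  have T2: "2 \<le> card T"
    using cactus_size_le_if_unique[OF F U] card_cycles_le[OF F] by linarith
  have "defines_facet (steiner_cut_dominant ends UNIV) c (2 * s)"
    using F(3) by (intro defines_facet_scaled_cactus[OF F cactus_unique_mono[OF U] _ s c]) auto
  then show facet: "defines_facet (cut_dominant ends) c (2 * s)" by (simp add: cut_dominant_def)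
  have "defines_facet (steiner_cut_dominant ends T) c (2 * s)"
    by (rule defines_facet_scaled_cactus[OF F U T2 s c])
  then show "steiner_degree ends c (2 * s) \<le> n"
    unfolding steiner_degree_le_iff[OF facet F(3)] using T2 T(2) size by (intro exI[of _ T]) simp
qed

text \<open>Validity for all cuts is taken from the facet of the full cut dominant, uniqueness from
  the one for at most five terminals. Uniqueness also bounds leaves plus defects by the number of
  terminals.\<close>

lemma cactus_of_facet:
  assumes V: "2 \<le> CARD('v)" and c: "minimum_integer_form c"
    and facet: "defines_facet (cut_dominant ends) c \<gamma>" and not: "\<not> nonnegativity_constraint c \<gamma>"
    and degree: "steiner_degree ends c \<gamma> \<le> 5"
  obtains F where "edge_disjoint_cycles F" "connected_spanning ends F"
    "card (leaves ends F) + (\<Sum>C\<in>cycles ends F. defect ends F C) \<le> 5" "0 < \<gamma>"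
    "\<And>e. c $ e = \<gamma> / 2 * cactus_vector ends F $ e"
proof -
  let ?K = "{incidence_vector (cut ends S) | S. UNIV \<inter> S \<noteq> {} \<and> UNIV - S \<noteq> {}}"
  have dom: "cut_dominant ends = dominant ?K"
    by (simp add: cut_dominant_def steiner_cut_dominant_def dominant_def)
  have "\<exists>a b :: 'v. a \<noteq> b"
  proof -
    obtain Y :: "'v set" where "card Y = 2" using obtain_subset_with_card_n[OF V] by blast
    then show ?thesis by (auto simp: card_2_iff)
  qed
  then obtain a b :: 'v where "a \<noteq> b" by blast
  then have "UNIV \<inter> {a} \<noteq> {} \<and> UNIV - {a} \<noteq> {}" by auto
  then have "incidence_vector (cut ends {a}) \<in> ?K" by (intro CollectI exI[of _ "{a}"]) simp
  then have K_ne: "?K \<noteq> {}" by (rule ex_in_conv[THEN iffD1, OF exI])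
  have K_nonneg: "0 \<le> k $ e" if k: "k \<in> ?K" for k e
  proof -
    obtain S where "k = incidence_vector (cut ends S)" using k by blast
    then show ?thesis by (simp add: incidence_vector_def)
  qed
  have \<gamma>: "0 < \<gamma>"
    by (rule facet_of_dominant_zero[OF K_ne K_nonneg facet[unfolded dom] c not])
  obtain T where T: "2 \<le> card T" "card T \<le> 5" "defines_facet (steiner_cut_dominant ends T) c \<gamma>"
    using iffD1[OF steiner_degree_le_iff[OF facet V] degree] by blast
  note facet_T = iffD1[OF defines_facet_steiner_iff[OF T(1) \<gamma>] T(3)]
  note facet_V = iffD1[OF defines_facet_steiner_iff[OF V \<gamma>] facet[unfolded cut_dominant_def]]
  have c0: "0 \<le> c $ e" for e by (rule facet_T[THEN conjunct1, rule_format])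
  have cut_ge: "\<gamma> \<le> (\<Sum>e\<in>cut ends S. c $ e)" if "S \<noteq> {}" "S \<noteq> UNIV" for S
  proof (rule facet_V[THEN conjunct2, THEN conjunct1, rule_format])
    show "UNIV \<inter> S \<noteq> {}" "UNIV - S \<noteq> {}" using that by blast+
  qed
  have unique: "d e = 0"
    if "\<And>e. c $ e = 0 \<Longrightarrow> d e = 0"
      "\<And>S. T \<inter> S \<noteq> {} \<Longrightarrow> T - S \<noteq> {} \<Longrightarrow> (\<Sum>e\<in>cut ends S. c $ e) = \<gamma> \<Longrightarrow> (\<Sum>e\<in>cut ends S. d e) = 0"
    for d :: "'e \<Rightarrow> real" and e
    by (rule facet_T[THEN conjunct2, THEN conjunct2, rule_format]) (fact that)+
  define x where "x e = c $ e / \<gamma>" for e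
  have sum_x: "(\<Sum>e\<in>cut ends S. x e) = (\<Sum>e\<in>cut ends S. c $ e) / \<gamma>" for S
    by (simp add: x_def sum_divide_distrib)
  have x0: "0 \<le> x e" for e using c0 \<gamma> by (simp add: x_def)
  have x1: "1 \<le> (\<Sum>e\<in>cut ends S. x e)" if "S \<noteq> {}" "S \<noteq> UNIV" for S
    using cut_ge[OF that] \<gamma> by (simp add: sum_x)
  have "steiner_vertex UNIV (node_weight x) T"
  proof (rule steiner_vertex_node_weight[OF x0 x1])
    fix y :: "'e \<Rightarrow> real" and e
    assume y: "\<And>e. x e = 0 \<Longrightarrow> y e = 0"
      "\<And>S. T \<inter> S \<noteq> {} \<Longrightarrow> T - S \<noteq> {} \<Longrightarrow> (\<Sum>e\<in>cut ends S. x e) = 1 \<Longrightarrow> (\<Sum>e\<in>cut ends S. y e) = 0"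
    show "y e = 0"
    proof (rule unique)
      show "y e = 0" if "c $ e = 0" for e using y(1)[of e] that by (simp add: x_def)
      show "(\<Sum>e\<in>cut ends S. y e) = 0"
        if "T \<inter> S \<noteq> {}" "T - S \<noteq> {}" "(\<Sum>e\<in>cut ends S. c $ e) = \<gamma>" for S
        using y(2)[OF that(1,2)] that(3) \<gamma> by (simp add: sum_x)
    qed
  qed
  then have hc: "half_cactus UNIV (node_weight x)"
    by (rule half_cactus_of_steiner_vertex[OF _ T(2) V])
  define F where "F = {e. x e \<noteq> 0}"
  note cactus = cactus_of_half_cactus[OF x0 x1 hc F_def]
  have eq: "c $ e = \<gamma> / 2 * cactus_vector ends F $ e" for e
    using cactus(3)[of e] \<gamma> by (simp add: x_def field_simps)
  have "cactus_unique F T"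
    unfolding cactus_unique_def
  proof (intro allI impI)
    fix d :: "'e \<Rightarrow> real" and e
    assume d: "\<forall>e. e \<notin> F \<longrightarrow> d e = 0" "\<forall>S. tight_steiner F T S \<longrightarrow> (\<Sum>e\<in>cut ends S. d e) = 0"
    show "d e = 0"
    proof (rule unique)
      show "d e = 0" if "c $ e = 0" for e using d(1) that by (simp add: F_def x_def)
      show "(\<Sum>e\<in>cut ends S. d e) = 0"
        if "T \<inter> S \<noteq> {}" "T - S \<noteq> {}" "(\<Sum>e\<in>cut ends S. c $ e) = \<gamma>" for S
      proof -
        have "(\<Sum>e\<in>cut ends S. c $ e) = \<gamma> / 2 * (\<Sum>e\<in>cut ends S. cactus_vector ends F $ e)"
          by (simp only: eq sum_distrib_left)
        then have "(\<Sum>e\<in>cut ends S. cactus_vector ends F $ e) = 2" using that(3) \<gamma> by simp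
        then show ?thesis using d(2) that(1,2) by (simp add: tight_steiner_def)
      qed
    qed
  qed
  then have "card (leaves ends F) + (\<Sum>C\<in>cycles ends F. defect ends F C) \<le> 5"
    using cactus_size_le_if_unique[OF cactus(2,1) V] T(2) by (meson le_trans)
  then show ?thesis using that[OF cactus(2,1) _ \<gamma> eq] by blast
qed

lemma minimum_integer_form_one:
  assumes "\<And>e. c $ e = real (a e)" "a e = 1"
  shows "minimum_integer_form (c :: real ^ 'e)"
proof -
  have "Gcd (range a) dvd a e" by simp
  then have "Gcd (range a) = 1" using assms(2) by simp
  then show ?thesis using assms(1) by (auto simp: minimum_integer_form_def)
qed

text \<open>An entry one of \<open>a\<close> makes \<open>r\<close> an integer that divides all
  entries of \<open>c\<close>, whose greatest common divisor is one.\<close>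

lemma minimum_integer_form_scale:
  assumes "minimum_integer_form (c :: real ^ 'e)" "\<And>e. c $ e = r * real (a e)" "a e = 1"
  shows "r = 1"
proof -
  obtain b where b: "\<And>e. c $ e = real (b e)" "Gcd (range b) = (1 :: nat)"
    using assms(1) by (auto simp: minimum_integer_form_def)
  have r: "r = real (b e)" using assms(2)[of e] b(1)[of e] assms(3) by simp
  have "b f = b e * a f" for f
  proof -
    have "real (b f) = real (b e * a f)" using assms(2)[of f] b(1)[of f] r by simp
    then show ?thesis by (simp only: of_nat_eq_iff)
  qed
  then have "b e dvd b f" for f by (rule dvdI)
  then have "b e dvd Gcd (range b)" by (intro Gcd_greatest) blast
  then have "b e = 1" by (simp add: b(2))
  then show ?thesis by (simp add: r)
qed

lemma cactus_vector_tree: "cycles ends F = {} \<Longrightarrow> cactus_vector ends F $ e = 2 * incidence_vector F $ e"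
  by (simp add: cactus_vector_def incidence_vector_def)

lemma cycle_nonempty:
  assumes "C \<in> cycles ends F"
  obtains e where "e \<in> C"
proof -
  obtain n x g where "cyclic C n x g" by (rule cyclic_exists[OF cyclesD(1)[OF assms]])
  then show ?thesis using that[of "g 0"] by (simp add: cyclic_def)
qed

end

theorem corollary2:
  fixes ends :: "'e::finite \<Rightarrow> 'v::finite set"
  assumes "simple_graph ends"
    and "connected_spanning ends UNIV"
    and "2 \<le> CARD('v)"
  shows "({(c, \<gamma>). minimum_integer_form c \<and> defines_facet (cut_dominant ends) c \<gamma> \<and>
            \<not> nonnegativity_constraint c \<gamma> \<and> steiner_degree ends c \<gamma> \<le> 5}
       = {(incidence_vector F, 1) | F. spanning_tree ends F \<and> card (leaves ends F) \<le> 5}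
       \<union> {(cactus_vector ends F, 2) | F. spanning_cactus ends F \<and>
            card (leaves ends F) + (\<Sum>C\<in>cycles ends F. defect ends F C) \<le> 5}) \<and>
       (\<forall>F. spanning_cactus ends F \<and>
            card (leaves ends F) + (\<Sum>C\<in>cycles ends F. defect ends F C) \<le> 5 \<longrightarrow>
            card (cycles ends F) \<le> 3)"
    (is "?L = ?R1 \<union> ?R2 \<and> ?N")
proof -
  interpret simple_ends ends by standard (rule assms(1))
  have V: "2 \<le> CARD('v)" by (rule assms(3))
  have cactusD: "connected_spanning ends F" "edge_disjoint_cycles F" "cycles ends F \<noteq> {}"
    if "spanning_cactus ends F" for F
    using that cyclesD(2) unfolding spanning_cactus_def edge_disjoint_cycles_def by blast+
  have edge: "\<exists>e. e \<in> F" if "connected_spanning ends F" for F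
    using connected_incident[OF that V] by (auto simp: incident_def)
  have tree: "(incidence_vector F, 1) \<in> ?L" if F: "spanning_tree ends F" "card (leaves ends F) \<le> 5" for F
  proof -
    have T: "connected_spanning ends F" "cycles ends F = {}" "edge_disjoint_cycles F"
      using F by (auto simp: spanning_tree_def edge_disjoint_cycles_def)
    obtain e where "e \<in> F" using edge[OF T(1)] by blast
    then have "minimum_integer_form (incidence_vector F)"
      by (intro minimum_integer_form_one[of _ "\<lambda>e. if e \<in> F then 1 else 0" e])
        (auto simp: incidence_vector_def)
    \<comment> \<open>The right-hand side one is written as \<open>2 * s\<close> to match
      \<open>cactus_facet\<close>.\<close>
    moreover have "defines_facet (cut_dominant ends) (incidence_vector F) (2 * (1 / 2))"
      "steiner_degree ends (incidence_vector F) (2 * (1 / 2)) \<le> 5"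
      using F T by (intro cactus_facet[OF T(3,1) V]; simp add: cactus_vector_tree)+
    ultimately show ?thesis by (simp add: nonnegativity_constraint_def)
  qed
  have cactus: "(cactus_vector ends F, 2) \<in> ?L"
    if F: "spanning_cactus ends F" "card (leaves ends F) + (\<Sum>C\<in>cycles ends F. defect ends F C) \<le> 5" for F
  proof -
    note T = cactusD[OF F(1)]
    obtain C where C: "C \<in> cycles ends F" using T(3) by blast
    obtain e where e: "e \<in> C" by (rule cycle_nonempty[OF C])
    then have "e \<in> F" using cyclesD(2)[OF C] by blast
    then have "minimum_integer_form (cactus_vector ends F)"
      using C e by (intro minimum_integer_form_one[of _
          "\<lambda>e. if e \<notin> F then 0 else if \<exists>C\<in>cycles ends F. e \<in> C then 1 else 2" e])
        (auto simp: cactus_vector_def)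
    moreover have "defines_facet (cut_dominant ends) (cactus_vector ends F) (2 * 1)"
      "steiner_degree ends (cactus_vector ends F) (2 * 1) \<le> 5"
      using F(2) by (intro cactus_facet[OF T(2,1) V]; simp)+
    ultimately show ?thesis by (simp add: nonnegativity_constraint_def)
  qed
  have "?L \<subseteq> ?R1 \<union> ?R2"
  proof
    fix p
    assume "p \<in> ?L"
    then obtain c \<gamma> where p: "p = (c, \<gamma>)" and c: "minimum_integer_form c"
      "defines_facet (cut_dominant ends) c \<gamma>" "\<not> nonnegativity_constraint c \<gamma>" "steiner_degree ends c \<gamma> \<le> 5"
      by blast
    obtain F where F: "edge_disjoint_cycles F" "connected_spanning ends F"
      "card (leaves ends F) + (\<Sum>C\<in>cycles ends F. defect ends F C) \<le> 5" "0 < \<gamma>"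
      "\<And>e. c $ e = \<gamma> / 2 * cactus_vector ends F $ e"
      by (rule cactus_of_facet[OF V c]) blast
    show "p \<in> ?R1 \<union> ?R2"
    proof (cases "cycles ends F = {}")
      case True
      obtain e where "e \<in> F" using edge[OF F(2)] by blast
      then have "\<gamma> = 1"
        using F(5) True by (intro minimum_integer_form_scale[OF c(1), of _ "\<lambda>e. if e \<in> F then 1 else 0" e])
          (auto simp: cactus_vector_tree incidence_vector_def)
      moreover have "c = incidence_vector F"
        using F(5) \<open>\<gamma> = 1\<close> True by (simp add: vec_eq_iff cactus_vector_tree)
      moreover have "spanning_tree ends F" using F(2) True by (simp add: spanning_tree_def)
      ultimately show ?thesis using p F(3) True by auto
    next
      case False
      then obtain C where C: "C \<in> cycles ends F" by blast
      obtain e where e: "e \<in> C" by (rule cycle_nonempty[OF C])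
      then have "e \<in> F" using cyclesD(2)[OF C] by blast
      then have "\<gamma> / 2 = 1"
        using F(5) C e by (intro minimum_integer_form_scale[OF c(1), of _
            "\<lambda>e. if e \<notin> F then 0 else if \<exists>C\<in>cycles ends F. e \<in> C then 1 else 2" e])
          (auto simp: cactus_vector_def)
      then have "\<gamma> = 2" by simp
      moreover have "c = cactus_vector ends F" using F(5) \<open>\<gamma> = 2\<close> by (simp add: vec_eq_iff)
      moreover have "spanning_cactus ends F"
        using F(1,2) False unfolding spanning_cactus_def edge_disjoint_cycles_def by blast
      ultimately show ?thesis using p F(3) by blast
    qed
  qed
  moreover have "?R1 \<union> ?R2 \<subseteq> ?L" using tree cactus by blast
  moreover have ?N
  proof (intro allI impI)
    fix F
    assume F: "spanning_cactus ends F \<and> card (leaves ends F) + (\<Sum>C\<in>cycles ends F. defect ends F C) \<le> 5"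
    note T = cactusD[OF conjunct1[OF F]]
    have "card (cycles ends F) + 2 \<le> 5"
      using card_cycles_le[OF T(2,1) V] conjunct2[OF F] by (rule le_trans)
    then show "card (cycles ends F) \<le> 3" by simp
  qed
  ultimately show ?thesis by (intro conjI equalityI)
qed

end
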